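(* Let $g\in H^1(\Omega)$ and let $V$ be a closed subspace of $H^1(\Omega)$ with $H^1_0(\Omega)\subset V\subset H^1(\Omega)$. Suppose that the functional $$\mathcal{E}(v,\varphi):=\int_\Omega W\bigl(\varphi(x),v(x),[A(\varphi)(x)]\nabla v(x)\bigr)\,\kappa(\varphi)(x)\,dx\qquad(v\in H^1(\Omega),\ \varphi\in\mathcal{O}(\Omega))$$ belongs to $C^0(H^1(\Omega)\times\mathcal{O}(\Omega))$, that $\mathcal{E}(v,\cdot)\in C^1(\mathcal{O}(\Omega))$ for every $v\in H^1(\Omega)$, and that $\partial_\varphi\mathcal{E}\in C^0\bigl(H^1(\Omega)\times\mathcal{O}(\Omega),(W^{1,\infty}(\Omega_0,\mathbb{R}^n))'\bigr)$. Let $\mathcal{U}_0\subset V$ and $\mathcal{O}_0\subset\mathcal{O}(\Omega)$ be open subsets with $\varphi_0\in\mathcal{O}_0$, and define $\mathcal{U}(\varphi,g):=\varphi_*(\mathcal{U}_0+g)\subset V(\varphi,g)$. Suppose that for every $\varphi\in\mathcal{O}_0$, $u(\varphi)\in\mathcal{U}(\varphi,g)$ is a global minimizer of $E(\cdot,\Omega(\varphi))$ in $\mathcal{U}(\varphi,g)$, and that the map $\varphi\mapsto\varphi_*^{-1}u(\varphi)$ belongs to $C^0(\mathcal{O}_0,H^1(\Omega))$. Then $E_*(\varphi):=E(u(\varphi),\Omega(\varphi))$ satisfies $E_*\in C^1(\mathcal{O}_0)$ and $$E_*'(\varphi)=\partial_\varphi\mathcal{E}(\varphi_*^{-1}u(\varphi),\varphi)\qquad(\varphi\in\mathcal{O}_0).$$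 In particular, $E_*'(\varphi_0)=\partial_\varphi\mathcal{E}(u(\varphi_0),\varphi_0)$.
   Context: Let $n\in\mathbb{N}$, let $\Omega_0\subset\mathbb{R}^n$ be a fixed bounded convex open set and $\Omega$ an open set with $\overline\Omega\subset\Omega_0$. $W^{1,\infty}(\Omega_0,\mathbb{R}^n)$ is identified with $C^{0,1}(\overline{\Omega_0},\mathbb{R}^n)$. $\varphi_0(x)=x$ is the identity; $|u|_{\mathrm{Lip},\Omega_0}:=\sup_{x\ne y\in\Omega_0}|u(x)-u(y)|/|x-y|$. For a map $\varphi$ put $\Omega(\varphi):=\varphi(\Omega)$, and $$\mathcal{O}(\Omega):=\{\varphi\in W^{1,\infty}(\Omega_0,\mathbb{R}^n):\ |\varphi-\varphi_0|_{\mathrm{Lip},\Omega_0}<1,\ \overline{\Omega(\varphi)}\subset\Omega_0\},$$ an open subset of $W^{1,\infty}(\Omega_0,\mathbb{R}^n)$; each $\varphi\in\mathcal{O}(\Omega)$ is bi-Lipschitz from $\Omega_0$ onto an open set. $\varphi_*v:=v\circ\varphi^{-1}$ is the pushforward (an isomorphism $H^1(\Omega)\to H^1(\Omega(\varphi))$), with inverse $\varphi_*^{-1}$. $\nabla\varphi^{\mathrm T}$ is the matrix with $(i,j)$ entry $\partial\varphi_j/\partial x_i$; $A(\varphi):=(\nabla\varphi^{\mathrm T})^{-1}$, $\kappa(\varphi):=\det\nabla\varphi^{\mathrm T}$. $W(\xi,\eta,\zeta)\in\mathbb{R}$, $(\xi,\eta,\zeta)\in\Omega_0\times\mathbb{R}\times\mathbb{R}^n$,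 is a given energy density such that the integrals considered are well defined; for an open $G$ with $\overline G\subset\Omega_0$ and $v\in H^1(G)$, $E(v,G):=\int_G W(x,v(x),\nabla v(x))\,dx$. One has $E(\varphi_*v,\Omega(\varphi))=\mathcal{E}(v,\varphi)$. $V(g):=\{v\in H^1(\Omega): v-g\in V\}$ and $V(\varphi,g):=\varphi_*(V(g))$. $\partial_\varphi\mathcal{E}$ is the partial Fréchet derivative of $\mathcal{E}$ with respect to $\varphi\in\mathcal{O}(\Omega)\subset W^{1,\infty}(\Omega_0,\mathbb{R}^n)$; prime on a Banach space denotes the dual; $E_*'$ is the Fréchet derivative. A global minimizer of a functional in a set is a point of the set where the functional attains its minimum over the set. "Open in $V$" is with respect to the $H^1(\Omega)$-norm. *)

theory Defs
  imports "HOL-Analysis.Analysis"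
begin

text \<open>
  Elements of the function spaces below are total functions standing for their restriction to the
  domain (and, for Sobolev functions, for their class modulo null sets). The norms are therefore
  only seminorms on these representatives; sets that are open or closed in the induced topologies
  are automatically saturated, and continuous maps and bounded functionals respect the
  identification.
\<close>

subsection \<open>Seminormed spaces of functions\<close>

definition seminorm_topology ::
    "('a \<Rightarrow> 'b::real_vector) set \<Rightarrow> (('a \<Rightarrow> 'b) \<Rightarrow> real) \<Rightarrow> ('a \<Rightarrow> 'b) topology" where
  "seminorm_topology C N =
     topology (\<lambda>U. U \<subseteq> C \<and> (\<forall>f\<in>U. \<exists>e>0. \<forall>h\<in>C. N (\<lambda>x. h x - f x) < e \<longrightarrow> h \<in> U))"

lemma openin_seminorm_topology:
  "openin (seminorm_topology C N) U \<longleftrightarrow>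
     U \<subseteq> C \<and> (\<forall>f\<in>U. \<exists>e>0. \<forall>h\<in>C. N (\<lambda>x. h x - f x) < e \<longrightarrow> h \<in> U)"
proof -
  let ?P = "\<lambda>U. U \<subseteq> C \<and> (\<forall>f\<in>U. \<exists>e>0. \<forall>h\<in>C. N (\<lambda>x. h x - f x) < e \<longrightarrow> h \<in> U)"
  have "istopology ?P"
    unfolding istopology_def
  proof (intro conjI allI impI)
    fix S T assume S: "?P S" and T: "?P T"
    show "S \<inter> T \<subseteq> C" using S by blast
    show "\<forall>f\<in>S \<inter> T. \<exists>e>0. \<forall>h\<in>C. N (\<lambda>x. h x - f x) < e \<longrightarrow> h \<in> S \<inter> T"
    proof
      fix f assume f: "f \<in> S \<inter> T"
      from S f obtain d where "d > 0" "\<forall>h\<in>C. N (\<lambda>x. h x - f x) < d \<longrightarrow> h \<in> S" by blast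
      moreover from T f obtain e where "e > 0" "\<forall>h\<in>C. N (\<lambda>x. h x - f x) < e \<longrightarrow> h \<in> T" by blast
      ultimately show "\<exists>e>0. \<forall>h\<in>C. N (\<lambda>x. h x - f x) < e \<longrightarrow> h \<in> S \<inter> T"
        by (intro exI[of _ "min d e"]) auto
    qed
  next
    fix \<K> assume K: "\<forall>K\<in>\<K>. ?P K"
    show "\<Union> \<K> \<subseteq> C" using K by blast
    show "\<forall>f\<in>\<Union> \<K>. \<exists>e>0. \<forall>h\<in>C. N (\<lambda>x. h x - f x) < e \<longrightarrow> h \<in> \<Union> \<K>"
      using K by (meson UnionE UnionI)
  qed
  then show ?thesis
    unfolding seminorm_topology_def by (simp add: topology_inverse')
qed

lemma topspace_seminorm_topology [simp]: "topspace (seminorm_topology C N) = C"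
proof -
  have "openin (seminorm_topology C N) C"
    unfolding openin_seminorm_topology by (auto intro: exI[of _ 1])
  then show ?thesis
    by (metis openin_seminorm_topology openin_subset openin_topspace subset_antisym)
qed

definition linear_subspace :: "('a \<Rightarrow> 'b::real_vector) set \<Rightarrow> bool" where
  "linear_subspace V \<longleftrightarrow> (\<lambda>x. 0) \<in> V \<and>
     (\<forall>f\<in>V. \<forall>h\<in>V. (\<lambda>x. f x + h x) \<in> V) \<and> (\<forall>c. \<forall>f\<in>V. (\<lambda>x. c *\<^sub>R f x) \<in> V)"

text \<open>Functionals are set to zero off the carrier, so that equality in the dual is equality in HOL.\<close>

definition dual_space ::
    "('a \<Rightarrow> 'b::real_vector) set \<Rightarrow> (('a \<Rightarrow> 'b) \<Rightarrow> real) \<Rightarrow> (('a \<Rightarrow> 'b) \<Rightarrow> real) set" where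
  "dual_space C N = {L.
     (\<forall>f. f \<notin> C \<longrightarrow> L f = 0) \<and>
     (\<forall>f\<in>C. \<forall>h\<in>C. L (\<lambda>x. f x + h x) = L f + L h) \<and>
     (\<forall>c. \<forall>f\<in>C. L (\<lambda>x. c *\<^sub>R f x) = c * L f) \<and>
     (\<exists>B. \<forall>f\<in>C. \<bar>L f\<bar> \<le> B * N f)}"

definition dual_norm ::
    "('a \<Rightarrow> 'b::real_vector) set \<Rightarrow> (('a \<Rightarrow> 'b) \<Rightarrow> real) \<Rightarrow> (('a \<Rightarrow> 'b) \<Rightarrow> real) \<Rightarrow> real" where
  "dual_norm C N L = (SUP f\<in>{f\<in>C. N f \<le> 1}. \<bar>L f\<bar>)"

definition dual_topology ::
    "('a \<Rightarrow> 'b::real_vector) set \<Rightarrow> (('a \<Rightarrow> 'b) \<Rightarrow> real) \<Rightarrow> (('a \<Rightarrow> 'b) \<Rightarrow> real) topology" where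
  "dual_topology C N = seminorm_topology (dual_space C N) (dual_norm C N)"

text \<open>
  The Frechet derivative at an interior point of the set on which the functional is considered;
  values of the functional away from the point play no role.
\<close>

definition has_dual_derivative ::
    "('a \<Rightarrow> 'b::real_vector) set \<Rightarrow> (('a \<Rightarrow> 'b) \<Rightarrow> real) \<Rightarrow> (('a \<Rightarrow> 'b) \<Rightarrow> real) \<Rightarrow>
     (('a \<Rightarrow> 'b) \<Rightarrow> real) \<Rightarrow> ('a \<Rightarrow> 'b) \<Rightarrow> bool" where
  "has_dual_derivative C N F L f \<longleftrightarrow> L \<in> dual_space C N \<and>
     (\<forall>e>0. \<exists>d>0. \<forall>h\<in>C. N h < d \<longrightarrow> \<bar>F (\<lambda>x. f x + h x) - F f - L h\<bar> \<le> e * N h)"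

definition dual_derivative ::
    "('a \<Rightarrow> 'b::real_vector) set \<Rightarrow> (('a \<Rightarrow> 'b) \<Rightarrow> real) \<Rightarrow> (('a \<Rightarrow> 'b) \<Rightarrow> real) \<Rightarrow>
     ('a \<Rightarrow> 'b) \<Rightarrow> (('a \<Rightarrow> 'b) \<Rightarrow> real)" where
  "dual_derivative C N F f = (SOME L. has_dual_derivative C N F L f)"

definition C1_functional_on ::
    "('a \<Rightarrow> 'b::real_vector) set \<Rightarrow> (('a \<Rightarrow> 'b) \<Rightarrow> real) \<Rightarrow> ('a \<Rightarrow> 'b) set \<Rightarrow>
     (('a \<Rightarrow> 'b) \<Rightarrow> real) \<Rightarrow> bool" where
  "C1_functional_on C N S F \<longleftrightarrow>
     (\<forall>f\<in>S. \<exists>L. has_dual_derivative C N F L f) \<and>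
     continuous_map (subtopology (seminorm_topology C N) S) (dual_topology C N)
       (dual_derivative C N F)"

subsection \<open>Weak gradients and Sobolev spaces\<close>

definition partial_deriv :: "'n::finite \<Rightarrow> (real^'n \<Rightarrow> real) \<Rightarrow> real^'n \<Rightarrow> real" where
  "partial_deriv i f x = frechet_derivative f (at x) (axis i 1)"

primrec Ck :: "nat \<Rightarrow> (real^'n::finite \<Rightarrow> real) \<Rightarrow> bool" where
  "Ck 0 f \<longleftrightarrow> continuous_on UNIV f"
| "Ck (Suc k) f \<longleftrightarrow> (\<forall>x. f differentiable at x) \<and> (\<forall>i. Ck k (partial_deriv i f))"

definition test_functions :: "(real^'n::finite) set \<Rightarrow> (real^'n \<Rightarrow> real) set" where
  "test_functions G = {\<psi>. (\<forall>k. Ck k \<psi>) \<and>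
     compact (closure {x. \<psi> x \<noteq> 0}) \<and> closure {x. \<psi> x \<noteq> 0} \<subseteq> G}"

definition locally_integrable_on ::
    "(real^'n::finite \<Rightarrow> 'b::{banach, second_countable_topology}) \<Rightarrow> (real^'n) set \<Rightarrow> bool" where
  "locally_integrable_on f G \<longleftrightarrow> (\<forall>K. compact K \<and> K \<subseteq> G \<longrightarrow> set_integrable lebesgue K f)"

definition has_weak_gradient ::
    "(real^'n::finite) set \<Rightarrow> (real^'n \<Rightarrow> real) \<Rightarrow> (real^'n \<Rightarrow> real^'n) \<Rightarrow> bool" where
  "has_weak_gradient G v p \<longleftrightarrow>
     locally_integrable_on v G \<and> locally_integrable_on p G \<and>
     (\<forall>\<psi>\<in>test_functions G. \<forall>i.
        (LINT x:G|lebesgue. v x * partial_deriv i \<psi> x) = - (LINT x:G|lebesgue. p x $ i * \<psi> x))"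

text \<open>Determined only up to a null set.\<close>

definition weak_gradient ::
    "(real^'n::finite) set \<Rightarrow> (real^'n \<Rightarrow> real) \<Rightarrow> real^'n \<Rightarrow> real^'n" where
  "weak_gradient G v = (SOME p. has_weak_gradient G v p)"

definition L2 ::
    "(real^'n::finite) set \<Rightarrow> (real^'n \<Rightarrow> 'b::{banach, second_countable_topology}) set" where
  "L2 G = {f. set_borel_measurable lebesgue G f \<and> set_integrable lebesgue G (\<lambda>x. (norm (f x))\<^sup>2)}"

definition H1 :: "(real^'n::finite) set \<Rightarrow> (real^'n \<Rightarrow> real) set" where
  "H1 G = {v \<in> L2 G. \<exists>p\<in>L2 G. has_weak_gradient G v p}"

definition H1_norm :: "(real^'n::finite) set \<Rightarrow> (real^'n \<Rightarrow> real) \<Rightarrow> real" where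
  "H1_norm G v = sqrt ((LINT x:G|lebesgue. (v x)\<^sup>2) + (LINT x:G|lebesgue. (norm (weak_gradient G v x))\<^sup>2))"

definition H1_topology :: "(real^'n::finite) set \<Rightarrow> (real^'n \<Rightarrow> real) topology" where
  "H1_topology G = seminorm_topology (H1 G) (H1_norm G)"

definition H10 :: "(real^'n::finite) set \<Rightarrow> (real^'n \<Rightarrow> real) set" where
  "H10 G = (H1_topology G) closure_of (test_functions G)"

text \<open>The inserted \<open>0\<close> only matters for the empty domain.\<close>

definition sup_norm :: "(real^'n::finite) set \<Rightarrow> (real^'n \<Rightarrow> real^'n) \<Rightarrow> real" where
  "sup_norm G u = Sup (insert 0 {norm (u x) | x. x \<in> G})"

definition Lip_seminorm :: "(real^'n::finite) set \<Rightarrow> (real^'n \<Rightarrow> real^'n) \<Rightarrow> real" where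
  "Lip_seminorm G u =
     Sup (insert 0 {norm (u x - u y) / norm (x - y) | x y. x \<in> G \<and> y \<in> G \<and> x \<noteq> y})"

text \<open>
  Lipschitz representatives of the elements of \<open>W\<^sup>1\<^sup>,\<^sup>\<infinity>(G, \<real>\<^sup>n)\<close>, with the
  norm of \<open>C\<^sup>0\<^sup>,\<^sup>1\<close>. For bounded convex open \<open>G\<close> every element of
  \<open>W\<^sup>1\<^sup>,\<^sup>\<infinity>\<close> has a unique such representative, the two norms are equivalent, and
  conversely every Lipschitz map satisfies the other conditions.
\<close>

definition W1inf :: "(real^'n::finite) set \<Rightarrow> (real^'n \<Rightarrow> real^'n) set" where
  "W1inf G = {u. bounded (u ` G) \<and> (\<exists>L. L-lipschitz_on G u) \<and>
     (\<forall>j. \<exists>p B. has_weak_gradient G (\<lambda>x. u x $ j) p \<and> (AE x\<in>G in lebesgue. norm (p x) \<le> B))}"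

definition W1inf_norm :: "(real^'n::finite) set \<Rightarrow> (real^'n \<Rightarrow> real^'n) \<Rightarrow> real" where
  "W1inf_norm G u = sup_norm G u + Lip_seminorm G u"

definition W1inf_topology :: "(real^'n::finite) set \<Rightarrow> (real^'n \<Rightarrow> real^'n) topology" where
  "W1inf_topology G = seminorm_topology (W1inf G) (W1inf_norm G)"

subsection \<open>Domain perturbations and energies\<close>

definition admissible ::
    "(real^'n::finite) set \<Rightarrow> (real^'n) set \<Rightarrow> (real^'n \<Rightarrow> real^'n) set" where
  "admissible \<Omega>0 \<Omega> =
     {\<phi> \<in> W1inf \<Omega>0. Lip_seminorm \<Omega>0 (\<lambda>x. \<phi> x - x) < 1 \<and> closure (\<phi> ` \<Omega>) \<subseteq> \<Omega>0}"

definition gradT ::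
    "(real^'n::finite) set \<Rightarrow> (real^'n \<Rightarrow> real^'n) \<Rightarrow> real^'n \<Rightarrow> real^'n^'n" where
  "gradT \<Omega>0 \<phi> x = (\<chi> i j. weak_gradient \<Omega>0 (\<lambda>y. \<phi> y $ j) x $ i)"

definition A_mat ::
    "(real^'n::finite) set \<Rightarrow> (real^'n \<Rightarrow> real^'n) \<Rightarrow> real^'n \<Rightarrow> real^'n^'n" where
  "A_mat \<Omega>0 \<phi> x = matrix_inv (gradT \<Omega>0 \<phi> x)"

definition kappa :: "(real^'n::finite) set \<Rightarrow> (real^'n \<Rightarrow> real^'n) \<Rightarrow> real^'n \<Rightarrow> real" where
  "kappa \<Omega>0 \<phi> x = det (gradT \<Omega>0 \<phi> x)"

definition pushforward ::
    "(real^'n::finite) set \<Rightarrow> (real^'n \<Rightarrow> real^'n) \<Rightarrow> (real^'n \<Rightarrow> real) \<Rightarrow> real^'n \<Rightarrow> real" where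
  "pushforward \<Omega>0 \<phi> v = v \<circ> inv_into \<Omega>0 \<phi>"

definition pullback ::
    "(real^'n::finite \<Rightarrow> real^'n) \<Rightarrow> (real^'n \<Rightarrow> real) \<Rightarrow> real^'n \<Rightarrow> real" where
  "pullback \<phi> w = w \<circ> \<phi>"

text \<open>\<open>\<phi>\<^sub>*(\<U> + g)\<close>, containing every representative on \<open>\<phi>(\<Omega>)\<close> of its members.\<close>

definition transported_set ::
    "(real^'n::finite) set \<Rightarrow> (real^'n) set \<Rightarrow> (real^'n \<Rightarrow> real) set \<Rightarrow> (real^'n \<Rightarrow> real) \<Rightarrow>
     (real^'n \<Rightarrow> real^'n) \<Rightarrow> (real^'n \<Rightarrow> real) set" where
  "transported_set \<Omega>0 \<Omega> \<U> g \<phi> =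
     {w. \<exists>v\<in>\<U>. AE y\<in>\<phi> ` \<Omega> in lebesgue. w y = pushforward \<Omega>0 \<phi> (\<lambda>x. v x + g x) y}"

definition energy ::
    "(real^'n::finite \<Rightarrow> real \<Rightarrow> real^'n \<Rightarrow> real) \<Rightarrow> (real^'n \<Rightarrow> real) \<Rightarrow> (real^'n) set \<Rightarrow> real" where
  "energy W v G = (LINT x:G|lebesgue. W x (v x) (weak_gradient G v x))"

definition ref_density ::
    "(real^'n::finite \<Rightarrow> real \<Rightarrow> real^'n \<Rightarrow> real) \<Rightarrow> (real^'n) set \<Rightarrow> (real^'n) set \<Rightarrow>
     (real^'n \<Rightarrow> real) \<Rightarrow> (real^'n \<Rightarrow> real^'n) \<Rightarrow> real^'n \<Rightarrow> real" where
  "ref_density W \<Omega>0 \<Omega> v \<phi> x =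
     W (\<phi> x) (v x) (A_mat \<Omega>0 \<phi> x *v weak_gradient \<Omega> v x) * kappa \<Omega>0 \<phi> x"

definition ref_energy ::
    "(real^'n::finite \<Rightarrow> real \<Rightarrow> real^'n \<Rightarrow> real) \<Rightarrow> (real^'n) set \<Rightarrow> (real^'n) set \<Rightarrow>
     (real^'n \<Rightarrow> real) \<Rightarrow> (real^'n \<Rightarrow> real^'n) \<Rightarrow> real" where
  "ref_energy W \<Omega>0 \<Omega> v \<phi> = (LINT x:\<Omega>|lebesgue. ref_density W \<Omega>0 \<Omega> v \<phi> x)"

definition W1inf_derivative ::
    "(real^'n::finite) set \<Rightarrow> ((real^'n \<Rightarrow> real^'n) \<Rightarrow> real) \<Rightarrow>
     (real^'n \<Rightarrow> real^'n) \<Rightarrow> (real^'n \<Rightarrow> real^'n) \<Rightarrow> real" where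
  "W1inf_derivative \<Omega>0 F \<phi> = dual_derivative (W1inf \<Omega>0) (W1inf_norm \<Omega>0) F \<phi>"

definition E_star ::
    "(real^'n::finite \<Rightarrow> real \<Rightarrow> real^'n \<Rightarrow> real) \<Rightarrow> (real^'n) set \<Rightarrow>
     ((real^'n \<Rightarrow> real^'n) \<Rightarrow> real^'n \<Rightarrow> real) \<Rightarrow> (real^'n \<Rightarrow> real^'n) \<Rightarrow> real" where
  "E_star W \<Omega> u \<phi> = energy W (u \<phi>) (\<phi> ` \<Omega>)"

end

theory Submission imports Defs begin

text \<open>
  Comparing the minimizer at one perturbation with the competitor obtained by transporting it to
  another one bounds the increments of \<open>E\<^sub>*\<close> from above and below by increments of \<open>\<E>\<close> at fixed
  first argument; by the mean value theorem and the continuity of \<open>\<partial>\<^sub>\<phi>\<E>\<close> both are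
  \<open>\<partial>\<^sub>\<phi>\<E>(\<phi>\<^sub>*\<^sup>-\<^sup>1u(\<phi>), \<phi>)h + o(h)\<close>.

  The comparison rests on the identity \<open>E(\<phi>\<^sub>*v, \<phi>(\<Omega>)) = \<E>(v, \<phi>)\<close>, that is, on the change of
  variables and the chain rule for weak gradients under a bi-Lipschitz map. Rademacher's theorem is
  avoided: the mollifications \<open>\<Phi> k\<close> of \<open>\<phi>\<close> are smooth, are perturbations of the identity with the
  same Lipschitz constant, converge uniformly, and their Jacobians converge almost everywhere along
  a subsequence to the weak one. The smooth change of variables therefore passes to the limit for
  continuous integrands with compact support, which determines the image measure. For the chain
  rule, the weak gradient of \<open>v\<close> is tested with cofactors of the Jacobian of \<open>\<Phi> k\<close> times
  \<open>\<zeta> \<circ> \<Phi> k\<close>; the cofactors are divergence free by the Piola identity.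
\<close>

section \<open>Calculus of smooth functions\<close>

text \<open>The obstacle is that \<phi> is merely Lipschitz: its Jacobian is available only as a
  weak gradient, fixed up to a null set, and its effect on measures is not directly accessible.
  Mollification works because the condition \<open>norm ((\<phi> x - \<phi> y) - (x - y)) \<le> L *
  norm (x - y)\<close> is convex in \<phi>, so averages inherit it with the same \<open>L\<close>.
  As \<open>L < 1\<close>, each approximant is injective, has a positive Jacobian determinant
  (absolute values disappear) and Jacobian entries of size at most 2 (constants dominate on the
  bounded domain). Testing with cofactors has two benefits: \<open>v\<close> itself is never
  approximated, and the product of the determinant with the inverse transpose becomes a polynomial
  in the Jacobian entries, which passes to almost everywhere limits without any estimate of
  inverses. In the final comparison the lower bound fixes a first argument that itself moves with
  the perturbation; this is where the continuity of the pulled-back minimizers and the joint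
  continuity of the derivative enter.\<close>

lemma partial_deriv_eqI:
  "(f has_derivative D) (at x) \<Longrightarrow> partial_deriv i f x = D (axis i 1)"
  by (simp add: partial_deriv_def frechet_derivative_at[symmetric])

lemma linear_eq_sum_axis:
  fixes D :: "real^'n::finite \<Rightarrow> real"
  assumes "linear D"
  shows "D h = (\<Sum>i\<in>UNIV. h $ i * D (axis i 1))"
proof -
  have "D h = D (\<Sum>i\<in>UNIV. h $ i *\<^sub>R axis i 1)"
    using basis_expansion[of h] by (simp add: scalar_mult_eq_scaleR)
  also have "\<dots> = (\<Sum>i\<in>UNIV. h $ i * D (axis i 1))"
    using assms by (simp add: linear_sum linear_cmul)
  finally show ?thesis .
qed

lemma has_derivative_partials:
  fixes f :: "real^'n::finite \<Rightarrow> real"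
  assumes "f differentiable at x"
  shows "(f has_derivative (\<lambda>h. \<Sum>i\<in>UNIV. h $ i * partial_deriv i f x)) (at x)"
proof -
  obtain D where D: "(f has_derivative D) (at x)"
    using assms differentiable_def by blast
  have "D = (\<lambda>h. \<Sum>i\<in>UNIV. h $ i * partial_deriv i f x)"
    unfolding partial_deriv_eqI[OF D]
    by (intro ext linear_eq_sum_axis has_derivative_linear[OF D])
  with D show ?thesis by metis
qed

lemma has_derivative_vec:
  fixes \<phi> :: "'a::real_normed_vector \<Rightarrow> real^'n::finite"
  assumes "\<And>j. ((\<lambda>x. \<phi> x $ j) has_derivative (\<lambda>h. D h $ j)) (at x)"
  shows "(\<phi> has_derivative D) (at x)"
  by (subst has_derivative_componentwise_within)
     (use assms in \<open>auto simp: Basis_vec_def inner_axis\<close>)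

lemma Ck_continuous: "Ck k f \<Longrightarrow> continuous_on UNIV f"
  by (cases k) (auto intro!: continuous_at_imp_continuous_on differentiable_imp_continuous_within)

lemma Ck_SucD: "Ck (Suc k) f \<Longrightarrow> Ck k f"
  by (induction k arbitrary: f)
     (auto intro!: continuous_at_imp_continuous_on differentiable_imp_continuous_within)

lemma Ck_SucI:
  assumes "\<And>x. (f has_derivative D x) (at x)" and "\<And>i. Ck k (\<lambda>x. D x (axis i 1))"
  shows "Ck (Suc k) f"
proof -
  have "partial_deriv i f = (\<lambda>x. D x (axis i 1))" for i
    using partial_deriv_eqI[OF assms(1)] by auto
  then show ?thesis using assms by (auto simp: differentiable_def)
qed

lemma Ck_Suc_has_derivative:
  "Ck (Suc k) f \<Longrightarrow> (f has_derivative (\<lambda>h. \<Sum>i\<in>UNIV. h $ i * partial_deriv i f x)) (at x)"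
  by (auto intro: has_derivative_partials)

lemma Ck_const: "Ck k (\<lambda>x. c)"
proof (induction k arbitrary: c)
  case (Suc k)
  show ?case by (rule Ck_SucI[where D = "\<lambda>x h. 0"]) (auto simp: Suc)
qed auto

lemma Ck_add: "Ck k f \<Longrightarrow> Ck k g \<Longrightarrow> Ck k (\<lambda>x. f x + g x)"
proof (induction k arbitrary: f g)
  case (Suc k)
  show ?case
    by (rule Ck_SucI, rule has_derivative_add[OF Suc.prems[THEN Ck_Suc_has_derivative]])
       (use Suc in \<open>auto simp: axis_def if_distrib if_distribR cong: if_cong\<close>)
qed (auto intro: continuous_on_add)

lemma Ck_mult: "Ck k f \<Longrightarrow> Ck k g \<Longrightarrow> Ck k (\<lambda>x. f x * g x)"
proof (induction k arbitrary: f g)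
  case (Suc k)
  note * = Suc.prems[THEN Ck_Suc_has_derivative]
  have "Ck k (\<lambda>x. f x * partial_deriv i g x + partial_deriv i f x * g x)" for i
    using Suc.prems Suc.prems[THEN Ck_SucD] by (intro Ck_add Suc.IH) auto
  then show ?case
    by - (rule Ck_SucI, rule has_derivative_mult[OF *],
      auto simp: axis_def if_distrib if_distribR cong: if_cong)
qed (auto intro: continuous_on_mult)

lemma Ck_sum: "(\<And>a. a \<in> A \<Longrightarrow> Ck k (f a)) \<Longrightarrow> Ck k (\<lambda>x. \<Sum>a\<in>A. f a x)"
  by (induction A rule: infinite_finite_induct) (auto intro: Ck_const Ck_add)

lemma Ck_prod: "(\<And>a. a \<in> A \<Longrightarrow> Ck k (f a)) \<Longrightarrow> Ck k (\<lambda>x. \<Prod>a\<in>A. f a x)"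
  by (induction A rule: infinite_finite_induct) (auto intro: Ck_const Ck_mult)

lemma Ck_component: "Ck k (\<lambda>x. x $ i)"
proof (cases k)
  case (Suc m)
  show ?thesis unfolding Suc
    by (rule Ck_SucI[where D = "\<lambda>x h. h $ i"])
       (auto intro: Ck_const bounded_linear.has_derivative[OF bounded_linear_vec_nth] has_derivative_ident)
qed (auto intro: continuous_intros)

text \<open>The row index is the component and the column index the direction of differentiation, so
  this is the transpose of the convention of \<open>gradT\<close>. With it the derivative is
  \<open>jacobian \<phi> x *v h\<close>.\<close>

definition jacobian :: "(real^'n \<Rightarrow> real^'n) \<Rightarrow> real^'n \<Rightarrow> real^'n^'n::finite" where
  "jacobian \<phi> x = (\<chi> j i. partial_deriv i (\<lambda>x. \<phi> x $ j) x)"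

lemma jacobian_has_derivative:
  assumes "\<And>j. Ck (Suc 0) (\<lambda>x. \<phi> x $ j)"
  shows "(\<phi> has_derivative (\<lambda>h. jacobian \<phi> x *v h)) (at x)"
proof (rule has_derivative_vec)
  fix j show "((\<lambda>x. \<phi> x $ j) has_derivative (\<lambda>h. (jacobian \<phi> x *v h) $ j)) (at x)"
    using Ck_Suc_has_derivative[OF assms[of j], of x]
    by (simp add: jacobian_def matrix_vector_mult_def mult.commute)
qed

lemma Ck_imp_Ck1: "Ck (Suc k) f \<Longrightarrow> Ck (Suc 0) f"
  by (auto dest: Ck_continuous)

lemma has_derivative_compose_partials:
  assumes "\<psi> differentiable at (\<phi> x)" and "\<And>j. Ck (Suc 0) (\<lambda>x. \<phi> x $ j)"
  shows "((\<lambda>x. \<psi> (\<phi> x)) has_derivative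
           (\<lambda>h. \<Sum>j\<in>UNIV. (jacobian \<phi> x *v h) $ j * partial_deriv j \<psi> (\<phi> x))) (at x)"
  using has_derivative_compose[OF jacobian_has_derivative[OF assms(2)] has_derivative_partials[OF assms(1)]]
  by simp

lemma partial_deriv_compose:
  assumes "\<psi> differentiable at (\<phi> x)" and "\<And>j. Ck (Suc 0) (\<lambda>x. \<phi> x $ j)"
  shows "partial_deriv i (\<lambda>x. \<psi> (\<phi> x)) x
           = (\<Sum>j\<in>UNIV. jacobian \<phi> x $ j $ i * partial_deriv j \<psi> (\<phi> x))"
  by (subst partial_deriv_eqI[OF has_derivative_compose_partials[OF assms]])
     (auto simp: matrix_vector_mult_basis column_def)

text \<open>By the chain rule the partials of the composite are sums of products of Jacobian entries
  with partials of \<psi> composed with the same \<phi>. Hence the induction on the order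
  generalises over \<psi> and keeps \<phi> fixed.\<close>

lemma Ck_compose:
  fixes \<phi> :: "real^'n \<Rightarrow> real^'n::finite"
  assumes "Ck k \<psi>" and "\<And>j. Ck k (\<lambda>x. \<phi> x $ j)"
  shows "Ck k (\<lambda>x. \<psi> (\<phi> x))"
  using assms
proof (induction k arbitrary: \<psi>)
  case 0
  have "continuous_on UNIV \<phi>"
    using 0(2) by (subst continuous_on_componentwise) (auto simp: Basis_vec_def inner_axis)
  then show ?case using 0(1) by (auto intro: continuous_on_compose2)
next
  case (Suc k)
  have 1: "Ck (Suc 0) (\<lambda>x. \<phi> x $ j)" for j using Suc.prems(2) Ck_imp_Ck1 by blast
  have d: "\<psi> differentiable at y" for y using Suc.prems(1) by auto
  have "Ck k (\<lambda>x. jacobian \<phi> x $ j $ i * partial_deriv j \<psi> (\<phi> x))" for i j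
  proof (rule Ck_mult)
    show "Ck k (\<lambda>x. jacobian \<phi> x $ j $ i)"
      using Suc.prems(2) by (simp add: jacobian_def)
    show "Ck k (\<lambda>x. partial_deriv j \<psi> (\<phi> x))"
      by (rule Suc.IH) (use Suc.prems(1) Suc.prems(2)[THEN Ck_SucD] in simp_all)
  qed
  then have "Ck k (\<lambda>x. \<Sum>j\<in>UNIV. jacobian \<phi> x $ j $ i * partial_deriv j \<psi> (\<phi> x))" for i
    by (intro Ck_sum)
  moreover have "partial_deriv i (\<lambda>x. \<psi> (\<phi> x))
      = (\<lambda>x. \<Sum>j\<in>UNIV. jacobian \<phi> x $ j $ i * partial_deriv j \<psi> (\<phi> x))" for i
    by (rule ext, rule partial_deriv_compose[OF d 1])
  ultimately have "Ck k (partial_deriv i (\<lambda>x. \<psi> (\<phi> x)))" for i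
    by simp
  then show ?case
    using has_derivative_compose_partials[OF d 1] by (auto simp: differentiable_def)
qed

lemma partial_deriv_local:
  assumes "open T" "x \<in> T" "\<And>y. y \<in> T \<Longrightarrow> f y = g y"
  shows "partial_deriv i f x = partial_deriv i g x"
    and "f differentiable at x \<longleftrightarrow> g differentiable at x"
proof -
  have "(f has_derivative D) (at x) \<longleftrightarrow> (g has_derivative D) (at x)" for D
    using assms by (metis has_derivative_transform_within_open)
  then show "partial_deriv i f x = partial_deriv i g x"
    and "f differentiable at x \<longleftrightarrow> g differentiable at x"
    by (auto simp: partial_deriv_def frechet_derivative_def differentiable_def)
qed

text \<open>The sets \<open>G\<close> and \<open>- K\<close> form an open cover, and the extension
  by zero is \<eta> on the first and 0 on the second. Both descriptions hold on the overlap, so the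
  partials of \<eta> vanish on \<open>G - K\<close> as well and the induction continues.\<close>

lemma Ck_cutoff:
  fixes \<eta> :: "real^'n::finite \<Rightarrow> real"
  assumes "Ck k \<eta>" and "open G" and "closed K" and "K \<subseteq> G" and "\<And>x. x \<in> G \<Longrightarrow> x \<notin> K \<Longrightarrow> \<eta> x = 0"
  shows "Ck k (\<lambda>x. if x \<in> G then \<eta> x else 0)"
  using assms(1,5)
proof (induction k arbitrary: \<eta>)
  case 0
  let ?f = "\<lambda>x. if x \<in> G then \<eta> x else 0"
  have "continuous_on G ?f"
    using 0(1) by (subst continuous_on_cong[OF refl, of _ _ \<eta>]) (auto intro: continuous_on_subset)
  moreover have "continuous_on (- K) ?f"
    using 0(2) by (subst continuous_on_cong[OF refl, of _ _ "\<lambda>x. 0"]) (auto intro: continuous_on_subset)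
  ultimately have "continuous_on (G \<union> - K) ?f"
    using assms by (intro continuous_on_open_Un) auto
  moreover have "G \<union> - K = UNIV" using assms by auto
  ultimately show ?case by simp
next
  case (Suc k)
  let ?f = "\<lambda>x. if x \<in> G then \<eta> x else 0"
  have o: "open (- K)" "open (G - K)" using assms by auto
  have G: "partial_deriv i ?f x = partial_deriv i \<eta> x" "?f differentiable at x" if "x \<in> G" for i x
    using partial_deriv_local[OF \<open>open G\<close> that, of ?f \<eta>] Suc.prems by auto
  have K: "partial_deriv i ?f x = 0" "?f differentiable at x" if "x \<notin> K" for i x
    using partial_deriv_local[OF o(1), of x ?f "\<lambda>x. 0"] that Suc.prems
    by (auto simp: partial_deriv_def)
  have "partial_deriv i ?f = (\<lambda>x. if x \<in> G then partial_deriv i \<eta> x else 0)" for i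
    using G K assms by (intro ext) (metis subsetD)
  moreover have "Ck k (\<lambda>x. if x \<in> G then partial_deriv i \<eta> x else 0)" for i
    using Suc.prems K G by (intro Suc.IH) (auto, metis)
  ultimately have "Ck k (partial_deriv i ?f)" for i by simp
  moreover have "?f differentiable at x" for x using G K assms by blast
  ultimately show ?case by simp
qed

lemma partial_deriv_eq_0_outside:
  assumes "x \<notin> closure {x. \<psi> x \<noteq> 0}"
  shows "partial_deriv i \<psi> x = 0"
proof -
  have "partial_deriv i \<psi> x = partial_deriv i (\<lambda>x. 0) x"
    by (rule partial_deriv_local[of "- closure {x. \<psi> x \<noteq> 0}"])
       (use assms closure_subset[of "{x. \<psi> x \<noteq> 0}"] in blast)+
  then show ?thesis by (simp add: partial_deriv_def)
qed

section \<open>Derivatives along lines and symmetry of second partial derivatives\<close>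

lemma Ck1_line_derivative:
  fixes f :: "real^'n::finite \<Rightarrow> real"
  assumes "Ck (Suc 0) f"
  shows "((\<lambda>s. f (x + s *\<^sub>R v)) has_real_derivative
           (\<Sum>i\<in>UNIV. v $ i * partial_deriv i f (x + s *\<^sub>R v))) (at s)"
proof -
  have "((\<lambda>s. x + s *\<^sub>R v) has_derivative (\<lambda>h. h *\<^sub>R v)) (at s)"
    by (auto intro!: derivative_eq_intros)
  from has_derivative_compose[OF this Ck_Suc_has_derivative[OF assms]]
  show ?thesis
    by (simp add: has_field_derivative_def sum_distrib_left[symmetric] mult_commute_abs mult.assoc)
qed

text \<open>The mean value theorem is used twice: in direction \<open>i\<close> for the increment of
  \<open>f\<close> in direction \<open>j\<close>, then in direction \<open>j\<close> for the partial
  derivative that results. Both displacements are shorter than \<open>t\<close>, whence the radius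
  \<open>2 * t\<close>.\<close>

lemma second_difference_mean_value:
  fixes f :: "real^'n::finite \<Rightarrow> real"
  assumes f: "Ck (Suc (Suc 0)) f" and t: "t > 0"
  shows "\<exists>y. norm (y - x) \<le> 2 * t \<and>
    f (x + t *\<^sub>R axis i 1 + t *\<^sub>R axis j 1) - f (x + t *\<^sub>R axis i 1) - f (x + t *\<^sub>R axis j 1) + f x
      = t\<^sup>2 * partial_deriv j (partial_deriv i f) y"
proof -
  have axis_sum: "(\<Sum>k\<in>UNIV. axis i 1 $ k * c k) = c i" for i :: 'n and c :: "'n \<Rightarrow> real"
    by (simp add: axis_def if_distrib if_distribR cong: if_cong)
  have 1: "Ck (Suc 0) f" "Ck (Suc 0) (partial_deriv i f)"
    using f Ck_SucD[OF f] by simp_all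
  define G where "G s = f ((x + t *\<^sub>R axis j 1) + s *\<^sub>R axis i 1) - f (x + s *\<^sub>R axis i 1)" for s
  have "(G has_real_derivative partial_deriv i f ((x + t *\<^sub>R axis j 1) + s *\<^sub>R axis i 1)
      - partial_deriv i f (x + s *\<^sub>R axis i 1)) (at s)" for s
    unfolding G_def
    using DERIV_diff[OF Ck1_line_derivative[OF 1(1), of "x + t *\<^sub>R axis j 1" "axis i 1" s]
        Ck1_line_derivative[OF 1(1), of x "axis i 1" s]]
    by (simp add: axis_sum)
  from MVT2[OF t, of G, OF this] obtain s where s: "0 < s" "s < t"
    "G t - G 0 = t * (partial_deriv i f ((x + t *\<^sub>R axis j 1) + s *\<^sub>R axis i 1)
      - partial_deriv i f (x + s *\<^sub>R axis i 1))" by auto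
  define H where "H r = partial_deriv i f ((x + s *\<^sub>R axis i 1) + r *\<^sub>R axis j 1)" for r
  have "(H has_real_derivative partial_deriv j (partial_deriv i f)
      ((x + s *\<^sub>R axis i 1) + r *\<^sub>R axis j 1)) (at r)" for r
    unfolding H_def
    using Ck1_line_derivative[OF 1(2), of "x + s *\<^sub>R axis i 1" "axis j 1" r] by (simp add: axis_sum)
  from MVT2[OF t, of H, OF this] obtain r where r: "0 < r" "r < t"
    "H t - H 0 = t * partial_deriv j (partial_deriv i f) ((x + s *\<^sub>R axis i 1) + r *\<^sub>R axis j 1)"
    by auto
  have "norm (s *\<^sub>R axis i 1 + r *\<^sub>R axis j 1 :: real^'n) \<le> s + r"
    using s r norm_triangle_ineq[of "s *\<^sub>R axis i 1 :: real^'n" "r *\<^sub>R axis j 1"]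
    by (simp add: norm_axis_1)
  then show ?thesis
    using s r by (intro exI[of _ "x + s *\<^sub>R axis i 1 + r *\<^sub>R axis j 1"])
      (simp add: G_def H_def power2_eq_square add_ac)
qed

text \<open>The second difference is symmetric in \<open>i\<close> and \<open>j\<close>, so dividing
  by the square of \<open>t\<close> equates the two mixed partials at the mean value points
  \<open>a t\<close> and \<open>b t\<close>. Both points tend to \<open>x\<close>, where the mixed
  partials are continuous.\<close>

lemma partial_deriv_commute:
  fixes f :: "real^'n::finite \<Rightarrow> real"
  assumes f: "Ck (Suc (Suc 0)) f"
  shows "partial_deriv i (partial_deriv j f) x = partial_deriv j (partial_deriv i f) x"
proof -
  define a where "a t = (SOME y. norm (y - x) \<le> 2 * t \<and>
    f (x + t *\<^sub>R axis i 1 + t *\<^sub>R axis j 1) - f (x + t *\<^sub>R axis i 1) - f (x + t *\<^sub>R axis j 1) + f x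
      = t\<^sup>2 * partial_deriv j (partial_deriv i f) y)" for t
  define b where "b t = (SOME y. norm (y - x) \<le> 2 * t \<and>
    f (x + t *\<^sub>R axis j 1 + t *\<^sub>R axis i 1) - f (x + t *\<^sub>R axis j 1) - f (x + t *\<^sub>R axis i 1) + f x
      = t\<^sup>2 * partial_deriv i (partial_deriv j f) y)" for t
  have a: "norm (a t - x) \<le> 2 * t \<and>
    f (x + t *\<^sub>R axis i 1 + t *\<^sub>R axis j 1) - f (x + t *\<^sub>R axis i 1) - f (x + t *\<^sub>R axis j 1) + f x
      = t\<^sup>2 * partial_deriv j (partial_deriv i f) (a t)" if "t > 0" for t
    unfolding a_def by (rule someI_ex, rule second_difference_mean_value[OF f that])
  have b: "norm (b t - x) \<le> 2 * t \<and>
    f (x + t *\<^sub>R axis j 1 + t *\<^sub>R axis i 1) - f (x + t *\<^sub>R axis j 1) - f (x + t *\<^sub>R axis i 1) + f x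
      = t\<^sup>2 * partial_deriv i (partial_deriv j f) (b t)" if "t > 0" for t
    unfolding b_def by (rule someI_ex, rule second_difference_mean_value[OF f that])
  have eq: "partial_deriv j (partial_deriv i f) (a t) = partial_deriv i (partial_deriv j f) (b t)"
    if "t > 0" for t
  proof -
    have "t\<^sup>2 * partial_deriv j (partial_deriv i f) (a t) = t\<^sup>2 * partial_deriv i (partial_deriv j f) (b t)"
      using a[OF that] b[OF that] by (simp add: algebra_simps)
    then show ?thesis using that by simp
  qed
  have lim: "(c \<longlongrightarrow> x) (at_right 0)" if "\<And>t. t > 0 \<Longrightarrow> norm (c t - x) \<le> 2 * t" for c
  proof -
    have "((\<lambda>t. c t - x) \<longlongrightarrow> 0) (at_right 0)"
    proof (rule Lim_null_comparison)
      show "\<forall>\<^sub>F t in at_right 0. norm (c t - x) \<le> 2 * t"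
        using that by (auto simp: eventually_at_right_field intro: exI[of _ 1])
      show "((\<lambda>t. 2 * t) \<longlongrightarrow> (0::real)) (at_right 0)" by (auto intro!: tendsto_eq_intros)
    qed
    then show ?thesis using Lim_null by blast
  qed
  have c: "isCont (partial_deriv k (partial_deriv l f)) x" for k l
    using f by (auto simp: continuous_on_eq_continuous_at)
  have A: "((\<lambda>t. partial_deriv j (partial_deriv i f) (a t)) \<longlongrightarrow> partial_deriv j (partial_deriv i f) x) (at_right 0)"
    by (rule isCont_tendsto_compose[OF c lim]) (use a in blast)
  have B: "((\<lambda>t. partial_deriv i (partial_deriv j f) (b t)) \<longlongrightarrow> partial_deriv i (partial_deriv j f) x) (at_right 0)"
    by (rule isCont_tendsto_compose[OF c lim]) (use b in blast)
  have "\<forall>\<^sub>F t in at_right (0::real).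
      partial_deriv j (partial_deriv i f) (a t) = partial_deriv i (partial_deriv j f) (b t)"
    using eq by (auto simp: eventually_at_right_field intro: exI[of _ 1])
  then have "((\<lambda>t. partial_deriv i (partial_deriv j f) (b t)) \<longlongrightarrow> partial_deriv j (partial_deriv i f) x) (at_right 0)"
    using A by (rule Lim_transform_eventually[rotated])
  from tendsto_unique[OF trivial_limit_at_right_real B this] show ?thesis .
qed

section \<open>Mollification\<close>

text \<open>The case \<open>m = 0\<close> is the classical flat function. The powers in the
  denominator make the family closed under differentiation up to linear combinations, so a single
  induction shows all its members smooth.\<close>

definition exp_inv_over_power :: "nat \<Rightarrow> real \<Rightarrow> real" where
  "exp_inv_over_power m s = (if s > 0 then exp (- 1 / s) / s ^ m else 0)"

lemma exp_inv_over_power_tendsto_0: "(exp_inv_over_power m \<longlongrightarrow> 0) (at 0)"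
proof -
  have "((\<lambda>s. inverse s ^ m / exp (inverse s)) \<longlongrightarrow> (0::real)) (at_right 0)"
    using filterlim_compose[OF tendsto_power_div_exp_0 filterlim_inverse_at_top_right] .
  moreover have "\<forall>\<^sub>F s in at_right (0::real). inverse s ^ m / exp (inverse s) = exp_inv_over_power m s"
    by (auto simp: eventually_at_right_field exp_inv_over_power_def exp_minus field_simps intro!: exI[of _ 1])
  ultimately have "(exp_inv_over_power m \<longlongrightarrow> 0) (at_right 0)"
    by (rule Lim_transform_eventually)
  moreover have "\<forall>\<^sub>F s in at_left (0::real). 0 = exp_inv_over_power m s"
    by (auto simp: eventually_at_left_field exp_inv_over_power_def intro!: exI[of _ "-1"])
  then have "(exp_inv_over_power m \<longlongrightarrow> 0) (at_left 0)"
    by (rule Lim_transform_eventually[OF tendsto_const])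
  ultimately show ?thesis by (simp add: filterlim_at_split)
qed

lemma DERIV_exp_inv_over_power:
  "(exp_inv_over_power m has_real_derivative
     (- real m * exp_inv_over_power (Suc m) s + exp_inv_over_power (Suc (Suc m)) s)) (at s)"
proof -
  consider "s > 0" | "s < 0" | "s = 0" by linarith
  then show ?thesis
  proof cases
    case 1
    have "((\<lambda>s. exp (- 1 / s) / s ^ m) has_real_derivative
       (- real m * exp_inv_over_power (Suc m) s + exp_inv_over_power (Suc (Suc m)) s)) (at s)"
    proof (rule DERIV_cong[OF DERIV_divide[OF _ DERIV_pow]])
      show "((\<lambda>s. exp (- 1 / s)) has_real_derivative exp (- 1 / s) / s\<^sup>2) (at s)"
        using 1 by (auto intro!: derivative_eq_intros simp: power2_eq_square)
      show "(exp (- 1 / s) / s\<^sup>2 * s ^ m - exp (- 1 / s) * (real m * s ^ (m - Suc 0))) / (s ^ m * s ^ m)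
        = - real m * exp_inv_over_power (Suc m) s + exp_inv_over_power (Suc (Suc m)) s"
        using 1 by (cases m) (auto simp: exp_inv_over_power_def field_simps power2_eq_square)
    qed (use 1 in auto)
    then show ?thesis
      by (rule DERIV_cong_ev[THEN iffD1, rotated -1])
         (use 1 in \<open>auto simp: exp_inv_over_power_def intro: eventually_mono[OF order_tendstoD(1)[OF tendsto_ident_at]]
            eventually_nhds_in_open[of "{0<..}", THEN eventually_mono]\<close>)
  next
    case 2
    have "((\<lambda>s. 0) has_real_derivative
       (- real m * exp_inv_over_power (Suc m) s + exp_inv_over_power (Suc (Suc m)) s)) (at s)"
      using 2 by (simp add: exp_inv_over_power_def)
    then show ?thesis
      by (rule DERIV_cong_ev[THEN iffD1, rotated -1])
         (use 2 in \<open>auto simp: exp_inv_over_power_def intro: eventually_nhds_in_open[of "{..<0}", THEN eventually_mono]\<close>)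
  next
    case 3
    \<comment> \<open>The difference quotient at 0 is the next member of the family, whose limit at
      0 is known. The identity also holds at \<open>h = 0\<close>, where the quotient is 0 by the
      convention for division by zero.\<close>
    have "(\<lambda>h. (exp_inv_over_power m (0 + h) - exp_inv_over_power m 0) / h) = exp_inv_over_power (Suc m)"
      by (auto simp: exp_inv_over_power_def field_simps)
    then show ?thesis
      using exp_inv_over_power_tendsto_0[of "Suc m"] 3
      by (simp add: DERIV_def) (simp add: exp_inv_over_power_def)
  qed
qed

lemma Ck_exp_inv_over_power:
  fixes i :: "'n::finite"
  shows "Ck k (\<lambda>x. exp_inv_over_power m (c * x $ i + d))"
proof (induction k arbitrary: m)
  case 0
  have "isCont (exp_inv_over_power m) s" for s
    using DERIV_exp_inv_over_power by (rule DERIV_isCont)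
  then have "continuous_on UNIV (exp_inv_over_power m)"
    by (simp add: continuous_at_imp_continuous_on)
  then show ?case
    by (auto intro!: continuous_on_compose2[of UNIV "exp_inv_over_power m"] continuous_intros)
next
  case (Suc k)
  have lin: "((\<lambda>x::real^'n. c * x $ i + d) has_derivative (\<lambda>h. c * h $ i)) (at x)" for x
    by (auto intro!: derivative_eq_intros bounded_linear.has_derivative[OF bounded_linear_vec_nth])
  note D = has_derivative_compose[OF lin DERIV_exp_inv_over_power[of m, unfolded has_field_derivative_def]]
  have "Ck k (\<lambda>x. (- real m * exp_inv_over_power (Suc m) (c * x $ i + d)
      + exp_inv_over_power (Suc (Suc m)) (c * x $ i + d)) * (c * axis j 1 $ i))" for j
    by (intro Ck_mult Ck_add Ck_const Suc.IH)
  then show ?case by - (rule Ck_SucI, rule D, simp)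
qed

lemma integrable_continuous_compact_support:
  fixes f :: "'a::euclidean_space \<Rightarrow> 'b::{banach, second_countable_topology}"
  assumes "continuous_on UNIV f" and "compact K" and "\<And>x. x \<notin> K \<Longrightarrow> f x = 0"
  shows "integrable lborel f"
proof -
  have "(\<lambda>x. indicator K x *\<^sub>R f x) = f"
    using assms(3) by (auto simp: indicator_def)
  then show ?thesis
    using borel_integrable_compact[OF assms(2) continuous_on_subset[OF assms(1) subset_UNIV]] by simp
qed

definition mollifier :: "real \<Rightarrow> (real^'n::finite \<Rightarrow> real) \<Rightarrow> bool" where
  "mollifier \<delta> \<rho> \<longleftrightarrow> (\<forall>k. Ck k \<rho>) \<and> (\<forall>x. 0 \<le> \<rho> x) \<and> (\<forall>x. \<rho> x \<noteq> 0 \<longrightarrow> norm x \<le> \<delta>) \<and>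
     integral\<^sup>L lborel \<rho> = 1"

lemma mollifier_integrable: "mollifier \<delta> \<rho> \<Longrightarrow> integrable lborel \<rho>"
  by (rule integrable_continuous_compact_support[of _ "cball 0 \<delta>"])
     (auto simp: mollifier_def dest: Ck_continuous)

lemma mollifier_exists:
  assumes "\<delta> > 0"
  shows "\<exists>\<rho> :: real^'n::finite \<Rightarrow> real. mollifier \<delta> \<rho>"
proof -
  \<comment> \<open>The bump below is supported in the cube of half side \<open>d\<close>; the bound
    of the Euclidean norm by the sum of the absolute coordinates puts this cube inside the ball of
    radius \<delta>.\<close>
  define d where "d = \<delta> / real CARD('n)"
  have "d > 0" using assms by (simp add: d_def)
  define b where "b x = (\<Prod>i\<in>UNIV. exp_inv_over_power 0 (1 * x $ i + d) * exp_inv_over_power 0 (-1 * x $ i + d))"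
    for x :: "real^'n"
  have smooth: "Ck k b" for k
    unfolding b_def by (intro Ck_prod Ck_mult Ck_exp_inv_over_power)
  have nonneg: "0 \<le> b x" for x
    unfolding b_def by (intro prod_nonneg mult_nonneg_nonneg) (auto simp: exp_inv_over_power_def)
  have supp: "norm x \<le> \<delta>" if "b x \<noteq> 0" for x
  proof -
    have *: "\<bar>x $ i\<bar> \<le> d" for i
    proof -
      have "x $ i < d \<and> 0 < x $ i + d"
        using that by (auto simp: b_def exp_inv_over_power_def split: if_splits)
      then show ?thesis by linarith
    qed
    have "norm x \<le> (\<Sum>i\<in>UNIV. \<bar>x $ i\<bar>)" by (rule norm_le_l1_cart)
    also have "\<dots> \<le> (\<Sum>i\<in>(UNIV::'n set). d)" by (intro sum_mono *)
    finally show ?thesis by (simp add: d_def)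
  qed
  have cont: "continuous_on UNIV b" using smooth Ck_continuous by blast
  have int: "integrable lborel b"
    by (rule integrable_continuous_compact_support[OF cont, of "cball 0 \<delta>"]) (use supp in force)+
  have pos: "0 < b 0"
    using \<open>d > 0\<close> by (auto simp: b_def exp_inv_over_power_def intro!: prod_pos)
  \<comment> \<open>Normalisation requires a nonzero integral. If it vanished, \<open>b\<close>
    would be zero almost everywhere, although it is nonzero on a nonempty open set containing
    0.\<close>
  have "integral\<^sup>L lborel b \<noteq> 0"
  proof
    assume "integral\<^sup>L lborel b = 0"
    then have "AE x in lborel. b x = 0"
      using integral_nonneg_eq_0_iff_AE[OF int] nonneg by auto
    then have "AE x in lebesgue. b x = 0" by (rule AE_completion)
    then have "negligible {x. b x \<noteq> 0}"
      by (simp add: negligible_iff_null_sets completion.AE_iff_null_sets)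
    moreover have "open {x. b x \<noteq> 0}"
      using cont by (intro open_Collect_neq) auto
    ultimately show False
      using pos open_not_negligible by fastforce
  qed
  then have I: "integral\<^sup>L lborel b > 0"
    using nonneg integral_nonneg_AE[of b lborel] by (simp add: less_le)
  have "mollifier \<delta> (\<lambda>x. inverse (integral\<^sup>L lborel b) * b x)"
    unfolding mollifier_def using smooth nonneg supp I
    by (auto intro!: Ck_mult Ck_const)
  then show ?thesis by blast
qed

lemma uniformly_continuous_compact_support:
  fixes f :: "'a::euclidean_space \<Rightarrow> 'b::real_normed_vector"
  assumes f: "continuous_on UNIV f" and supp: "\<And>x. norm x > R \<Longrightarrow> f x = 0" and e: "e > 0"
  shows "\<exists>d>0. \<forall>x y. norm (x - y) < d \<longrightarrow> norm (f x - f y) < e"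
proof -
  have "uniformly_continuous_on (cball 0 (R + 1)) f"
    by (intro compact_uniformly_continuous continuous_on_subset[OF f]) auto
  then obtain d where d: "d > 0"
    "\<And>x y. x \<in> cball 0 (R + 1) \<Longrightarrow> y \<in> cball 0 (R + 1) \<Longrightarrow> dist x y < d \<Longrightarrow> dist (f x) (f y) < e"
    unfolding uniformly_continuous_on_def using e by (metis dist_commute)
  have "norm (f x - f y) < e" if "norm (x - y) < min d 1" for x y
  proof (cases "norm x \<le> R + 1 \<and> norm y \<le> R + 1")
    case True
    then show ?thesis using d(2)[of x y] that by (simp add: dist_norm)
  next
    \<comment> \<open>Two points at distance less than 1, one of them beyond radius
      \<open>R + 1\<close>, both lie beyond \<open>R\<close>, where \<open>f\<close>
      vanishes.\<close>
    case False
    moreover have "norm x \<le> norm y + norm (x - y)" "norm y \<le> norm x + norm (x - y)"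
      by norm+
    ultimately have "norm x > R" "norm y > R" using that by auto
    then show ?thesis using supp e by simp
  qed
  then show ?thesis using \<open>d > 0\<close> by (intro exI[of _ "min d 1"]) auto
qed

lemma partial_deriv_support:
  fixes \<rho> :: "real^'n::finite \<Rightarrow> real"
  assumes "\<And>x. \<rho> x \<noteq> 0 \<Longrightarrow> norm x \<le> R" and "partial_deriv i \<rho> x \<noteq> 0"
  shows "norm x \<le> R"
proof -
  have "closure {x. \<rho> x \<noteq> 0} \<subseteq> cball 0 R"
    using assms(1) by (intro closure_minimal) auto
  moreover have "x \<in> closure {x. \<rho> x \<noteq> 0}"
    using assms(2) partial_deriv_eq_0_outside by blast
  ultimately show ?thesis by auto
qed

text \<open>The mean value theorem along the segment turns the remainder into differences of
  partials, which are small uniformly by compact support. The tolerance is divided by the dimension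
  because one such difference occurs per coordinate.\<close>

lemma uniformly_differentiable_compact_support:
  fixes \<rho> :: "real^'n::finite \<Rightarrow> real"
  assumes \<rho>: "Ck (Suc 0) \<rho>" and supp: "\<And>x. \<rho> x \<noteq> 0 \<Longrightarrow> norm x \<le> R" and e: "e > 0"
  shows "\<exists>d>0. \<forall>z h. norm h < d \<longrightarrow>
    \<bar>\<rho> (z + h) - \<rho> z - (\<Sum>i\<in>UNIV. h $ i * partial_deriv i \<rho> z)\<bar> \<le> e * norm h"
proof -
  have "\<exists>d>0. \<forall>x y. norm (x - y) < d \<longrightarrow> norm (partial_deriv i \<rho> x - partial_deriv i \<rho> y) < e / CARD('n)" for i
  proof (rule uniformly_continuous_compact_support[where R = R])
    show "partial_deriv i \<rho> x = 0" if "norm x > R" for x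
      using partial_deriv_support[of \<rho> R i x, OF supp] that by force
  qed (use \<rho> e in auto)
  then obtain d where d: "\<And>i. d i > 0"
    "\<And>i x y. norm (x - y) < d i \<Longrightarrow> norm (partial_deriv i \<rho> x - partial_deriv i \<rho> y) < e / CARD('n)"
    by metis
  define D where "D = Min (range d)"
  have D: "D > 0" "D \<le> d i" for i using d(1) by (auto simp: D_def)
  show ?thesis
  proof (intro exI conjI allI impI)
    fix z h :: "real^'n" assume h: "norm h < D"
    obtain s where s: "0 < s" "s < 1"
      "\<rho> (z + h) - \<rho> z = (\<Sum>i\<in>UNIV. h $ i * partial_deriv i \<rho> (z + s *\<^sub>R h))"
      using MVT2[of 0 1 "\<lambda>s. \<rho> (z + s *\<^sub>R h)", OF _ Ck1_line_derivative[OF \<rho>]] by auto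
    have "\<bar>h $ i * partial_deriv i \<rho> (z + s *\<^sub>R h) - h $ i * partial_deriv i \<rho> z\<bar> \<le> norm h * (e / CARD('n))" for i
    proof -
      have "norm ((z + s *\<^sub>R h) - z) < d i"
        using s h D(2)[of i] mult_left_le_one_le[of "norm h" s] by simp
      from d(2)[OF this] show ?thesis
        unfolding right_diff_distrib[symmetric] abs_mult
        by (intro mult_mono component_le_norm_cart) auto
    qed
    then have "(\<Sum>i\<in>UNIV. \<bar>h $ i * partial_deriv i \<rho> (z + s *\<^sub>R h) - h $ i * partial_deriv i \<rho> z\<bar>)
        \<le> (\<Sum>i\<in>(UNIV::'n set). norm h * (e / CARD('n)))"
      by (intro sum_mono)
    then show "\<bar>\<rho> (z + h) - \<rho> z - (\<Sum>i\<in>UNIV. h $ i * partial_deriv i \<rho> z)\<bar> \<le> e * norm h"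
      unfolding s(3) sum_subtractf[symmetric]
      by (intro order.trans[OF sum_abs]) (simp add: mult_ac)
  qed (use D in simp)
qed

section \<open>Convolution with smooth compactly supported kernels\<close>

definition convol :: "(real^'n::finite \<Rightarrow> real) \<Rightarrow> (real^'n \<Rightarrow> real) \<Rightarrow> real^'n \<Rightarrow> real" where
  "convol f \<rho> x = (\<integral>y. f y * \<rho> (x - y) \<partial>lborel)"

lemma bounded_continuous_support:
  fixes \<rho> :: "real^'n::finite \<Rightarrow> real"
  assumes "continuous_on UNIV \<rho>" and "\<And>x. \<rho> x \<noteq> 0 \<Longrightarrow> norm x \<le> R"
  shows "\<exists>B. \<forall>x. \<bar>\<rho> x\<bar> \<le> B"
proof -
  have "bounded (\<rho> ` cball 0 R)"
    by (intro compact_imp_bounded compact_continuous_image continuous_on_subset[OF assms(1)]) auto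
  then obtain B where B: "B > 0" "\<And>x. norm x \<le> R \<Longrightarrow> norm (\<rho> x) \<le> B"
    by (auto simp: bounded_pos)
  have "\<bar>\<rho> x\<bar> \<le> B" for x
    using B assms(2)[of x] by (cases "\<rho> x = 0") auto
  then show ?thesis by blast
qed

lemma convol_integrable:
  fixes f \<rho> :: "real^'n::finite \<Rightarrow> real"
  assumes f: "integrable lborel f" and \<rho>: "continuous_on UNIV \<rho>" and supp: "\<And>x. \<rho> x \<noteq> 0 \<Longrightarrow> norm x \<le> R"
  shows "integrable lborel (\<lambda>y. f y * \<rho> (x - y))"
proof -
  obtain B where B: "\<And>x. \<bar>\<rho> x\<bar> \<le> B"
    using bounded_continuous_support[OF \<rho> supp] by blast
  have [measurable]: "\<rho> \<in> borel_measurable borel" "f \<in> borel_measurable borel"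
    using \<rho> f by (auto intro: borel_measurable_continuous_onI dest: borel_measurable_integrable)
  show ?thesis
    by (rule Bochner_Integration.integrable_bound[OF integrable_mult_left[OF f, of B]])
       (auto simp: abs_mult intro!: AE_I2 mult_mono order.trans[OF B abs_ge_self])
qed

text \<open>Differentiation under the integral: the remainder of the kernel is at most
  \<open>e' * norm h\<close> uniformly in the integration variable, and integration against
  \<open>f\<close> multiplies this by the L1 norm \<open>I\<close> of \<open>f\<close>. The choice
  \<open>e' = e / (I + 1)\<close> also covers \<open>I = 0\<close>.\<close>

lemma convol_has_derivative:
  fixes f \<rho> :: "real^'n::finite \<Rightarrow> real"
  assumes f: "integrable lborel f" and \<rho>: "Ck (Suc 0) \<rho>" and supp: "\<And>x. \<rho> x \<noteq> 0 \<Longrightarrow> norm x \<le> R"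
  shows "(convol f \<rho> has_derivative (\<lambda>h. \<Sum>i\<in>UNIV. h $ i * convol f (partial_deriv i \<rho>) x)) (at x)"
  unfolding has_derivative_at_alt
proof (intro conjI allI impI)
  show "bounded_linear (\<lambda>h. \<Sum>i\<in>UNIV. h $ i * convol f (partial_deriv i \<rho>) x)"
    by (intro bounded_linear_sum bounded_linear_mult_left[THEN bounded_linear_compose] bounded_linear_vec_nth)
  fix e :: real assume "e > 0"
  define I where "I = (\<integral>y. \<bar>f y\<bar> \<partial>lborel)"
  have I: "I \<ge> 0" unfolding I_def by simp
  define e' where "e' = e / (I + 1)"
  have e': "e' > 0" using \<open>e > 0\<close> I by (simp add: e'_def)
  obtain d where d: "d > 0" "\<And>z h. norm h < d \<Longrightarrow>
    \<bar>\<rho> (z + h) - \<rho> z - (\<Sum>i\<in>UNIV. h $ i * partial_deriv i \<rho> z)\<bar> \<le> e' * norm h"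
    using uniformly_differentiable_compact_support[OF \<rho> supp e'] by auto
  have suppD: "norm x \<le> R" if "partial_deriv i \<rho> x \<noteq> 0" for i x
    using partial_deriv_support[OF supp that] .
  have contD: "continuous_on UNIV (partial_deriv i \<rho>)" for i
    using \<rho> by simp
  have "norm (convol f \<rho> y - convol f \<rho> x - (\<Sum>i\<in>UNIV. (y - x) $ i * convol f (partial_deriv i \<rho>) x))
      \<le> e * norm (y - x)" if y: "norm (y - x) < d" for y
  proof -
    note int = convol_integrable[OF f Ck_continuous[OF \<rho>] supp]
      convol_integrable[OF f contD suppD]
    let ?g = "\<lambda>z. \<rho> (y - z) - \<rho> (x - z) - (\<Sum>i\<in>UNIV. (y - x) $ i * partial_deriv i \<rho> (x - z))"
    have eq: "f z * ?g z = f z * \<rho> (y - z) - f z * \<rho> (x - z)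
        - (\<Sum>i\<in>UNIV. (y - x) $ i * (f z * partial_deriv i \<rho> (x - z)))" for z
      by (simp add: algebra_simps sum_distrib_left)
    have 1: "convol f \<rho> y - convol f \<rho> x - (\<Sum>i\<in>UNIV. (y - x) $ i * convol f (partial_deriv i \<rho>) x)
      = (\<integral>z. f z * ?g z \<partial>lborel)"
      unfolding convol_def eq using int
      by (simp del: vector_minus_component add: Bochner_Integration.integral_diff
          Bochner_Integration.integral_sum Bochner_Integration.integrable_sum Bochner_Integration.integrable_diff)
    have 2: "norm (\<integral>z. f z * ?g z \<partial>lborel) \<le> (\<integral>z. \<bar>f z\<bar> * (e' * norm (y - x)) \<partial>lborel)"
    proof (rule integral_norm_bound[THEN order.trans], rule integral_mono)
      show "integrable lborel (\<lambda>z. norm (f z * ?g z))"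
        unfolding eq using int by (intro integrable_norm Bochner_Integration.integrable_diff
          Bochner_Integration.integrable_sum integrable_mult_right)
      show "integrable lborel (\<lambda>z. \<bar>f z\<bar> * (e' * norm (y - x)))"
        using f by (intro integrable_mult_left) simp
      fix z show "norm (f z * ?g z) \<le> \<bar>f z\<bar> * (e' * norm (y - x))"
      proof -
        have "(x - z) + (y - x) = y - z" by simp
        then have "\<bar>?g z\<bar> \<le> e' * norm (y - x)"
          using d(2)[OF y, of "x - z"] by simp
        then show ?thesis unfolding real_norm_def abs_mult by (intro mult_left_mono) auto
      qed
    qed
    have 3: "(\<integral>z. \<bar>f z\<bar> * (e' * norm (y - x)) \<partial>lborel) = I * (e' * norm (y - x))"
      by (simp add: I_def)
    have 4: "I * (e' * norm (y - x)) \<le> e * norm (y - x)"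
      using I \<open>e > 0\<close> by (auto simp: e'_def field_simps intro!: mult_right_mono)
    show ?thesis unfolding 1 using order.trans[OF 2[unfolded 3] 4] .
  qed
  then show "\<exists>d>0. \<forall>y. norm (y - x) < d \<longrightarrow>
      norm (convol f \<rho> y - convol f \<rho> x - (\<Sum>i\<in>UNIV. (y - x) $ i * convol f (partial_deriv i \<rho>) x))
      \<le> e * norm (y - x)"
    using \<open>d > 0\<close> by blast
qed

text \<open>All derivatives fall on the kernel, and the partials of the kernel satisfy the same
  hypotheses with the same radius \<open>R\<close>; therefore the induction generalises over
  \<rho>.\<close>

lemma Ck_convol:
  fixes f \<rho> :: "real^'n::finite \<Rightarrow> real"
  assumes f: "integrable lborel f" and \<rho>: "\<And>k. Ck k \<rho>" and supp: "\<And>x. \<rho> x \<noteq> 0 \<Longrightarrow> norm x \<le> R"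
  shows "Ck k (convol f \<rho>)"
  using \<rho> supp
proof (induction k arbitrary: \<rho>)
  case 0
  show ?case
    using convol_has_derivative[OF f 0(1,2)]
    by (auto intro!: continuous_at_imp_continuous_on has_derivative_continuous simp del: Ck.simps(2))
next
  case (Suc k)
  have "Ck k (convol f (partial_deriv i \<rho>))" for i
  proof (rule Suc.IH)
    show "Ck k (partial_deriv i \<rho>)" for k using Suc.prems(1)[of "Suc k"] by simp
    show "norm x \<le> R" if "partial_deriv i \<rho> x \<noteq> 0" for x
      using partial_deriv_support[OF Suc.prems(2) that] .
  qed
  then show ?case
    by (intro Ck_SucI[OF convol_has_derivative[OF f Suc.prems]])
       (auto simp: axis_def if_distrib if_distribR cong: if_cong)
qed

lemma partial_deriv_convol:
  fixes f \<rho> :: "real^'n::finite \<Rightarrow> real"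
  assumes "integrable lborel f" and "Ck (Suc 0) \<rho>" and "\<And>x. \<rho> x \<noteq> 0 \<Longrightarrow> norm x \<le> R"
  shows "partial_deriv i (convol f \<rho>) x = convol f (partial_deriv i \<rho>) x"
  by (subst partial_deriv_eqI[OF convol_has_derivative[OF assms]])
     (auto simp: axis_def if_distrib if_distribR cong: if_cong)

section \<open>Continuity of translations in L1 and convergence of mollifications\<close>

lemma lborel_integral_translate:
  fixes f :: "'a::euclidean_space \<Rightarrow> 'b::{banach, second_countable_topology}"
  assumes [measurable]: "f \<in> borel_measurable borel"
  shows "integrable lborel (\<lambda>x. f (x + h)) \<longleftrightarrow> integrable lborel f"
    and "(\<integral>x. f (x + h) \<partial>lborel) = (\<integral>x. f x \<partial>lborel)"
proof -
  have d: "distr lborel borel ((+) h) = (lborel :: 'a measure)" by (rule lborel_distr_plus)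
  show "integrable lborel (\<lambda>x. f (x + h)) \<longleftrightarrow> integrable lborel f"
    by (subst (2) d[symmetric], subst integrable_distr_eq) (auto simp: add.commute)
  show "(\<integral>x. f (x + h) \<partial>lborel) = (\<integral>x. f x \<partial>lborel)"
    by (subst (2) d[symmetric], subst integral_distr) (auto simp: add.commute)
qed

lemma lborel_integral_reflect:
  fixes f :: "'a::euclidean_space \<Rightarrow> 'b::{banach, second_countable_topology}"
  assumes [measurable]: "f \<in> borel_measurable borel"
  shows "integrable lborel (\<lambda>x. f (h - x)) \<longleftrightarrow> integrable lborel f"
    and "(\<integral>x. f (h - x) \<partial>lborel) = (\<integral>x. f x \<partial>lborel)"
proof -
  have d: "distr lborel borel (\<lambda>x. h - x) = (lborel :: 'a measure)"
    using lborel_affine[of "-1" h] by (simp add: density_1 cong: distr_cong)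
  show "integrable lborel (\<lambda>x. f (h - x)) \<longleftrightarrow> integrable lborel f"
    by (subst (2) d[symmetric], subst integrable_distr_eq) auto
  show "(\<integral>x. f (h - x) \<partial>lborel) = (\<integral>x. f x \<partial>lborel)"
    by (subst (2) d[symmetric], subst integral_distr) auto
qed

text \<open>Regularity squeezes \<open>A\<close> between a compact \<open>K\<close> and an open
  \<open>U\<close> with \<open>U - K\<close> small. A shift shorter than the distance from
  \<open>K\<close> to the complement of \<open>U\<close> keeps \<open>K\<close> inside
  \<open>U\<close>, so the indicator can change only where \<open>x\<close> or \<open>x + h\<close>
  lies in \<open>U - K\<close>.\<close>

lemma indicator_translation_continuous:
  fixes A :: "'a::euclidean_space set"
  assumes A: "A \<in> sets lborel" "emeasure lborel A < \<infinity>" and e: "e > 0"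
  shows "\<exists>d>0. \<forall>h. norm h < d \<longrightarrow>
    (\<integral>x. \<bar>indicator A (x + h) - indicator A x :: real\<bar> \<partial>lborel) \<le> e"
proof -
  have lm: "A \<in> lmeasurable"
    using A by (simp add: fmeasurable_def)
  have sA: "A \<in> sets lebesgue" using A by simp
  \<comment> \<open>Three pieces \<open>U - A\<close>, \<open>A - C\<close> and
    \<open>C - K\<close>, each of measure below \<open>e / 8\<close>, keep \<open>U - K\<close>
    below \<open>e / 2\<close>; this measure is counted twice at the end, once for \<open>x\<close>
    and once for \<open>x + h\<close>.\<close>
  obtain C where C: "closed C" "C \<subseteq> A" "A - C \<in> lmeasurable" "emeasure lebesgue (A - C) < ennreal (e / 8)"
    using sets_lebesgue_inner_closed[OF sA, of "e / 8"] e by auto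
  obtain U where U: "open U" "A \<subseteq> U" "U - A \<in> lmeasurable" "emeasure lebesgue (U - A) < ennreal (e / 8)"
    using sets_lebesgue_outer_open[OF sA, of "e / 8"] e by auto
  have Clm: "C \<in> lmeasurable"
    using fmeasurable.Diff[OF lm C(3)] C(2) by (simp add: double_diff)
  \<comment> \<open>Inner regularity supplies a closed set that may be unbounded; intersecting with
    a large ball makes it compact at a small cost in measure.\<close>
  have UnC: "(\<Union>n. C \<inter> cball 0 (real n)) = C"
    using real_arch_simple by fastforce
  have "(\<lambda>n. measure lebesgue (C \<inter> cball 0 (real n))) \<longlonglongrightarrow> measure lebesgue (\<Union>n. C \<inter> cball 0 (real n))"
  proof (rule Lim_measure_incseq)
    have "C \<inter> cball 0 (real n) \<in> sets lebesgue" for n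
      using C(1) by (intro sets.Int) (auto simp: borel_closed)
    then show "range (\<lambda>n. C \<inter> cball 0 (real n)) \<subseteq> sets lebesgue" by auto
    show "incseq (\<lambda>n. C \<inter> cball 0 (real n))" by (auto simp: incseq_def)
    show "emeasure lebesgue (\<Union>n. C \<inter> cball 0 (real n)) \<noteq> \<infinity>"
      unfolding UnC using Clm by (auto simp: fmeasurable_def)
  qed
  note this[unfolded UnC]
  then have "\<forall>\<^sub>F n in sequentially. measure lebesgue (C \<inter> cball 0 (real n)) > measure lebesgue C - e / 8"
    using e by (intro order_tendstoD) auto
  then obtain n where n: "measure lebesgue (C \<inter> cball 0 (real n)) > measure lebesgue C - e / 8"
    using eventually_happens'[OF sequentially_bot] by blast
  define K where "K = C \<inter> cball 0 (real n)"
  have K: "compact K" "K \<subseteq> A" "K \<subseteq> U" using C U by (auto simp: K_def closed_Int_compact)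
  have Klm: "K \<in> lmeasurable" using K by (simp add: lmeasurable_compact)
  have Ulm: "U \<in> lmeasurable"
    using fmeasurable.Un[OF U(3) lm] U(2) by (simp add: Un_absorb2)
  have UK: "U - K = (U - A) \<union> (A - C) \<union> (C - K)"
    using C U by (auto simp: K_def)
  have CK: "measure lebesgue (C - K) < e / 8"
    using n measurable_measure_Diff[OF Clm fmeasurableD[OF Klm]] by (simp add: K_def)
  have "measure lebesgue (U - A) < e / 8" "measure lebesgue (A - C) < e / 8"
    using C(3,4) U(3,4) e by (simp_all add: emeasure_eq_measure2 ennreal_less_iff)
  moreover have "measure lebesgue (U - K) \<le> measure lebesgue (U - A) + measure lebesgue (A - C) + measure lebesgue (C - K)"
    unfolding UK using C(3) U(3) Clm Klm
    by (intro order.trans[OF measure_Un_le] add_right_mono measure_Un_le)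
       (auto simp: fmeasurableD sets.Diff)
  ultimately have UKm: "measure lebesgue (U - K) \<le> e / 2" using CK e by linarith
  have UKs: "U - K \<in> sets borel" using U K by (auto simp: compact_imp_closed)
  have "U - K \<in> lmeasurable"
    using Ulm Klm by (rule fmeasurable.Diff)
  then have UKi: "integrable lborel (indicator (U - K) :: _ \<Rightarrow> real)"
    using UKs by (simp add: fmeasurable_def)
  obtain d where d: "d > 0" "(\<Union>x\<in>K. ball x d) \<subseteq> U"
    using compact_subset_open_imp_ball_epsilon_subset[OF K(1) U(1) K(3)] by blast
  have "(\<integral>x. \<bar>indicator A (x + h) - indicator A x :: real\<bar> \<partial>lborel) \<le> e" if h: "norm h < d" for h
  proof -
    have in_U: "x + h \<in> U \<and> x - h \<in> U" if "x \<in> K" for x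
    proof -
      have "x + h \<in> ball x d" "x - h \<in> ball x d" using h by (auto simp: dist_norm)
      then show ?thesis using d(2) that by blast
    qed
    have le: "\<bar>indicator A (x + h) - indicator A x :: real\<bar>
        \<le> indicator (U - K) (x + h) + indicator (U - K) x" for x
      using in_U[of "x + h"] in_U[of x] K(2) U(2) by (auto simp: indicator_def)
    have Am: "(indicator A :: 'a \<Rightarrow> real) \<in> borel_measurable borel" using A by simp
    have Ai: "integrable lborel (indicator A :: _ \<Rightarrow> real)" using A by simp
    have m: "(indicator (U - K) :: 'a \<Rightarrow> real) \<in> borel_measurable borel" using UKs by simp
    have "(\<integral>x. \<bar>indicator A (x + h) - indicator A x :: real\<bar> \<partial>lborel)
      \<le> (\<integral>x. indicator (U - K) (x + h) + indicator (U - K) x \<partial>lborel)"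
      using le UKi Ai lborel_integral_translate(1)[OF m, of h] lborel_integral_translate(1)[OF Am, of h]
      by (intro integral_mono integrable_abs Bochner_Integration.integrable_add
          Bochner_Integration.integrable_diff) auto
    also have "\<dots> = 2 * measure lborel (U - K)"
      using UKi lborel_integral_translate[OF m, of h] by simp
    also have "\<dots> \<le> e" using UKm UKs by simp
    finally show ?thesis .
  qed
  then show ?thesis using d(1) by blast
qed

text \<open>Translations are L1 isometries, so the property passes from indicators to sums and to L1
  limits: in the limit step the error of the approximant is counted once at \<open>x + h\<close> and
  once at \<open>x\<close>.\<close>

lemma integrable_translation_continuous:
  fixes f :: "'a::euclidean_space \<Rightarrow> real"
  assumes "integrable lborel f" and "e > 0"
  shows "\<exists>d>0. \<forall>h. norm h < d \<longrightarrow> (\<integral>x. \<bar>f (x + h) - f x\<bar> \<partial>lborel) \<le> e"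
  using assms
proof (induction arbitrary: e rule: integrable_induct)
  case (base A c)
  obtain d where d: "d > 0" "\<And>h. norm h < d \<Longrightarrow>
    (\<integral>x. \<bar>indicator A (x + h) - indicator A x :: real\<bar> \<partial>lborel) \<le> e / (\<bar>c\<bar> + 1)"
    using indicator_translation_continuous[OF base(1,2), of "e / (\<bar>c\<bar> + 1)"] base(3) by auto
  have "(\<integral>x. \<bar>indicator A (x + h) *\<^sub>R c - indicator A x *\<^sub>R c\<bar> \<partial>lborel) \<le> e" if "norm h < d" for h
  proof -
    have "(\<integral>x. \<bar>indicator A (x + h) *\<^sub>R c - indicator A x *\<^sub>R c\<bar> \<partial>lborel)
      = (\<integral>x. \<bar>indicator A (x + h) - indicator A x :: real\<bar> \<partial>lborel) * \<bar>c\<bar>"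
      by (simp add: left_diff_distrib[symmetric] abs_mult)
    also have "\<dots> \<le> e / (\<bar>c\<bar> + 1) * \<bar>c\<bar>"
      using d(2)[OF that] by (intro mult_right_mono) auto
    also have "\<dots> \<le> e"
      using base(3) by (simp add: field_simps)
    finally show ?thesis .
  qed
  then show ?case using d(1) by blast
next
  case (add f g)
  obtain d1 where d1: "d1 > 0" "\<And>h. norm h < d1 \<Longrightarrow> (\<integral>x. \<bar>f (x + h) - f x\<bar> \<partial>lborel) \<le> e / 2"
    using add.IH(1)[of "e / 2"] add.prems by auto
  obtain d2 where d2: "d2 > 0" "\<And>h. norm h < d2 \<Longrightarrow> (\<integral>x. \<bar>g (x + h) - g x\<bar> \<partial>lborel) \<le> e / 2"
    using add.IH(2)[of "e / 2"] add.prems by auto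
  have [measurable]: "f \<in> borel_measurable borel" "g \<in> borel_measurable borel"
    using add.hyps by (auto dest: borel_measurable_integrable)
  note i = add.hyps lborel_integral_translate(1)[of f, THEN iffD2] lborel_integral_translate(1)[of g, THEN iffD2]
  have "(\<integral>x. \<bar>(f (x + h) + g (x + h)) - (f x + g x)\<bar> \<partial>lborel) \<le> e" if "norm h < min d1 d2" for h
  proof -
    have "(\<integral>x. \<bar>(f (x + h) + g (x + h)) - (f x + g x)\<bar> \<partial>lborel)
      \<le> (\<integral>x. \<bar>f (x + h) - f x\<bar> + \<bar>g (x + h) - g x\<bar> \<partial>lborel)"
      using i by (intro integral_mono) auto
    also have "\<dots> = (\<integral>x. \<bar>f (x + h) - f x\<bar> \<partial>lborel) + (\<integral>x. \<bar>g (x + h) - g x\<bar> \<partial>lborel)"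
      using i by (intro Bochner_Integration.integral_add) auto
    finally show ?thesis using d1(2)[of h] d2(2)[of h] that by simp
  qed
  then show ?case using d1(1) d2(1) by (intro exI[of _ "min d1 d2"]) auto
next
  case (lim f s)
  have m[measurable]: "f \<in> borel_measurable borel" "\<And>i. s i \<in> borel_measurable borel"
    using lim.hyps by (auto dest: borel_measurable_integrable)
  have "(\<lambda>i. \<integral>x. \<bar>s i x - f x\<bar> \<partial>lborel) \<longlonglongrightarrow> integral\<^sup>L lborel (\<lambda>x::'a. 0)"
  proof (rule integral_dominated_convergence[where w = "\<lambda>x. 3 * \<bar>f x\<bar>"])
    show "AE x in lborel. (\<lambda>i. \<bar>s i x - f x\<bar>) \<longlonglongrightarrow> 0"
      using lim.hyps(2) by (intro AE_I2 tendsto_rabs_zero LIM_zero) auto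
    \<comment> \<open>The approximants supplied by the induction rule are bounded by twice
      \<open>\<bar>f x\<bar>\<close>, which explains the factor 3.\<close>
    show "AE x in lborel. norm \<bar>s i x - f x\<bar> \<le> 3 * \<bar>f x\<bar>" for i
    proof (rule AE_I2)
      fix x show "norm \<bar>s i x - f x\<bar> \<le> 3 * \<bar>f x\<bar>"
        using lim.hyps(3)[of x i] by auto
    qed
  qed (use lim.hyps in auto)
  then have "\<forall>\<^sub>F i in sequentially. (\<integral>x. \<bar>s i x - f x\<bar> \<partial>lborel) < e / 3"
    using lim.prems by (intro order_tendstoD) auto
  then obtain i where i: "(\<integral>x. \<bar>s i x - f x\<bar> \<partial>lborel) < e / 3"
    using eventually_happens'[OF sequentially_bot] by blast
  obtain d where d: "d > 0" "\<And>h. norm h < d \<Longrightarrow> (\<integral>x. \<bar>s i (x + h) - s i x\<bar> \<partial>lborel) \<le> e / 3"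
    using lim.IH[of "e / 3" i] lim.prems by auto
  have "(\<integral>x. \<bar>f (x + h) - f x\<bar> \<partial>lborel) \<le> e" if "norm h < d" for h
  proof -
    have int: "integrable lborel (\<lambda>x. f (x + h))" "integrable lborel (\<lambda>x. s i (x + h))"
      using lborel_integral_translate(1)[OF m(1)] lborel_integral_translate(1)[OF m(2)] lim.hyps by blast+
    have t: "(\<integral>x. \<bar>s i (x + h) - f (x + h)\<bar> \<partial>lborel) = (\<integral>x. \<bar>s i x - f x\<bar> \<partial>lborel)"
      using lborel_integral_translate(2)[of "\<lambda>x. \<bar>s i x - f x\<bar>" h] by simp
    have "(\<integral>x. \<bar>f (x + h) - f x\<bar> \<partial>lborel) \<le>
      (\<integral>x. \<bar>s i (x + h) - f (x + h)\<bar> + \<bar>s i (x + h) - s i x\<bar> + \<bar>s i x - f x\<bar> \<partial>lborel)"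
      using int lim.hyps by (intro integral_mono) auto
    also have "\<dots> = (\<integral>x. \<bar>s i (x + h) - f (x + h)\<bar> \<partial>lborel) + (\<integral>x. \<bar>s i (x + h) - s i x\<bar> \<partial>lborel)
        + (\<integral>x. \<bar>s i x - f x\<bar> \<partial>lborel)"
      using int lim.hyps by simp
    finally show ?thesis using d(2)[OF that] i t by linarith
  qed
  then show ?case using d(1) by blast
qed

lemma convol_commute:
  fixes f \<rho> :: "real^'n::finite \<Rightarrow> real"
  assumes [measurable]: "f \<in> borel_measurable borel" "\<rho> \<in> borel_measurable borel"
  shows "convol f \<rho> x = (\<integral>z. f (x - z) * \<rho> z \<partial>lborel)"
  unfolding convol_def
  using lborel_integral_reflect(2)[of "\<lambda>z. f (x - z) * \<rho> z" x] by simp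

text \<open>Since \<rho> has mass one, the error at \<open>x\<close> is the \<rho>-average of
  \<open>f (x - z) - f x\<close>. Exchanging the order of integration leaves an average of
  translation errors, each at most \<open>e\<close> on the support. Working with nonnegative
  integrals yields integrability along with the bound.\<close>

lemma mollifier_L1_bound:
  fixes f \<rho> :: "real^'n::finite \<Rightarrow> real"
  assumes f: "integrable lborel f" and \<rho>: "mollifier \<delta> \<rho>"
    and e: "\<And>h. norm h \<le> \<delta> \<Longrightarrow> (\<integral>x. \<bar>f (x + h) - f x\<bar> \<partial>lborel) \<le> e"
  shows "integrable lborel (\<lambda>x. convol f \<rho> x - f x)"
    and "(\<integral>x. \<bar>convol f \<rho> x - f x\<bar> \<partial>lborel) \<le> e"
proof -
  have sm: "\<And>k. Ck k \<rho>" and nn: "\<And>x. 0 \<le> \<rho> x" and supp: "\<And>x. \<rho> x \<noteq> 0 \<Longrightarrow> norm x \<le> \<delta>"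
    and one: "integral\<^sup>L lborel \<rho> = 1" and i\<rho>: "integrable lborel \<rho>"
    using \<rho> mollifier_integrable by (auto simp: mollifier_def)
  have c\<rho>: "continuous_on UNIV \<rho>" using sm Ck_continuous by blast
  have [measurable]: "f \<in> borel_measurable borel" "\<rho> \<in> borel_measurable borel"
    using f i\<rho> by (auto dest: borel_measurable_integrable)
  have cm[measurable]: "convol f \<rho> \<in> borel_measurable borel"
    using Ck_continuous[OF Ck_convol[OF f sm supp]] by (rule borel_measurable_continuous_onI)
  \<comment> \<open>No sign of \<open>e\<close> is assumed. Since \<rho> is not identically zero,
    its support gives \<open>0 \<le> \<delta>\<close>, and the hypothesis for the zero shift reads
    \<open>0 \<le> e\<close>.\<close>
  have "0 \<le> e"
  proof -
    have "\<rho> \<noteq> (\<lambda>x. 0)" using one by auto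
    then obtain x where "\<rho> x \<noteq> 0" by auto
    then have "norm (0::real^'n) \<le> \<delta>"
      using order.trans[OF norm_ge_zero supp, of x] by simp
    from e[OF this] show ?thesis by simp
  qed
  have ii: "integrable lborel (\<lambda>z. f (x - z) * \<rho> z)" for x
    using convol_integrable[OF f c\<rho> supp, of x] lborel_integral_reflect(1)[of "\<lambda>z. f (x - z) * \<rho> z" x] by simp
  have it: "integrable lborel (\<lambda>x. \<bar>f (x - z) - f x\<bar>)" for z
    using lborel_integral_translate(1)[of f "-z"] f by simp
  have "ennreal \<bar>convol f \<rho> x - f x\<bar> \<le> (\<integral>\<^sup>+z. ennreal (\<bar>f (x - z) - f x\<bar> * \<rho> z) \<partial>lborel)" for x
  proof -
    have i1: "integrable lborel (\<lambda>z. (f (x - z) - f x) * \<rho> z)"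
      using ii[of x] i\<rho> by (simp add: left_diff_distrib)
    have "convol f \<rho> x - f x = (\<integral>z. (f (x - z) - f x) * \<rho> z \<partial>lborel)"
      using ii[of x] i\<rho> by (simp add: convol_commute left_diff_distrib one)
    moreover have "\<bar>\<integral>z. (f (x - z) - f x) * \<rho> z \<partial>lborel\<bar> \<le> (\<integral>z. \<bar>f (x - z) - f x\<bar> * \<rho> z \<partial>lborel)"
      using integral_norm_bound[of lborel "\<lambda>z. (f (x - z) - f x) * \<rho> z"] nn by (simp add: abs_mult)
    moreover have "integrable lborel (\<lambda>z. \<bar>f (x - z) - f x\<bar> * \<rho> z)"
      using integrable_abs[OF i1] nn by (simp add: abs_mult)
    ultimately show ?thesis
      using nn by (subst nn_integral_eq_integral) (auto simp: ennreal_leI)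
  qed
  then have "(\<integral>\<^sup>+x. ennreal \<bar>convol f \<rho> x - f x\<bar> \<partial>lborel)
    \<le> (\<integral>\<^sup>+x. \<integral>\<^sup>+z. ennreal (\<bar>f (x - z) - f x\<bar> * \<rho> z) \<partial>lborel \<partial>lborel)"
    by (rule nn_integral_mono)
  also have "\<dots> = (\<integral>\<^sup>+z. \<integral>\<^sup>+x. ennreal (\<bar>f (x - z) - f x\<bar> * \<rho> z) \<partial>lborel \<partial>lborel)"
    by (rule lborel_pair.Fubini'[symmetric]) (simp add: borel_prod[symmetric])
  also have "\<dots> \<le> (\<integral>\<^sup>+z. ennreal (e * \<rho> z) \<partial>lborel)"
  proof (rule nn_integral_mono)
    fix z :: "real^'n"
    have "(\<integral>\<^sup>+x. ennreal (\<bar>f (x - z) - f x\<bar> * \<rho> z) \<partial>lborel) = ennreal ((\<integral>x. \<bar>f (x - z) - f x\<bar> \<partial>lborel) * \<rho> z)"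
      using it[of z] nn by (subst nn_integral_eq_integral) auto
    also have "\<dots> \<le> ennreal (e * \<rho> z)"
    proof (cases "\<rho> z = 0")
      case False
      then show ?thesis using e[of "-z"] supp[of z] nn by (intro ennreal_leI mult_right_mono) auto
    qed simp
    finally show "(\<integral>\<^sup>+x. ennreal (\<bar>f (x - z) - f x\<bar> * \<rho> z) \<partial>lborel) \<le> ennreal (e * \<rho> z)" .
  qed
  also have "\<dots> = ennreal e"
    using i\<rho> nn \<open>0 \<le> e\<close> by (subst nn_integral_eq_integral) (auto simp: one)
  finally have *: "(\<integral>\<^sup>+x. ennreal \<bar>convol f \<rho> x - f x\<bar> \<partial>lborel) \<le> ennreal e" .
  show i: "integrable lborel (\<lambda>x. convol f \<rho> x - f x)"
    by (rule integrableI_bounded) (use * in \<open>auto intro: le_less_trans\<close>)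
  have "ennreal (\<integral>x. \<bar>convol f \<rho> x - f x\<bar> \<partial>lborel) \<le> ennreal e"
    using * nn_integral_eq_integral[OF integrable_abs[OF i]] by simp
  then show "(\<integral>x. \<bar>convol f \<rho> x - f x\<bar> \<partial>lborel) \<le> e"
    using \<open>0 \<le> e\<close> by simp
qed

lemma mollification_tendsto_L1:
  fixes f :: "real^'n::finite \<Rightarrow> real"
  assumes f: "integrable lborel f" and \<rho>: "\<And>k. mollifier (\<delta> k) (\<rho> k)" and \<delta>: "\<delta> \<longlonglongrightarrow> 0"
  shows "integrable lborel (\<lambda>x. convol f (\<rho> k) x - f x)"
    and "(\<lambda>k. \<integral>x. \<bar>convol f (\<rho> k) x - f x\<bar> \<partial>lborel) \<longlonglongrightarrow> 0"
proof -
  have [measurable]: "f \<in> borel_measurable borel"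
    using f by (auto dest: borel_measurable_integrable)
  show "integrable lborel (\<lambda>x. convol f (\<rho> k) x - f x)"
  proof (rule mollifier_L1_bound(1)[OF f \<rho>])
    \<comment> \<open>For integrability any bound on the translation errors suffices; twice the L1
      norm serves for all shifts.\<close>
    fix h show "(\<integral>x. \<bar>f (x + h) - f x\<bar> \<partial>lborel) \<le> 2 * (\<integral>x. \<bar>f x\<bar> \<partial>lborel)"
    proof -
      have i: "integrable lborel (\<lambda>x. f (x + h))"
        using lborel_integral_translate(1)[of f h] f by simp
      have "(\<integral>x. \<bar>f (x + h) - f x\<bar> \<partial>lborel) \<le> (\<integral>x. \<bar>f (x + h)\<bar> + \<bar>f x\<bar> \<partial>lborel)"
        using i f by (intro integral_mono) auto
      also have "\<dots> = 2 * (\<integral>x. \<bar>f x\<bar> \<partial>lborel)"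
        using i f lborel_integral_translate(2)[of "\<lambda>x. \<bar>f x\<bar>" h] by simp
      finally show ?thesis .
    qed
  qed
  show "(\<lambda>k. \<integral>x. \<bar>convol f (\<rho> k) x - f x\<bar> \<partial>lborel) \<longlonglongrightarrow> 0"
  proof (rule LIMSEQ_I)
    fix e :: real assume "e > 0"
    obtain d where d: "d > 0" "\<And>h. norm h < d \<Longrightarrow> (\<integral>x. \<bar>f (x + h) - f x\<bar> \<partial>lborel) \<le> e / 2"
      using integrable_translation_continuous[OF f, of "e / 2"] \<open>e > 0\<close> by auto
    have "\<forall>\<^sub>F k in sequentially. \<delta> k < d"
      using \<delta> d(1) by (rule order_tendstoD)
    then obtain N where N: "\<And>k. k \<ge> N \<Longrightarrow> \<delta> k < d"
      by (auto simp: eventually_sequentially)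
    have "norm ((\<integral>x. \<bar>convol f (\<rho> k) x - f x\<bar> \<partial>lborel) - 0) < e" if "k \<ge> N" for k
      using mollifier_L1_bound(2)[OF f \<rho>, of k "e / 2"] d(2) N[OF that] \<open>e > 0\<close> by fastforce
    then show "\<exists>N. \<forall>k\<ge>N. norm ((\<integral>x. \<bar>convol f (\<rho> k) x - f x\<bar> \<partial>lborel) - 0) < e" by blast
  qed
qed

section \<open>Weak gradients\<close>

text \<open>Lebesgue measure is complete, so measurability passes between functions that agree
  almost everywhere and need not be assumed. If neither is measurable, both integrals have the
  default value 0.\<close>

lemma integral_lebesgue_cong_AE:
  fixes f g :: "'a::euclidean_space \<Rightarrow> 'b::euclidean_space"
  assumes ae: "AE x in lebesgue. f x = g x"
  shows "integrable lebesgue f \<longleftrightarrow> integrable lebesgue g"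
    and "integral\<^sup>L lebesgue f = integral\<^sup>L lebesgue g"
proof -
  have ae': "AE x in lebesgue. g x = f x" using ae by eventually_elim simp
  have m: "f \<in> borel_measurable lebesgue \<longleftrightarrow> g \<in> borel_measurable lebesgue"
    using borel_measurable_AE ae ae' by blast
  show i: "integrable lebesgue f \<longleftrightarrow> integrable lebesgue g"
    using m integrable_cong_AE[OF _ _ ae] borel_measurable_integrable by blast
  show "integral\<^sup>L lebesgue f = integral\<^sup>L lebesgue g"
  proof (cases "f \<in> borel_measurable lebesgue")
    case True
    then show ?thesis using m ae by (intro integral_cong_AE) auto
  next
    case False
    then show ?thesis using m borel_measurable_integrable by (metis not_integrable_integral_eq)
  qed
qed

lemma set_integral_lebesgue_cong_AE:
  fixes f g :: "'a::euclidean_space \<Rightarrow> 'b::euclidean_space"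
  assumes ae: "AE x\<in>A in lebesgue. f x = g x"
  shows "set_integrable lebesgue A f \<longleftrightarrow> set_integrable lebesgue A g"
    and "(LINT x:A|lebesgue. f x) = (LINT x:A|lebesgue. g x)"
proof -
  have "AE x in lebesgue. indicator A x *\<^sub>R f x = indicator A x *\<^sub>R g x"
    using ae by eventually_elim (auto simp: indicator_def)
  from integral_lebesgue_cong_AE[OF this]
  show "set_integrable lebesgue A f \<longleftrightarrow> set_integrable lebesgue A g"
    and "(LINT x:A|lebesgue. f x) = (LINT x:A|lebesgue. g x)"
    by (auto simp: set_integrable_def set_lebesgue_integral_def)
qed

lemma lebesgue_integrable_borel_representative:
  fixes f :: "'a::euclidean_space \<Rightarrow> real"
  assumes "integrable lebesgue f"
  obtains f' where "integrable lborel f'" "AE x in lebesgue. f x = f' x"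
proof -
  obtain f' where f': "f' \<in> borel_measurable lborel" "AE x in lborel. f x = f' x"
    using completion_ex_borel_measurable_real[OF borel_measurable_integrable[OF assms]] by auto
  have ae: "AE x in lebesgue. f x = f' x" using f'(2) by (rule AE_completion)
  then have "integrable lebesgue f'" using assms integral_lebesgue_cong_AE(1) by blast
  then have "integrable lborel f'" using integrable_completion[OF f'(1)] by simp
  then show thesis using ae that by blast
qed

lemma continuous_imp_lebesgue_measurable:
  fixes f :: "'a::euclidean_space \<Rightarrow> 'b::topological_space"
  assumes "continuous_on UNIV f"
  shows "f \<in> borel_measurable lebesgue"
  using borel_measurable_continuous_onI[OF assms] by (intro measurable_completion) simp

lemma set_integrable_mult_compact_support:
  fixes f \<psi> :: "real^'n::finite \<Rightarrow> real"
  assumes f: "locally_integrable_on f G" and \<psi>: "continuous_on UNIV \<psi>"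
    and K: "compact K" "K \<subseteq> G" and supp: "\<And>x. x \<in> G \<Longrightarrow> \<psi> x \<noteq> 0 \<Longrightarrow> x \<in> K"
  shows "set_integrable lebesgue G (\<lambda>x. f x * \<psi> x)"
proof -
  have eq: "(\<lambda>x. indicator G x *\<^sub>R (f x * \<psi> x)) = (\<lambda>x. indicator K x *\<^sub>R (f x * \<psi> x))"
    using supp K by (fastforce simp: indicator_def)
  have fK: "integrable lebesgue (\<lambda>x. indicator K x *\<^sub>R f x)"
    using f K by (auto simp: locally_integrable_on_def set_integrable_def)
  have "bounded (\<psi> ` K)"
    using K \<psi> by (intro compact_imp_bounded compact_continuous_image) (auto intro: continuous_on_subset)
  then obtain B where B: "\<And>x. x \<in> K \<Longrightarrow> \<bar>\<psi> x\<bar> \<le> B" by (auto simp: bounded_iff)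
  have "integrable lebesgue (\<lambda>x. indicator K x *\<^sub>R (f x * \<psi> x))"
  proof (rule Bochner_Integration.integrable_bound[OF integrable_mult_left[OF fK, of B]])
    show "(\<lambda>x. indicator K x *\<^sub>R (f x * \<psi> x)) \<in> borel_measurable lebesgue"
      using borel_measurable_times[OF borel_measurable_integrable[OF fK] continuous_imp_lebesgue_measurable[OF \<psi>]]
      by (simp add: mult.assoc)
    show "AE x in lebesgue. norm (indicator K x *\<^sub>R (f x * \<psi> x)) \<le> norm (indicator K x *\<^sub>R f x * B)"
      using B by (auto simp: indicator_def abs_mult intro!: mult_left_mono order.trans[OF B abs_ge_self])
  qed
  then show "set_integrable lebesgue G (\<lambda>x. f x * \<psi> x)"
    unfolding set_integrable_def eq .
qed

lemma test_functionD:
  assumes "\<psi> \<in> test_functions G"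
  shows "Ck k \<psi>" "continuous_on UNIV \<psi>" "compact (closure {x. \<psi> x \<noteq> 0})" "closure {x. \<psi> x \<noteq> 0} \<subseteq> G"
    "continuous_on UNIV (partial_deriv i \<psi>)" "\<psi> x \<noteq> 0 \<Longrightarrow> x \<in> closure {x. \<psi> x \<noteq> 0}"
    "partial_deriv i \<psi> x \<noteq> 0 \<Longrightarrow> x \<in> closure {x. \<psi> x \<noteq> 0}"
proof -
  have C: "\<And>k. Ck k \<psi>" using assms by (simp add: test_functions_def)
  show "Ck k \<psi>" "continuous_on UNIV \<psi>" "continuous_on UNIV (partial_deriv i \<psi>)"
    using C[of k] C[of "Suc 0"] Ck_continuous[OF C[of 0]] by auto
  show "compact (closure {x. \<psi> x \<noteq> 0})" "closure {x. \<psi> x \<noteq> 0} \<subseteq> G"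
    using assms by (auto simp: test_functions_def)
  show "\<psi> x \<noteq> 0 \<Longrightarrow> x \<in> closure {x. \<psi> x \<noteq> 0}"
    using closure_subset[of "{x. \<psi> x \<noteq> 0}"] by blast
  show "partial_deriv i \<psi> x \<noteq> 0 \<Longrightarrow> x \<in> closure {x. \<psi> x \<noteq> 0}"
    using partial_deriv_eq_0_outside by blast
qed

lemma set_integrable_mult_test_function:
  fixes f \<psi> :: "real^'n::finite \<Rightarrow> real"
  assumes "locally_integrable_on f G" and "\<psi> \<in> test_functions G"
  shows "set_integrable lebesgue G (\<lambda>x. f x * \<psi> x)"
    and "set_integrable lebesgue G (\<lambda>x. f x * partial_deriv i \<psi> x)"
  by (rule set_integrable_mult_compact_support[OF assms(1) _ test_functionD(3,4)[OF assms(2)]];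
      use test_functionD[OF assms(2)] in blast)+

section \<open>Mollification kernels as test functions\<close>

lemma Ck_reflect: "Ck k \<rho> \<Longrightarrow> Ck k (\<lambda>y. \<rho> (x - y))"
proof (rule Ck_compose)
  show "Ck k (\<lambda>y. (x - y) $ j)" for j
    using Ck_add[OF Ck_const[of k "x $ j"] Ck_mult[OF Ck_const[of k "-1"] Ck_component[of k j]]] by simp
qed

lemma partial_deriv_reflect:
  assumes "Ck (Suc 0) \<rho>"
  shows "partial_deriv i (\<lambda>y. \<rho> (x - y)) y = - partial_deriv i \<rho> (x - y)"
proof -
  have "((\<lambda>y. x - y) has_derivative (\<lambda>h. - h)) (at y)" by (auto intro!: derivative_eq_intros)
  note D = has_derivative_compose[OF this Ck_Suc_has_derivative[OF assms]]
  show ?thesis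
    by (subst partial_deriv_eqI[OF D]) (auto simp: axis_def if_distrib if_distribR sum_negf cong: if_cong)
qed

lemma mollifier_test_function:
  assumes \<rho>: "mollifier \<delta> \<rho>" and G: "cball x \<delta> \<subseteq> G"
  shows "(\<lambda>y. \<rho> (x - y)) \<in> test_functions G"
proof -
  have "closure {y. \<rho> (x - y) \<noteq> 0} \<subseteq> cball x \<delta>"
    using \<rho> by (intro closure_minimal) (auto simp: mollifier_def dist_norm)
  moreover from this have "compact (closure {y. \<rho> (x - y) \<noteq> 0})"
    by (meson bounded_cball bounded_subset compact_eq_bounded_closed closed_closure)
  moreover have "Ck k (\<lambda>y. \<rho> (x - y))" for k
    using \<rho> by (intro Ck_reflect) (simp add: mollifier_def)
  ultimately show ?thesis
    using G by (simp add: test_functions_def del: compact_closure)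
qed

text \<open>The neighbourhood is the sum of \<open>K\<close> and a closed ball of small radius, and
  a sum of two compact sets is compact.\<close>

lemma compact_neighbourhood:
  fixes K G :: "'a::euclidean_space set"
  assumes "compact K" "open G" "K \<subseteq> G"
  obtains r K' where "r > 0" "compact K'" "K' \<subseteq> G" "\<And>x. x \<in> K \<Longrightarrow> cball x r \<subseteq> K'"
proof -
  obtain r where r: "r > 0" "(\<Union>x\<in>K. cball x r) \<subseteq> G"
    using compact_subset_open_imp_cball_epsilon_subset[OF assms] by blast
  have "(\<Union>x\<in>K. cball x r) = {x + y |x y. x \<in> K \<and> y \<in> cball 0 r}"
  proof (intro set_eqI iffI)
    fix z assume "z \<in> (\<Union>x\<in>K. cball x r)"
    then obtain x where "x \<in> K" "dist x z \<le> r" by auto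
    then show "z \<in> {x + y |x y. x \<in> K \<and> y \<in> cball 0 r}"
      by (intro CollectI exI[of _ x] exI[of _ "z - x"]) (auto simp: dist_norm norm_minus_commute)
  qed (force simp: dist_norm)
  then have "compact (\<Union>x\<in>K. cball x r)"
    using compact_sums[OF assms(1) compact_cball[of 0 r]] by simp
  then show thesis using r that by blast
qed

text \<open>At \<open>x\<close> the convolution sees only the ball of radius \<delta>. A function
  that is merely locally integrable may therefore be cut off to \<open>K\<close> and replaced by a
  Borel version \<open>f'\<close>, as \<open>convol\<close> integrates over \<open>lborel\<close>,
  and the value is still the integral of \<open>f\<close> against the reflected kernel.\<close>

lemma convol_local:
  fixes f f' \<rho> :: "real^'n::finite \<Rightarrow> real"
  assumes f': "f' \<in> borel_measurable borel" "AE y in lebesgue. indicator K y * f y = f' y"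
    and \<rho>: "continuous_on UNIV \<rho>" and supp: "\<And>z. \<rho> z \<noteq> 0 \<Longrightarrow> norm z \<le> \<delta>"
    and x: "cball x \<delta> \<subseteq> K" "K \<subseteq> G"
  shows "convol f' \<rho> x = (LINT y:G|lebesgue. f y * \<rho> (x - y))"
proof -
  have [measurable]: "\<rho> \<in> borel_measurable borel" "f' \<in> borel_measurable borel"
    using \<rho> f'(1) by (auto intro: borel_measurable_continuous_onI)
  have "convol f' \<rho> x = (\<integral>y. f' y * \<rho> (x - y) \<partial>lebesgue)"
    unfolding convol_def by (rule integral_completion[symmetric]) measurable
  also have "\<dots> = (\<integral>y. indicator G y *\<^sub>R (f y * \<rho> (x - y)) \<partial>lebesgue)"
  proof (rule integral_lebesgue_cong_AE(2))
    have mem: "y \<in> K" "y \<in> G" if "\<rho> (x - y) \<noteq> 0" for y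
      using supp[OF that] x by (auto simp: dist_norm)
    show "AE y in lebesgue. f' y * \<rho> (x - y) = indicator G y *\<^sub>R (f y * \<rho> (x - y))"
      using f'(2)
    proof eventually_elim
      case (elim y)
      then show ?case using mem[of y] by (cases "\<rho> (x - y) = 0") auto
    qed
  qed
  finally show ?thesis by (simp add: set_lebesgue_integral_def)
qed

lemma AE_open_if_AE_compact:
  fixes G :: "(real^'n::finite) set"
  assumes "open G" and "\<And>K. compact K \<Longrightarrow> K \<subseteq> G \<Longrightarrow> AE x\<in>K in lebesgue. P x"
  shows "AE x\<in>G in lebesgue. P x"
proof -
  obtain C :: "nat \<Rightarrow> (real^'n) set" where C: "\<And>n. compact (C n)" "\<And>n. C n \<subseteq> G" "\<Union>(range C) = G"
    using open_Union_compact_subsets[OF assms(1)] by metis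
  have "AE x in lebesgue. \<forall>n. x \<in> C n \<longrightarrow> P x"
    by (subst AE_all_countable) (use assms(2)[OF C(1,2)] in blast)
  then show ?thesis
  proof eventually_elim
    case (elim x)
    then show ?case using C(3) by blast
  qed
qed

lemma mollifier_sequence:
  assumes "r > 0"
  obtains \<rho> :: "nat \<Rightarrow> real^'n::finite \<Rightarrow> real" where "\<And>k. mollifier (r / Suc k) (\<rho> k)"
    "(\<lambda>k. r / Suc k) \<longlonglongrightarrow> 0" "\<And>k. r / Suc k \<le> r"
proof -
  have "\<forall>k. \<exists>\<rho> :: real^'n \<Rightarrow> real. mollifier (r / Suc k) \<rho>"
    using assms by (auto intro: mollifier_exists)
  then obtain \<rho> :: "nat \<Rightarrow> real^'n \<Rightarrow> real" where "\<And>k. mollifier (r / Suc k) (\<rho> k)" by metis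
  moreover have "(\<lambda>k. r / Suc k) \<longlonglongrightarrow> 0"
    using LIMSEQ_Suc[OF lim_const_over_n[of r]] by simp
  moreover have "r / Suc k \<le> r" for k using assms by (simp add: field_simps)
  ultimately show thesis using that by blast
qed

text \<open>On a compact \<open>K\<close> the mollifications of \<open>f\<close>, cut off to a
  neighbourhood of \<open>K\<close>, are integrals of \<open>f\<close> against test functions and
  hence vanish. They converge in L1, so a subsequence converges almost everywhere, and its limit on
  \<open>K\<close> is \<open>f\<close>.\<close>

lemma du_Bois_Reymond:
  fixes f :: "real^'n::finite \<Rightarrow> real"
  assumes G: "open G" and f: "locally_integrable_on f G"
    and 0: "\<And>\<psi>. \<psi> \<in> test_functions G \<Longrightarrow> (LINT x:G|lebesgue. f x * \<psi> x) = 0"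
  shows "AE x\<in>G in lebesgue. f x = 0"
proof (rule AE_open_if_AE_compact[OF G])
  fix K assume K: "compact K" "K \<subseteq> G"
  obtain r K' where r: "r > 0" "compact K'" "K' \<subseteq> G" "\<And>x. x \<in> K \<Longrightarrow> cball x r \<subseteq> K'"
    using compact_neighbourhood[OF K(1) G K(2)] by blast
  have "integrable lebesgue (\<lambda>x. indicator K' x * f x)"
    using f r by (simp add: locally_integrable_on_def set_integrable_def)
  then obtain f' where f': "integrable lborel f'" "AE x in lebesgue. indicator K' x * f x = f' x"
    using lebesgue_integrable_borel_representative by metis
  obtain \<rho> :: "nat \<Rightarrow> real^'n \<Rightarrow> real" where \<rho>: "\<And>k. mollifier (r / Suc k) (\<rho> k)"
    "(\<lambda>k. r / Suc k) \<longlonglongrightarrow> 0" "\<And>k. r / Suc k \<le> r"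
    using mollifier_sequence[OF r(1), where 'n = 'n] by blast
  have zero: "convol f' (\<rho> k) x = 0" if "x \<in> K" for x k
  proof -
    have sub: "cball x (r / Suc k) \<subseteq> K'"
      using r(4)[OF that] \<rho>(3)[of k] by (meson cball_subset_cball_iff order.trans subset_cball)
    have "convol f' (\<rho> k) x = (LINT y:G|lebesgue. f y * \<rho> k (x - y))"
      using \<rho>(1)[of k] f' sub r(3)
      by (intro convol_local[where K = K' and \<delta> = "r / Suc k"])
         (auto simp: mollifier_def dest: borel_measurable_integrable Ck_continuous)
    also have "\<dots> = 0"
      using mollifier_test_function[OF \<rho>(1)[of k], of x G] sub r(3) by (intro 0) auto
    finally show ?thesis .
  qed
  obtain s where s: "strict_mono s" "AE x in lborel. (\<lambda>k. convol f' (\<rho> (s k)) x - f' x) \<longlonglongrightarrow> 0"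
    using tendsto_L1_AE_subseq[where M = lborel and u = "\<lambda>k x. convol f' (\<rho> k) x - f' x"]
      mollification_tendsto_L1[OF f'(1) \<rho>(1,2)] by auto
  show "AE x\<in>K in lebesgue. f x = 0"
    using AE_completion[OF s(2)] f'(2)
  proof eventually_elim
    case (elim x)
    show ?case
    proof
      assume x: "x \<in> K"
      then have "x \<in> K'" using r(1) r(4)[of x] by auto
      then show "f x = 0" using elim zero[OF x] by (simp add: LIMSEQ_const_iff)
    qed
  qed
qed

lemma locally_integrable_cong_AE:
  fixes f f' :: "real^'n::finite \<Rightarrow> 'b::euclidean_space"
  assumes "locally_integrable_on f G" and "AE x\<in>G in lebesgue. f x = f' x"
  shows "locally_integrable_on f' G"
  unfolding locally_integrable_on_def
proof (intro allI impI)
  fix K assume K: "compact K \<and> K \<subseteq> G"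
  have "AE x\<in>K in lebesgue. f x = f' x"
    using assms(2) K by (auto elim!: eventually_mono)
  then show "set_integrable lebesgue K f'"
    using assms(1) K set_integral_lebesgue_cong_AE(1) unfolding locally_integrable_on_def by blast
qed

lemma has_weak_gradient_cong_AE:
  fixes G :: "(real^'n::finite) set"
  assumes v: "has_weak_gradient G v p"
    and "AE x\<in>G in lebesgue. v x = v' x" and "AE x\<in>G in lebesgue. p x = p' x"
  shows "has_weak_gradient G v' p'"
proof -
  have "(LINT x:G|lebesgue. v' x * partial_deriv i \<psi> x) = (LINT x:G|lebesgue. v x * partial_deriv i \<psi> x)"
    and "(LINT x:G|lebesgue. p' x $ i * \<psi> x) = (LINT x:G|lebesgue. p x $ i * \<psi> x)" for i \<psi>
    by (rule set_integral_lebesgue_cong_AE(2), use assms(2) in eventually_elim, simp)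
       (rule set_integral_lebesgue_cong_AE(2), use assms(3) in eventually_elim, simp)
  then show ?thesis
    using v locally_integrable_cong_AE[OF _ assms(2)] locally_integrable_cong_AE[OF _ assms(3)]
    unfolding has_weak_gradient_def by auto
qed

lemma locally_integrable_component:
  "locally_integrable_on p G \<Longrightarrow> locally_integrable_on (\<lambda>x. p x $ i) G"
  unfolding locally_integrable_on_def set_integrable_def
  using integrable_bounded_linear[OF bounded_linear_vec_nth, of lebesgue _ i] by fastforce

lemma locally_integrable_diff:
  "locally_integrable_on f G \<Longrightarrow> locally_integrable_on g G \<Longrightarrow> locally_integrable_on (\<lambda>x. f x - g x) G"
  unfolding locally_integrable_on_def by (blast intro: set_integral_diff)

text \<open>Since \<open>weak_gradient\<close> is an arbitrary choice, this is what makes statements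
  about it meaningful up to null sets. The components of \<open>p - q\<close> annihilate all test
  functions, and the previous lemmas apply.\<close>

lemma has_weak_gradient_unique:
  fixes G :: "(real^'n::finite) set"
  assumes G: "open G" and p: "has_weak_gradient G v p" and q: "has_weak_gradient G v' q"
    and ae: "AE x\<in>G in lebesgue. v x = v' x"
  shows "AE x\<in>G in lebesgue. p x = q x"
proof -
  have q': "has_weak_gradient G v q"
    by (rule has_weak_gradient_cong_AE[OF q]) (use ae in \<open>auto elim!: eventually_mono\<close>)
  have "AE x\<in>G in lebesgue. p x $ i - q x $ i = 0" for i
  proof (rule du_Bois_Reymond[OF G])
    have l: "locally_integrable_on (\<lambda>x. p x $ i) G" "locally_integrable_on (\<lambda>x. q x $ i) G"
      using p q by (auto simp: has_weak_gradient_def intro: locally_integrable_component)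
    then show "locally_integrable_on (\<lambda>x. p x $ i - q x $ i) G" by (rule locally_integrable_diff)
    fix \<psi> assume \<psi>: "\<psi> \<in> test_functions G"
    have "(LINT x:G|lebesgue. p x $ i * \<psi> x) = (LINT x:G|lebesgue. q x $ i * \<psi> x)"
    proof -
      have "- (LINT x:G|lebesgue. p x $ i * \<psi> x) = (LINT x:G|lebesgue. v x * partial_deriv i \<psi> x)"
        using p \<psi> by (simp add: has_weak_gradient_def)
      also have "\<dots> = - (LINT x:G|lebesgue. q x $ i * \<psi> x)"
        using q' \<psi> by (simp add: has_weak_gradient_def)
      finally show ?thesis by simp
    qed
    then show "(LINT x:G|lebesgue. (p x $ i - q x $ i) * \<psi> x) = 0"
      using set_integrable_mult_test_function(1)[OF l(1) \<psi>] set_integrable_mult_test_function(1)[OF l(2) \<psi>]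
      by (simp add: left_diff_distrib set_integral_diff)
  qed
  then have "AE x in lebesgue. \<forall>i. x \<in> G \<longrightarrow> p x $ i - q x $ i = 0"
    by (subst AE_all_countable) auto
  then show ?thesis by eventually_elim (auto simp: vec_eq_iff)
qed

lemma weak_gradient_works:
  "has_weak_gradient G v p \<Longrightarrow> has_weak_gradient G v (weak_gradient G v)"
  unfolding weak_gradient_def by (rule someI[of "has_weak_gradient G v"])

section \<open>Smooth approximation of Lipschitz perturbations of the identity\<close>

text \<open>The deviation of a mollification from the identity is an average of the deviations of
  \<phi> at translated points, so the constant \<open>L\<close> is inherited unchanged. The Jacobian
  entries are mollifications of the weak derivatives and converge in L1; a subsequence converges
  almost everywhere.\<close>

lemma smooth_approximation:
  fixes \<phi> :: "real^'n::finite \<Rightarrow> real^'n"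
  assumes \<Omega>0: "open \<Omega>0" and \<Omega>: "compact (closure \<Omega>)" "closure \<Omega> \<subseteq> \<Omega>0"
    and L: "0 \<le> L" "\<forall>x\<in>\<Omega>0. \<forall>y\<in>\<Omega>0. norm ((\<phi> x - \<phi> y) - (x - y)) \<le> L * norm (x - y)"
    and p: "\<And>j. has_weak_gradient \<Omega>0 (\<lambda>x. \<phi> x $ j) (p j)"
  shows "\<exists>\<Phi> \<delta>. (\<forall>k m j. Ck m (\<lambda>x. \<Phi> k x $ j)) \<and>
    (\<forall>k. \<forall>x\<in>\<Omega>. \<forall>y\<in>\<Omega>. norm ((\<Phi> k x - \<Phi> k y) - (x - y)) \<le> L * norm (x - y)) \<and>
    (\<forall>k. \<forall>x\<in>\<Omega>. norm (\<Phi> k x - \<phi> x) \<le> \<delta> k) \<and> \<delta> \<longlonglongrightarrow> 0 \<and>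
    (AE x\<in>\<Omega> in lebesgue. \<forall>i j. (\<lambda>k. jacobian (\<Phi> k) x $ j $ i) \<longlonglongrightarrow> p j x $ i)"
proof -
  obtain r K where r: "r > 0" "compact K" "K \<subseteq> \<Omega>0" "\<And>x. x \<in> closure \<Omega> \<Longrightarrow> cball x r \<subseteq> K"
    using compact_neighbourhood[OF \<Omega>(1) \<Omega>0 \<Omega>(2)] by blast
  obtain \<rho> :: "nat \<Rightarrow> real^'n \<Rightarrow> real" where \<rho>: "\<And>k. mollifier (r / Suc k) (\<rho> k)"
    "(\<lambda>k. r / Suc k) \<longlonglongrightarrow> 0" "\<And>k. r / Suc k \<le> r"
    using mollifier_sequence[OF r(1), where 'n = 'n] by blast
  have \<rho>D: "\<And>m k. Ck m (\<rho> k)" "\<And>k x. 0 \<le> \<rho> k x" "\<And>k x. \<rho> k x \<noteq> 0 \<Longrightarrow> norm x \<le> r / Suc k"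
    "\<And>k. integral\<^sup>L lborel (\<rho> k) = 1" "\<And>k. integrable lborel (\<rho> k)"
    using \<rho>(1) mollifier_integrable unfolding mollifier_def by blast+
  have Lip: "norm (\<phi> x - \<phi> y) \<le> (1 + L) * norm (x - y)" if "x \<in> \<Omega>0" "y \<in> \<Omega>0" for x y
    using L(2)[rule_format, OF that] norm_triangle_ineq[of "(\<phi> x - \<phi> y) - (x - y)" "x - y"] by (simp add: algebra_simps)
  have "(1 + L)-lipschitz_on \<Omega>0 \<phi>"
    using Lip L(1) by (intro lipschitz_onI) (simp_all add: dist_norm)
  then have cont: "continuous_on K \<phi>"
    using r(3) by (auto intro: lipschitz_on_continuous_on continuous_on_subset)
  \<comment> \<open>The compact \<open>K\<close> contains all closed balls of radius
    \<open>r\<close> around points of \<Omega>, and the kernels have radius at most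
    \<open>r\<close>. Although \<open>F\<close> may jump at the boundary of \<open>K\<close>, its
    mollifications on \<Omega> thus involve only values of \<phi>.\<close>
  define F where "F x = indicator K x *\<^sub>R \<phi> x" for x
  have F: "integrable lborel F" unfolding F_def by (rule borel_integrable_compact[OF r(2) cont])
  have Fj: "integrable lborel (\<lambda>x. F x $ j)" for j
    using integrable_bounded_linear[OF bounded_linear_vec_nth F] .
  have [measurable]: "F \<in> borel_measurable borel" "\<And>j. (\<lambda>x. F x $ j) \<in> borel_measurable borel"
    "\<And>k. \<rho> k \<in> borel_measurable borel"
    using F Fj \<rho>D(5) by (auto dest: borel_measurable_integrable)
  define \<Phi> where "\<Phi> k x = (\<chi> j. convol (\<lambda>x. F x $ j) (\<rho> k) x)" for k x
  have smooth: "Ck m (\<lambda>x. \<Phi> k x $ j)" for m k j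
    using Ck_convol[OF Fj \<rho>D(1,3)] by (simp add: \<Phi>_def)
  have int: "integrable lborel (\<lambda>z. \<rho> k z *\<^sub>R F (x - z))" for k x
  proof -
    obtain B where B: "\<And>x. \<bar>\<rho> k x\<bar> \<le> B"
      using bounded_continuous_support[OF Ck_continuous[OF \<rho>D(1)] \<rho>D(3)] by blast
    have "integrable lborel (\<lambda>z. F (x - z))"
      using lborel_integral_reflect(1)[of F x] F by simp
    then have "integrable lborel (\<lambda>z. B *\<^sub>R F (x - z))" by simp
    then show ?thesis
    proof (rule Bochner_Integration.integrable_bound)
      show "AE z in lborel. norm (\<rho> k z *\<^sub>R F (x - z)) \<le> norm (B *\<^sub>R F (x - z))"
      proof (rule AE_I2)
        fix z show "norm (\<rho> k z *\<^sub>R F (x - z)) \<le> norm (B *\<^sub>R F (x - z))"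
          using B[of z] by (simp add: mult_right_mono)
      qed
    qed measurable
  qed
  have \<Phi>_eq: "\<Phi> k x = (\<integral>z. \<rho> k z *\<^sub>R F (x - z) \<partial>lborel)" for k x
  proof (subst vec_eq_iff, intro allI)
    fix j
    have "(\<integral>z. \<rho> k z *\<^sub>R F (x - z) \<partial>lborel) $ j = (\<integral>z. (\<rho> k z *\<^sub>R F (x - z)) $ j \<partial>lborel)"
      using integral_bounded_linear[OF bounded_linear_vec_nth int] by metis
    also have "\<dots> = \<Phi> k x $ j"
      unfolding \<Phi>_def by (simp add: convol_commute mult.commute)
    finally show "\<Phi> k x $ j = (\<integral>z. \<rho> k z *\<^sub>R F (x - z) \<partial>lborel) $ j" by simp
  qed
  \<comment> \<open>An average with nonnegative weights of total mass one cannot exceed a bound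
    valid on the support. It gives both the Lipschitz estimate and the uniform distance.\<close>
  have bound: "norm (\<integral>z. \<rho> k z *\<^sub>R G z \<partial>lborel) \<le> B"
    if "integrable lborel (\<lambda>z. \<rho> k z *\<^sub>R G z)" "\<And>z. \<rho> k z \<noteq> 0 \<Longrightarrow> norm (G z) \<le> B"
    for k B and G :: "real^'n \<Rightarrow> real^'n"
  proof -
    have "norm (\<integral>z. \<rho> k z *\<^sub>R G z \<partial>lborel) \<le> (\<integral>z. norm (\<rho> k z *\<^sub>R G z) \<partial>lborel)"
      by (rule integral_norm_bound)
    also have "\<dots> \<le> (\<integral>z. \<rho> k z * B \<partial>lborel)"
    proof (rule integral_mono)
      fix z show "norm (\<rho> k z *\<^sub>R G z) \<le> \<rho> k z * B"
        using that(2)[of z] \<rho>D(2)[of k z] by (cases "\<rho> k z = 0") (auto intro: mult_left_mono)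
    qed (rule integrable_norm[OF that(1)], use \<rho>D(5) in simp)
    also have "\<dots> = B" using \<rho>D(4,5) by simp
    finally show ?thesis .
  qed
  have inK: "x - z \<in> K" if "x \<in> \<Omega>" "\<rho> k z \<noteq> 0" for x z k
  proof -
    have "norm z \<le> r" using order.trans[OF \<rho>D(3)[OF that(2)] \<rho>(3)] .
    then have "x - z \<in> cball x r" by (simp add: dist_norm)
    then show ?thesis using r(4)[of x] that(1) closure_subset[of \<Omega>] by blast
  qed
  have inK0: "x \<in> K" if "x \<in> \<Omega>" for x
  proof -
    have "x \<in> cball x r" using r(1) by simp
    then show ?thesis using r(4)[of x] that closure_subset[of \<Omega>] by blast
  qed
  have lip\<Phi>: "norm ((\<Phi> k x - \<Phi> k y) - (x - y)) \<le> L * norm (x - y)" if xy: "x \<in> \<Omega>" "y \<in> \<Omega>" for k x y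
  proof -
    have i: "integrable lborel (\<lambda>z. \<rho> k z *\<^sub>R (F (x - z) - F (y - z) - (x - y)))"
      using int[of k x] int[of k y] \<rho>D(5)[of k]
      by (simp add: scaleR_diff_right)
    have "(\<Phi> k x - \<Phi> k y) - (x - y) = (\<integral>z. \<rho> k z *\<^sub>R (F (x - z) - F (y - z) - (x - y)) \<partial>lborel)"
      using int[of k x] int[of k y] \<rho>D(5)[of k]
      by (simp add: \<Phi>_eq scaleR_diff_right \<rho>D(4))
    moreover have "norm (F (x - z) - F (y - z) - (x - y)) \<le> L * norm (x - y)" if "\<rho> k z \<noteq> 0" for z
      using L(2)[rule_format, of "x - z" "y - z"] inK[OF xy(1) that] inK[OF xy(2) that] r(3) by (auto simp: F_def)
    ultimately show ?thesis using bound[OF i] by simp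
  qed
  have near: "norm (\<Phi> k x - \<phi> x) \<le> (1 + L) * (r / Suc k)" if x: "x \<in> \<Omega>" for k x
  proof -
    have i: "integrable lborel (\<lambda>z. \<rho> k z *\<^sub>R (F (x - z) - \<phi> x))"
      using int[of k x] \<rho>D(5)[of k] by (simp add: scaleR_diff_right)
    have "\<Phi> k x - \<phi> x = (\<integral>z. \<rho> k z *\<^sub>R (F (x - z) - \<phi> x) \<partial>lborel)"
      using int[of k x] \<rho>D(5)[of k] by (simp add: \<Phi>_eq scaleR_diff_right \<rho>D(4))
    moreover have "norm (F (x - z) - \<phi> x) \<le> (1 + L) * (r / Suc k)" if z: "\<rho> k z \<noteq> 0" for z
    proof -
      have "norm (\<phi> (x - z) - \<phi> x) \<le> (1 + L) * norm z"
        using Lip[of "x - z" x] inK[OF x z] inK0[OF x] r(3) by auto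
      also have "\<dots> \<le> (1 + L) * (r / Suc k)"
        using \<rho>D(3)[OF z] L(1) by (intro mult_left_mono) auto
      finally show ?thesis using inK[OF x z] by (simp add: F_def)
    qed
    ultimately show ?thesis using bound[OF i] by simp
  qed
  have "\<exists>q. integrable lborel q \<and> (AE x in lebesgue. indicator K x * p j x $ i = q x)" for i j
  proof -
    have "integrable lebesgue (\<lambda>x. indicator K x * p j x $ i)"
      using locally_integrable_component[of "p j" \<Omega>0 i] p[of j] r(2,3)
      by (simp add: has_weak_gradient_def locally_integrable_on_def set_integrable_def)
    then show ?thesis by (metis lebesgue_integrable_borel_representative)
  qed
  then have "\<forall>i j. \<exists>q. integrable lborel q \<and> (AE x in lebesgue. indicator K x * p j x $ i = q x)"
    by blast
  then obtain q where "\<forall>i j. integrable lborel (q i j) \<and> (AE x in lebesgue. indicator K x * p j x $ i = q i j x)"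
    unfolding choice_iff by blast
  then have q: "\<And>i j. integrable lborel (q i j)"
    "\<And>i j. AE x in lebesgue. indicator K x * p j x $ i = q i j x"
    by blast+
  \<comment> \<open>The derivative falls on the kernel, and testing the weak gradient with the
    reflected kernel moves it to \<phi>; the sign from the reflection cancels the one from
    integration by parts.\<close>
  have jac: "jacobian (\<Phi> k) x $ j $ i = convol (q i j) (\<rho> k) x" if x: "x \<in> \<Omega>" for k x i j
  proof -
    have sub: "cball x (r / Suc k) \<subseteq> K"
      using r(4)[of x] x \<rho>(3)[of k] closure_subset[of \<Omega>] by (meson order.trans subset_cball subsetD)
    have t: "(\<lambda>y. \<rho> k (x - y)) \<in> test_functions \<Omega>0"
      using mollifier_test_function[OF \<rho>(1)] sub r(3) by blast
    have C1: "Ck (Suc 0) (\<rho> k)" by (rule \<rho>D(1))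
    have "jacobian (\<Phi> k) x $ j $ i = convol (\<lambda>x. F x $ j) (partial_deriv i (\<rho> k)) x"
      using partial_deriv_convol[OF Fj C1 \<rho>D(3)] by (simp add: jacobian_def \<Phi>_def)
    also have "\<dots> = (LINT y:\<Omega>0|lebesgue. \<phi> y $ j * partial_deriv i (\<rho> k) (x - y))"
    proof (rule convol_local[where K = K and \<delta> = "r / Suc k"])
      show "continuous_on UNIV (partial_deriv i (\<rho> k))" using \<rho>D(1)[of "Suc 0" k] by simp
      show "norm z \<le> r / Suc k" if "partial_deriv i (\<rho> k) z \<noteq> 0" for z
        using partial_deriv_support[OF \<rho>D(3) that] .
      show "AE y in lebesgue. indicator K y * \<phi> y $ j = F y $ j" by (simp add: F_def)
    qed (use sub r(3) in measurable)
    also have "\<dots> = - (LINT y:\<Omega>0|lebesgue. \<phi> y $ j * partial_deriv i (\<lambda>y. \<rho> k (x - y)) y)"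
      by (simp add: partial_deriv_reflect[OF C1] set_lebesgue_integral_def)
    also have "\<dots> = (LINT y:\<Omega>0|lebesgue. p j y $ i * \<rho> k (x - y))"
      using p[of j] t unfolding has_weak_gradient_def by auto
    also have "\<dots> = convol (q i j) (\<rho> k) x"
    proof (rule convol_local[where K = K and \<delta> = "r / Suc k", symmetric])
      show "q i j \<in> borel_measurable borel" using q(1)[of i j] by (auto dest: borel_measurable_integrable)
      show "continuous_on UNIV (\<rho> k)" by (rule Ck_continuous[OF \<rho>D(1)])
      show "norm z \<le> r / Suc k" if "\<rho> k z \<noteq> 0" for z using \<rho>D(3)[OF that] .
    qed (use q(2) sub r(3) in auto)
    finally show ?thesis .
  qed
  \<comment> \<open>One subsequence has to serve all entries at once, so it is extracted from the
    sum of the errors of all entries.\<close>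
  define S where "S k x = (\<Sum>i\<in>UNIV. \<Sum>j\<in>UNIV. \<bar>convol (q i j) (\<rho> k) x - q i j x\<bar>)" for k x
  have Si: "integrable lborel (S k)" for k
    unfolding S_def using mollification_tendsto_L1(1)[OF q(1) \<rho>(1,2)] by auto
  have "(\<lambda>k. \<integral>x. norm (S k x) \<partial>lborel) \<longlonglongrightarrow> 0"
  proof -
    have "(\<integral>x. norm (S k x) \<partial>lborel)
        = (\<Sum>i\<in>UNIV. \<Sum>j\<in>UNIV. \<integral>x. \<bar>convol (q i j) (\<rho> k) x - q i j x\<bar> \<partial>lborel)" for k
      using mollification_tendsto_L1(1)[OF q(1) \<rho>(1,2)]
      by (simp add: S_def sum_nonneg Bochner_Integration.integral_sum)
    moreover have "(\<lambda>k. \<Sum>i\<in>UNIV. \<Sum>j\<in>UNIV. \<integral>x. \<bar>convol (q i j) (\<rho> k) x - q i j x\<bar> \<partial>lborel) \<longlonglongrightarrow> 0"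
      by (intro tendsto_null_sum mollification_tendsto_L1(2)[OF q(1) \<rho>(1,2)])
    ultimately show ?thesis by simp
  qed
  from tendsto_L1_AE_subseq[OF Si this] obtain s where s: "strict_mono s"
    "AE x in lborel. (\<lambda>k. S (s k) x) \<longlonglongrightarrow> 0" by auto
  have qAE: "AE x in lebesgue. \<forall>i j. indicator K x * p j x $ i = q i j x"
    using q(2) by (simp add: AE_all_countable)
  have "AE x\<in>\<Omega> in lebesgue. \<forall>i j. (\<lambda>k. jacobian (\<Phi> (s k)) x $ j $ i) \<longlonglongrightarrow> p j x $ i"
    using AE_completion[OF s(2)] qAE
  proof eventually_elim
    case (elim x)
    show ?case
    proof (intro impI allI)
      fix i j assume x: "x \<in> \<Omega>"
      have "(\<lambda>k. convol (q i j) (\<rho> (s k)) x - q i j x) \<longlonglongrightarrow> 0"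
      proof (rule Lim_null_comparison[OF always_eventually elim(1)], intro allI)
        fix k
        have "\<bar>convol (q i j) (\<rho> (s k)) x - q i j x\<bar>
            \<le> (\<Sum>j\<in>UNIV. \<bar>convol (q i j) (\<rho> (s k)) x - q i j x\<bar>)"
          by (rule member_le_sum) auto
        also have "\<dots> \<le> S (s k) x"
          unfolding S_def
          by (rule member_le_sum[of i UNIV "\<lambda>i. \<Sum>j\<in>UNIV. \<bar>convol (q i j) (\<rho> (s k)) x - q i j x\<bar>"])
             (auto intro: sum_nonneg)
        finally show "norm (convol (q i j) (\<rho> (s k)) x - q i j x) \<le> S (s k) x" by simp
      qed
      then have "(\<lambda>k. convol (q i j) (\<rho> (s k)) x) \<longlonglongrightarrow> q i j x"
        using Lim_null by blast
      moreover have "q i j x = p j x $ i"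
        using elim(2) inK0[OF x] by (metis indicator_simps(1) mult_1)
      ultimately show "(\<lambda>k. jacobian (\<Phi> (s k)) x $ j $ i) \<longlonglongrightarrow> p j x $ i"
        using jac[OF x] by simp
    qed
  qed
  moreover have "(\<lambda>k. (1 + L) * (r / Suc (s k))) \<longlonglongrightarrow> 0"
    using LIMSEQ_subseq_LIMSEQ[OF tendsto_mult_right_zero[OF \<rho>(2), of "1 + L"] s(1)] by (simp add: o_def)
  ultimately show ?thesis
    using smooth lip\<Phi> near
    by (intro exI[of _ "\<lambda>k. \<Phi> (s k)"] exI[of _ "\<lambda>k. (1 + L) * (r / Suc (s k))"] conjI) blast+
qed

section \<open>Determinants and the Piola identity\<close>

text \<open>The segment \<open>N\<close> joins the identity to \<open>M\<close> through invertible
  matrices: a kernel vector \<open>h\<close> of \<open>N t\<close> would satisfy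
  \<open>norm h \<le> L * norm h\<close>. The determinant is 1 at the identity and cannot change
  sign along the segment.\<close>

lemma det_pos_near_identity:
  fixes M :: "real^'n^'n::finite"
  assumes L: "L < 1" and M: "\<And>h. norm (M *v h - h) \<le> L * norm h"
  shows "det M > 0"
proof (rule ccontr)
  define N where "N t = (\<chi> i j. (1 - t) * mat 1 $ i $ j + t * M $ i $ j)" for t :: real
  have Nv: "N t *v h = h + t *\<^sub>R (M *v h - h)" for t and h :: "real^'n"
  proof -
    have "N t = (1 - t) *\<^sub>R mat 1 + t *\<^sub>R M" by (simp add: N_def vec_eq_iff)
    then have "N t *v h = (1 - t) *\<^sub>R (mat 1 *v h) + t *\<^sub>R (M *v h)"
      by (simp only: matrix_vector_mult_add_rdistrib scaleR_matrix_vector_assoc)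
    then show ?thesis
      by (simp add: scaleR_diff_left scaleR_diff_right)
  qed
  have nz: "det (N t) \<noteq> 0" if "0 \<le> t" "t \<le> 1" for t
  proof -
    have "h = 0" if "N t *v h = 0" for h :: "real^'n"
    proof (rule ccontr)
      assume "h \<noteq> 0"
      have "h = - (t *\<^sub>R (M *v h - h))" using that Nv[of t h] by (simp add: eq_neg_iff_add_eq_0)
      then have "norm h = t * norm (M *v h - h)"
        using \<open>0 \<le> t\<close> by (metis abs_of_nonneg norm_minus_cancel norm_scaleR)
      also have "\<dots> \<le> norm (M *v h - h)"
        using \<open>t \<le> 1\<close> \<open>0 \<le> t\<close> by (intro mult_left_le_one_le) auto
      also have "\<dots> \<le> L * norm h" by (rule M)
      also have "\<dots> < norm h" using L \<open>h \<noteq> 0\<close> by simp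
      finally show False by simp
    qed
    then have "invertible (N t)"
      unfolding invertible_left_inverse matrix_left_invertible_ker by blast
    then show ?thesis by (simp add: invertible_det_nz)
  qed
  assume "\<not> det M > 0"
  moreover have "N 1 = M" "N 0 = mat 1" by (simp_all add: N_def vec_eq_iff)
  moreover have "continuous_on {0..1} (\<lambda>t. det (N t))"
    unfolding det_def N_def by (auto intro!: continuous_intros)
  ultimately have "\<exists>t\<ge>0. t \<le> 1 \<and> det (N t) = 0"
    by (intro IVT2') auto
  then show False using nz by blast
qed

text \<open>For \<open>r = axis j 1\<close> this is the \<open>(i, j)\<close> cofactor of
  \<open>M\<close>. Cofactors are encoded as determinants of the full size so that linearity in the
  rows and the determinant bounds apply to them directly.\<close>

definition det_row_replaced :: "real^'n^'n::finite \<Rightarrow> 'n \<Rightarrow> real^'n \<Rightarrow> real" where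
  "det_row_replaced M i r = det (\<chi> b. if b = i then r else M $ b)"

lemma det_row_replaced_expand:
  "det_row_replaced M i r = (\<Sum>j\<in>UNIV. r $ j * det_row_replaced M i (axis j 1))"
proof -
  have "det_row_replaced M i r = det_row_replaced M i (\<Sum>j\<in>UNIV. r $ j *s axis j 1)"
    by (simp add: basis_expansion)
  then show ?thesis
    unfolding det_row_replaced_def by (simp only: det_linear_row_sum[OF finite] det_row_mul)
qed

text \<open>Cramer's rule: \<open>transpose M *v c\<close> is the combination of the rows of
  \<open>M\<close> with coefficients \<open>c\<close>, and in place of row \<open>i\<close> only its
  multiple of row \<open>i\<close> contributes.\<close>

lemma det_row_replaced_transpose:
  "det_row_replaced M i (transpose M *v c) = c $ i * det M"
proof -
  have "det_row_replaced M i (transpose M *v c)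
      = det (transpose (\<chi> b. if b = i then transpose M *v c else M $ b))"
    by (simp only: det_row_replaced_def det_transpose)
  also have "transpose (\<chi> b. if b = i then transpose M *v c else M $ b)
      = (\<chi> a b. if b = i then (transpose M *v c) $ a else transpose M $ a $ b)"
    by (simp add: transpose_def vec_eq_iff)
  also have "det \<dots> = c $ i * det M"
    using cramer_lemma[of i "transpose M" c] by (simp add: det_transpose)
  finally show ?thesis .
qed

lemma matrix_inv_mult:
  fixes A :: "real^'n^'n::finite"
  assumes "det A \<noteq> 0"
  shows "A *v (matrix_inv A *v r) = r"
proof -
  have "invertible A" using assms invertible_det_nz by blast
  then have "A ** matrix_inv A = mat 1" unfolding matrix_inv_def invertible_def by (rule someI2_ex) blast
  then show ?thesis by (simp add: matrix_vector_mul_assoc)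
qed

text \<open>This eliminates the inverse matrix: once multiplied by the determinant, as happens in a
  change of variables, the transformed gradient is a combination of cofactors.\<close>

lemma det_row_replaced_matrix_inv:
  assumes "det M \<noteq> 0"
  shows "(matrix_inv (transpose M) *v r) $ i * det M = det_row_replaced M i r"
  using det_row_replaced_transpose[of M i "matrix_inv (transpose M) *v r"]
    matrix_inv_mult[of "transpose M" r] assms by (simp add: det_transpose)

text \<open>The product rule in the Leibniz expansion, with the terms grouped by the differentiated
  row.\<close>

lemma det_has_derivative:
  fixes N :: "'a::real_normed_vector \<Rightarrow> real^'n^'n::finite"
  assumes "\<And>b a. ((\<lambda>x. N x $ b $ a) has_derivative (\<lambda>h. N' h $ b $ a)) (at x)"
  shows "((\<lambda>x. det (N x)) has_derivative (\<lambda>h. \<Sum>b\<in>UNIV. det_row_replaced (N x) b (N' h $ b))) (at x)"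
proof -
  have eq: "(\<Sum>p | p permutes (UNIV :: 'n set). of_int (sign p) *
        (\<Sum>b\<in>UNIV. N' h $ b $ p b * (\<Prod>c\<in>UNIV - {b}. N x $ c $ p c)))
      = (\<Sum>b\<in>UNIV. det_row_replaced (N x) b (N' h $ b))" for h
  proof -
    have "(\<Prod>c\<in>UNIV. (if c = b then N' h $ b else N x $ c) $ p c)
        = N' h $ b $ p b * (\<Prod>c\<in>UNIV - {b}. N x $ c $ p c)" for b and p :: "'n \<Rightarrow> 'n"
      by (subst prod.remove[of UNIV b]) (auto intro!: prod.cong arg_cong2[where f = "(*)"])
    then show ?thesis
      unfolding det_row_replaced_def det_def
      by (simp only: vec_lambda_beta sum_distrib_left) (rule sum.swap)
  qed
  have "((\<lambda>x. det (N x)) has_derivative (\<lambda>h. \<Sum>p | p permutes (UNIV :: 'n set). of_int (sign p) *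
        (\<Sum>b\<in>UNIV. N' h $ b $ p b * (\<Prod>c\<in>UNIV - {b}. N x $ c $ p c)))) (at x)"
    unfolding det_def
    by (intro has_derivative_sum has_derivative_mult_right has_derivative_prod assms)
  then show ?thesis unfolding eq .
qed

text \<open>Polarisation: the determinant with \<open>r + s\<close> in both rows vanishes, and so do
  the diagonal terms of its bilinear expansion.\<close>

lemma det_two_rows_antisymmetric:
  fixes M :: "real^'n^'n::finite"
  assumes "i \<noteq> b"
  shows "det (\<chi> c. if c = i then r else if c = b then s else M $ c)
       = - det (\<chi> c. if c = i then s else if c = b then r else M $ c)"
proof -
  let ?D = "\<lambda>r s. det (\<chi> c. if c = i then r else if c = b then s else M $ c)"
  have D: "?D r s = det (\<chi> c. if c = b then s else if c = i then r else M $ c)" for r s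
    using assms by (intro arg_cong[of _ _ det]) (auto simp: vec_eq_iff)
  have add1: "?D (r + r') s = ?D r s + ?D r' s" for r r' s
    using det_row_add[of i "\<lambda>_. r" "\<lambda>_. r'" "\<lambda>c. if c = b then s else M $ c"] by simp
  have add2: "?D r (s + s') = ?D r s + ?D r s'" for r s s'
    unfolding D using det_row_add[of b "\<lambda>_. s" "\<lambda>_. s'" "\<lambda>c. if c = i then r else M $ c"] by simp
  have zero: "?D r r = 0" for r
    by (rule det_identical_rows[OF assms]) (auto simp: row_def vec_eq_iff)
  have "?D (r + s) (r + s) = ?D r s + ?D s r"
    by (simp add: add1 add2 zero)
  then show ?thesis using zero[of "r + s"] by simp
qed

lemma Ck_det:
  fixes N :: "real^'m::finite \<Rightarrow> real^'n^'n::finite"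
  assumes "\<And>b a. Ck k (\<lambda>x. N x $ b $ a)"
  shows "Ck k (\<lambda>x. det (N x))"
  unfolding det_def by (intro Ck_sum Ck_mult Ck_const Ck_prod assms)

lemma Ck_det_row_replaced:
  fixes N :: "real^'m::finite \<Rightarrow> real^'n^'n::finite"
  assumes "\<And>b a. Ck k (\<lambda>x. N x $ b $ a)"
  shows "Ck k (\<lambda>x. det_row_replaced (N x) i r)"
  unfolding det_row_replaced_def
proof (rule Ck_det)
  show "Ck k (\<lambda>x. (\<chi> b. if b = i then r else N x $ b) $ b $ a)" for b a
    using assms by (cases "b = i") (auto intro: Ck_const)
qed

lemma Ck_jacobian:
  assumes "\<And>k j. Ck k (\<lambda>x. \<Phi> x $ j)"
  shows "Ck k (\<lambda>x. jacobian \<Phi> x $ b $ a)"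
  using assms[of "Suc k" b] by (simp add: jacobian_def)

text \<open>Row \<open>i\<close> of the modified matrix is constant, so only the other rows are
  differentiated. For each of them the term is a second derivative \<open>H\<close>, symmetric in
  \<open>j\<close> and \<open>l\<close>, times a determinant \<open>D\<close>, antisymmetric in
  \<open>j\<close> and \<open>l\<close>; the double sum equals its own negative.\<close>

lemma Piola_identity:
  fixes \<Phi> :: "real^'n \<Rightarrow> real^'n::finite"
  assumes \<Phi>: "\<And>k j. Ck k (\<lambda>x. \<Phi> x $ j)"
  shows "(\<Sum>j\<in>UNIV. partial_deriv j (\<lambda>x. det_row_replaced (jacobian \<Phi> x) i (axis j 1)) x) = 0"
proof -
  define H where "H b j l = partial_deriv j (\<lambda>x. jacobian \<Phi> x $ b $ l) x" for b j l
  define D where "D b j l = det (\<chi> c. if c = i then axis j 1 else if c = b then axis l 1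
      else jacobian \<Phi> x $ c)" for b j l
  have H_sym: "H b j l = H b l j" for b j l
    using partial_deriv_commute[OF \<Phi>[of "Suc (Suc 0)" b], of j l x]
    by (simp add: H_def jacobian_def)
  have D_anti: "D b j l = - D b l j" if "i \<noteq> b" for b j l
    unfolding D_def by (rule det_two_rows_antisymmetric[OF that])
  have deriv: "partial_deriv j (\<lambda>x. det_row_replaced (jacobian \<Phi> x) i (axis j 1)) x
    = (\<Sum>b\<in>UNIV - {i}. \<Sum>l\<in>UNIV. H b j l * D b j l)" for j
  proof -
    define N where "N x = (\<chi> b. if b = i then axis j 1 else jacobian \<Phi> x $ b)" for x
    define N' where "N' h = (\<chi> b a. if b = i then 0 else \<Sum>k\<in>UNIV. h $ k * H b k a)" for h :: "real^'n"
    have "((\<lambda>x. N x $ b $ a) has_derivative (\<lambda>h. N' h $ b $ a)) (at x)" for b a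
      using Ck_Suc_has_derivative[OF Ck_jacobian[OF \<Phi>, of "Suc 0" b a], of x]
      by (cases "b = i") (auto simp: N_def N'_def H_def)
    note d = det_has_derivative[OF this]
    have "partial_deriv j (\<lambda>x. det_row_replaced (jacobian \<Phi> x) i (axis j 1)) x
        = (\<Sum>b\<in>UNIV. det_row_replaced (N x) b (N' (axis j 1) $ b))"
      using partial_deriv_eqI[OF d] by (simp add: det_row_replaced_def N_def)
    also have "\<dots> = (\<Sum>b\<in>UNIV - {i}. det_row_replaced (N x) b (N' (axis j 1) $ b))"
    proof (rule sum.mono_neutral_right)
      have "N' (axis j 1) $ i = 0" by (simp add: N'_def vec_eq_iff)
      then show "\<forall>b\<in>UNIV - (UNIV - {i}). det_row_replaced (N x) b (N' (axis j 1) $ b) = 0"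
        using det_row_0[of i "\<lambda>b. N x $ b"] by (auto simp: det_row_replaced_def)
    qed auto
    also have "\<dots> = (\<Sum>b\<in>UNIV - {i}. \<Sum>l\<in>UNIV. H b j l * D b j l)"
    proof (rule sum.cong[OF refl])
      fix b assume b: "b \<in> UNIV - {i}"
      have "N' (axis j 1) $ b $ l = H b j l" for l
        using b by (simp add: N'_def axis_def if_distrib if_distribR cong: if_cong)
      moreover have "det_row_replaced (N x) b (axis l 1) = D b j l" for l
        unfolding det_row_replaced_def D_def N_def
        using b by (intro arg_cong[of _ _ det]) (auto simp: vec_eq_iff)
      ultimately show "det_row_replaced (N x) b (N' (axis j 1) $ b) = (\<Sum>l\<in>UNIV. H b j l * D b j l)"
        by (subst det_row_replaced_expand) simp
    qed
    finally show ?thesis .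
  qed
  have "(\<Sum>j\<in>UNIV. partial_deriv j (\<lambda>x. det_row_replaced (jacobian \<Phi> x) i (axis j 1)) x)
      = (\<Sum>b\<in>UNIV - {i}. \<Sum>j\<in>UNIV. \<Sum>l\<in>UNIV. H b j l * D b j l)"
    unfolding deriv by (rule sum.swap)
  also have "\<dots> = (\<Sum>b\<in>UNIV - {i}. 0)"
  proof (rule sum.cong[OF refl])
    fix b assume "b \<in> UNIV - {i}"
    then have "i \<noteq> b" by auto
    have "(\<Sum>j\<in>UNIV. \<Sum>l\<in>UNIV. H b j l * D b j l) = (\<Sum>l\<in>UNIV. \<Sum>j\<in>UNIV. H b j l * D b j l)"
      by (rule sum.swap)
    also have "\<dots> = (\<Sum>l\<in>UNIV. \<Sum>j\<in>UNIV. - (H b l j * D b l j))"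
    proof (intro sum.cong refl)
      fix l j show "H b j l * D b j l = - (H b l j * D b l j)"
        using H_sym[of b j l] D_anti[OF \<open>i \<noteq> b\<close>, of j l] by simp
    qed
    also have "\<dots> = - (\<Sum>j\<in>UNIV. \<Sum>l\<in>UNIV. H b j l * D b j l)"
      by (simp add: sum_negf)
    finally show "(\<Sum>j\<in>UNIV. \<Sum>l\<in>UNIV. H b j l * D b j l) = 0" by simp
  qed
  finally show ?thesis by simp
qed

section \<open>Change of variables for smooth maps\<close>

text \<open>
  The change of variables theorem of the library is restricted to wellordered index types. This
  copy of an arbitrary finite index type carries such an order.
\<close>

typedef ('n::finite) ordered_index = "{..<CARD('n)}"
  by (rule exI[of _ 0]) simp

instantiation ordered_index :: (finite) linorder
begin

definition "less_eq_ordered_index (a :: 'a ordered_index) (b :: 'a ordered_index) \<longleftrightarrow> Rep_ordered_index a \<le> Rep_ordered_index b"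
definition "less_ordered_index (a :: 'a ordered_index) (b :: 'a ordered_index) \<longleftrightarrow> Rep_ordered_index a < Rep_ordered_index b"

instance
  by standard (auto simp: less_eq_ordered_index_def less_ordered_index_def Rep_ordered_index_inject)

end

lemma UNIV_ordered_index: "(UNIV :: 'n::finite ordered_index set) = Abs_ordered_index ` {..<CARD('n)}"
  by (metis type_definition.Abs_image type_definition_ordered_index)

instance ordered_index :: (finite) finite
  by standard (simp add: UNIV_ordered_index)

instance ordered_index :: (finite) wellorder
proof
  fix P :: "'a ordered_index \<Rightarrow> bool" and a
  assume step: "\<And>x. (\<And>y. y < x \<Longrightarrow> P y) \<Longrightarrow> P x"
  show "P a"
    by (induction a rule: measure_induct_rule[of Rep_ordered_index])
       (auto intro: step simp: less_ordered_index_def)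
qed

lemma ordered_index_bij: "\<exists>\<beta> :: 'n::finite ordered_index \<Rightarrow> 'n. bij \<beta>"
proof -
  have "CARD('n ordered_index) = CARD('n)"
    unfolding UNIV_ordered_index
    by (subst card_image) (auto simp: inj_on_def Abs_ordered_index_inject)
  then show ?thesis using finite_same_card_bij[of "UNIV :: 'n ordered_index set" "UNIV :: 'n set"] by simp
qed

text \<open>Conjugation by \<beta> matches the permutations of the two index types and preserves
  both the sign and the product in each Leibniz term.\<close>

lemma det_reindex:
  fixes M :: "real^'n::finite^'n" and \<beta> :: "'m::finite \<Rightarrow> 'n"
  assumes \<beta>: "bij \<beta>"
  shows "det (\<chi> a b. M $ \<beta> a $ \<beta> b) = det M"
proof -
  have inv: "inv \<beta> (\<beta> a) = a" "\<beta> (inv \<beta> c) = c" for a c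
    using \<beta> by (simp_all add: bij_is_inj bij_is_surj surj_f_inv_f)
  have mp: "map_permutation UNIV \<beta> p c = \<beta> (p (inv \<beta> c))" for p c
    using \<beta> by (simp add: map_permutation_def bij_is_surj restrict_id_def)
  have mp': "map_permutation UNIV (inv \<beta>) q a = inv \<beta> (q (\<beta> a))" for q a
    using \<beta> by (simp add: map_permutation_def bij_imp_bij_inv bij_is_surj restrict_id_def inv_inv_eq)
  have "det (\<chi> a b. M $ \<beta> a $ \<beta> b)
    = (\<Sum>p | p permutes (UNIV::'m set). of_int (sign p) * (\<Prod>a\<in>UNIV. M $ \<beta> a $ \<beta> (p a)))"
    by (simp add: det_def)
  also have "\<dots> = (\<Sum>q | q permutes (UNIV::'n set). of_int (sign q) * (\<Prod>c\<in>UNIV. M $ c $ q c))"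
  proof (rule sum.reindex_bij_witness[where i = "map_permutation UNIV (inv \<beta>)" and j = "map_permutation UNIV \<beta>"])
    fix p assume p: "p \<in> {p. p permutes (UNIV::'m set)}"
    show "map_permutation UNIV (inv \<beta>) (map_permutation UNIV \<beta> p) = p"
      by (rule ext) (simp add: mp mp' inv)
    show "map_permutation UNIV \<beta> p \<in> {q. q permutes UNIV}"
      using p map_permutation_permutes[of \<beta> UNIV UNIV p] \<beta> by simp
    have "sign (map_permutation UNIV \<beta> p) = sign p"
      using p \<beta> by (intro sign_map_permutation) (auto simp: bij_is_inj)
    moreover have "(\<Prod>c\<in>UNIV. M $ c $ map_permutation UNIV \<beta> p c) = (\<Prod>a\<in>UNIV. M $ \<beta> a $ \<beta> (p a))"
      using prod.reindex_bij_betw[OF \<beta>, of "\<lambda>c. M $ c $ map_permutation UNIV \<beta> p c"]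
      by (simp add: mp inv)
    ultimately show "of_int (sign (map_permutation UNIV \<beta> p)) * (\<Prod>c\<in>UNIV. M $ c $ map_permutation UNIV \<beta> p c)
      = of_int (sign p) * (\<Prod>a\<in>UNIV. M $ \<beta> a $ \<beta> (p a))"
      by simp
  next
    fix q assume q: "q \<in> {q. q permutes (UNIV::'n set)}"
    show "map_permutation UNIV \<beta> (map_permutation UNIV (inv \<beta>) q) = q"
      by (rule ext) (simp add: mp mp' inv)
    show "map_permutation UNIV (inv \<beta>) q \<in> {p. p permutes UNIV}"
      using q map_permutation_permutes[of "inv \<beta>" UNIV UNIV q] \<beta> by (simp add: bij_imp_bij_inv)
  qed
  finally show ?thesis by (simp add: det_def)
qed

lemma prod_Basis_cart:
  fixes f :: "real^'n::finite \<Rightarrow> real"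
  shows "(\<Prod>b\<in>Basis. f b) = (\<Prod>i\<in>UNIV. f (axis i 1))"
proof -
  have B: "(Basis :: (real^'n) set) = range (\<lambda>i. axis i 1)" by (auto simp: Basis_vec_def)
  have "inj (\<lambda>i::'n. axis i (1::real))" by (auto simp: inj_on_def axis_eq_axis)
  then show ?thesis unfolding B by (subst prod.reindex) (simp_all add: o_def)
qed

definition reindex_vec :: "('m \<Rightarrow> 'n) \<Rightarrow> 'a^'n \<Rightarrow> 'a^'m" where
  "reindex_vec \<beta> x = (\<chi> a. x $ \<beta> a)"

lemma reindex_vec_inv:
  assumes "bij \<beta>"
  shows "reindex_vec (inv \<beta>) (reindex_vec \<beta> x) = x" "reindex_vec \<beta> (reindex_vec (inv \<beta>) y) = y"
  using assms by (simp_all add: reindex_vec_def vec_eq_iff bij_is_inj bij_is_surj surj_f_inv_f)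

lemma bounded_linear_reindex_vec: "bounded_linear (reindex_vec \<beta> :: real^'n::finite \<Rightarrow> real^'m::finite)"
  by (intro linear_conv_bounded_linear[THEN iffD1] linearI) (simp_all add: reindex_vec_def vec_eq_iff)

lemma continuous_reindex_vec: "continuous_on S (reindex_vec \<beta> :: real^'n::finite \<Rightarrow> real^'m::finite)"
  by (rule linear_continuous_on[OF bounded_linear_reindex_vec])

text \<open>A renaming of coordinates turns a box into a box with the same side lengths in another
  order, and the values on boxes characterise Lebesgue measure.\<close>

lemma distr_reindex_vec:
  fixes \<beta> :: "'m::finite \<Rightarrow> 'n::finite"
  assumes \<beta>: "bij \<beta>"
  shows "distr lborel borel (reindex_vec \<beta>) = (lborel :: (real^'m) measure)"
proof (rule lborel_eqI[symmetric])
  fix l u :: "real^'m" assume lu: "\<And>b. b \<in> Basis \<Longrightarrow> l \<bullet> b \<le> u \<bullet> b"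
  have m: "(reindex_vec \<beta> :: real^'n \<Rightarrow> real^'m) \<in> borel_measurable borel"
    by (intro borel_measurable_continuous_onI continuous_reindex_vec)
  have le: "l $ a \<le> u $ a" for a using lu[of "axis a 1"] by (simp add: inner_axis)
  have all: "(\<forall>a. P (\<beta> a) a) \<longleftrightarrow> (\<forall>i. P i (inv \<beta> i))" for P
    using \<beta> by (metis bij_inv_eq_iff)
  have "reindex_vec \<beta> -` box l u = box (reindex_vec (inv \<beta>) l) (reindex_vec (inv \<beta>) u)"
    by (auto simp: mem_box_cart reindex_vec_def all[of "\<lambda>i a. l $ a < _ $ i"] all[of "\<lambda>i a. _ $ i < u $ a"])
       (metis \<beta> bij_inv_eq_iff)+
  then have "emeasure (distr lborel borel (reindex_vec \<beta>)) (box l u)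
      = emeasure lborel (box (reindex_vec (inv \<beta>) l) (reindex_vec (inv \<beta>) u))"
    using m by (simp add: emeasure_distr)
  also have "\<dots> = (\<Prod>b\<in>Basis. (reindex_vec (inv \<beta>) u - reindex_vec (inv \<beta>) l) \<bullet> b)"
    by (rule emeasure_lborel_box) (use le in \<open>auto simp: Basis_vec_def inner_axis reindex_vec_def\<close>)
  also have "(\<Prod>b\<in>Basis. (reindex_vec (inv \<beta>) u - reindex_vec (inv \<beta>) l) \<bullet> b)
      = (\<Prod>i\<in>UNIV. u $ inv \<beta> i - l $ inv \<beta> i)"
    by (subst prod_Basis_cart) (simp add: inner_axis reindex_vec_def)
  also have "\<dots> = (\<Prod>a\<in>UNIV. u $ a - l $ a)"
    by (rule prod.reindex_bij_betw[OF bij_imp_bij_inv[OF \<beta>]])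
  also have "\<dots> = (\<Prod>b\<in>Basis. (u - l) \<bullet> b)"
    by (subst prod_Basis_cart) (simp add: inner_axis)
  finally show "emeasure (distr lborel borel (reindex_vec \<beta>)) (box l u) = (\<Prod>b\<in>Basis. (u - l) \<bullet> b)" .
qed simp

lemma integral_reindex_vec:
  fixes \<beta> :: "'m::finite \<Rightarrow> 'n::finite" and f :: "real^'m \<Rightarrow> 'b::euclidean_space"
  assumes \<beta>: "bij \<beta>" and f: "f \<in> borel_measurable borel"
  shows "integrable lborel (\<lambda>x. f (reindex_vec \<beta> x)) \<longleftrightarrow> integrable lborel f"
    and "(\<integral>x. f (reindex_vec \<beta> x) \<partial>lborel) = (\<integral>y. f y \<partial>lborel)"
proof -
  have m: "(reindex_vec \<beta> :: real^'n \<Rightarrow> real^'m) \<in> borel_measurable borel"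
    by (intro borel_measurable_continuous_onI continuous_reindex_vec)
  show "integrable lborel (\<lambda>x. f (reindex_vec \<beta> x)) \<longleftrightarrow> integrable lborel f"
    by (subst distr_reindex_vec[OF \<beta>, symmetric], subst integrable_distr_eq) (use m f in auto)
  show "(\<integral>x. f (reindex_vec \<beta> x) \<partial>lborel) = (\<integral>y. f y \<partial>lborel)"
    by (subst distr_reindex_vec[OF \<beta>, symmetric], subst integral_distr) (use m f in auto)
qed

text \<open>The coordinates are renamed by \<open>T\<close>, with inverse \<open>U\<close>, and the
  theorem for wellordered indices is applied to the conjugated map \<Psi>. Renaming preserves the
  measure and the determinant, so the formula returns unchanged.\<close>

lemma smooth_change_of_variables:
  fixes \<Phi> :: "real^'n::finite \<Rightarrow> real^'n" and f :: "real^'n \<Rightarrow> real"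
  assumes \<Omega>: "open \<Omega>" and \<Phi>: "\<And>j. Ck (Suc 0) (\<lambda>x. \<Phi> x $ j)" and inj: "inj_on \<Phi> \<Omega>"
    and f: "f \<in> borel_measurable borel" and int: "integrable lborel (\<lambda>y. indicator (\<Phi> ` \<Omega>) y * f y)"
  shows "(\<integral>y. indicator (\<Phi> ` \<Omega>) y * f y \<partial>lborel)
       = (\<integral>x. indicator \<Omega> x * (\<bar>det (jacobian \<Phi> x)\<bar> * f (\<Phi> x)) \<partial>lborel)"
proof -
  obtain \<beta> :: "'n ordered_index \<Rightarrow> 'n" where \<beta>: "bij \<beta>" using ordered_index_bij by blast
  define T where "T = (reindex_vec \<beta> :: real^'n \<Rightarrow> real^'n ordered_index)"
  define U where "U = (reindex_vec (inv \<beta>) :: real^'n ordered_index \<Rightarrow> real^'n)"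
  have UT: "U (T x) = x" "T (U y) = y" for x y
    using reindex_vec_inv[OF \<beta>] by (auto simp: T_def U_def)
  have bl: "bounded_linear T" "bounded_linear U"
    by (simp_all add: T_def U_def bounded_linear_reindex_vec)
  have cT: "continuous_on S T" "continuous_on S' U" for S S'
    by (simp_all add: T_def U_def continuous_reindex_vec)
  have TU_img: "T ` S = U -` S" for S
    by (auto simp: UT) (metis UT(2) image_eqI)
  have T_open: "open (T ` S)" if "open S" for S
    unfolding TU_img using cT(2) that by (simp add: open_vimage continuous_on_eq_continuous_at)
  have \<Phi>cont: "continuous_on S \<Phi>" for S
    using has_derivative_continuous[OF jacobian_has_derivative[OF \<Phi>]]
    by (simp add: continuous_at_imp_continuous_on)
  have \<Phi>open: "open (\<Phi> ` \<Omega>)" using invariance_of_domain[OF \<Phi>cont \<Omega> inj] .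
  have fm: "(\<lambda>y. f (U y)) \<in> borel_measurable borel"
    by (rule measurable_compose[OF borel_measurable_continuous_onI[OF cT(2)] f])
  define \<Psi> where "\<Psi> y = T (\<Phi> (U y))" for y
  define \<Psi>' where "\<Psi>' y h = T (jacobian \<Phi> (U y) *v U h)" for y h
  have der: "(\<Psi> has_derivative \<Psi>' y) (at y within S)" for y S
  proof -
    have "((\<lambda>y. \<Phi> (U y)) has_derivative (\<lambda>h. jacobian \<Phi> (U y) *v U h)) (at y within S)"
      using has_derivative_compose[OF bounded_linear_imp_has_derivative[OF bl(2)] jacobian_has_derivative[OF \<Phi>]] .
    from bounded_linear.has_derivative[OF bl(1) this] show ?thesis unfolding \<Psi>_def \<Psi>'_def .
  qed
  \<comment> \<open>The matrix of the conjugated derivative is the Jacobian with rows and columns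
    renamed by the same bijection.\<close>
  have det: "det (matrix (\<Psi>' y)) = det (jacobian \<Phi> (U y))" for y
  proof -
    have "inv \<beta> i = b \<longleftrightarrow> i = \<beta> b" for i b
      using \<beta> by (metis bij_inv_eq_iff)
    then have Ua: "U (axis b 1) = axis (\<beta> b) 1" for b
      by (simp add: U_def reindex_vec_def axis_def vec_eq_iff)
    have "matrix (\<Psi>' y) = (\<chi> a b. jacobian \<Phi> (U y) $ \<beta> a $ \<beta> b)"
      unfolding matrix_def \<Psi>'_def Ua
      by (simp add: vec_eq_iff T_def reindex_vec_def matrix_vector_mult_basis column_def)
    then show ?thesis by (simp only: det_reindex[OF \<beta>])
  qed
  have inj': "inj_on \<Psi> (T ` \<Omega>)"
    using inj UT by (auto simp: inj_on_def \<Psi>_def) (metis UT(1))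
  have img: "\<Psi> ` T ` \<Omega> = T ` \<Phi> ` \<Omega>" by (simp add: image_image \<Psi>_def UT)
  define F where "F y = (vec (f (U y)) :: real^1)" for y
  have sub: "(\<lambda>y. indicator (T ` \<Phi> ` \<Omega>) y * f (U y)) \<in> borel_measurable borel"
    using fm T_open[OF \<Phi>open] by auto
  have meas: "(\<lambda>y. indicator (T ` \<Omega>) y * (\<bar>det (jacobian \<Phi> (U y))\<bar> * f (\<Phi> (U y)))) \<in> borel_measurable borel"
  proof -
    have "continuous_on UNIV (\<lambda>x. det (jacobian \<Phi> x))"
      unfolding det_def jacobian_def using \<Phi> by (auto intro!: continuous_intros)
    then have "continuous_on UNIV (\<lambda>y. det (jacobian \<Phi> (U y)))"
      by (rule continuous_on_compose2[OF _ cT(2)]) auto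
    then have "(\<lambda>y. det (jacobian \<Phi> (U y))) \<in> borel_measurable borel"
      by (rule borel_measurable_continuous_onI)
    moreover have "(\<lambda>y. f (\<Phi> (U y))) \<in> borel_measurable borel"
      by (rule measurable_compose[OF borel_measurable_continuous_onI f],
          rule continuous_on_compose2[OF \<Phi>cont cT(2)]) auto
    moreover have "(indicator (T ` \<Omega>) :: _ \<Rightarrow> real) \<in> borel_measurable borel"
      using T_open[OF \<Omega>] by simp
    ultimately show ?thesis
      by (intro borel_measurable_times borel_measurable_abs)
  qed
  have ind: "indicator (T ` S) (T x) = (indicator S x :: real)" for S x
    using UT by (auto simp: indicator_def TU_img)
  have 1: "integrable lborel (\<lambda>y. indicator (T ` \<Phi> ` \<Omega>) y * f (U y))"
    "(\<integral>y. indicator (T ` \<Phi> ` \<Omega>) y * f (U y) \<partial>lborel) = (\<integral>y. indicator (\<Phi> ` \<Omega>) y * f y \<partial>lborel)"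
    using integral_reindex_vec[OF \<beta> sub] int by (simp_all add: T_def[symmetric] ind UT)
  have 2: "(\<integral>y. indicator (T ` \<Omega>) y * (\<bar>det (jacobian \<Phi> (U y))\<bar> * f (\<Phi> (U y))) \<partial>lborel)
     = (\<integral>x. indicator \<Omega> x * (\<bar>det (jacobian \<Phi> x)\<bar> * f (\<Phi> x)) \<partial>lborel)"
    using integral_reindex_vec(2)[OF \<beta> meas] by (simp add: T_def[symmetric] ind UT)
  \<comment> \<open>The theorem to be applied is stated for vector-valued integrands over Lebesgue
    measure; scalar integrands over \<open>lborel\<close> are passed to it as vectors of length
    one.\<close>
  have vec_int: "set_integrable lebesgue S (\<lambda>y. vec (h y) :: real^1) \<and>
      (LINT y:S|lebesgue. vec (h y) :: real^1) $ 1 = (\<integral>y. indicator S y * h y \<partial>lborel)"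
    if "(\<lambda>y. indicator S y * h y) \<in> borel_measurable borel" "integrable lborel (\<lambda>y. indicator S y * h y)"
    for S and h :: "real^'n ordered_index \<Rightarrow> real"
  proof -
    have i: "integrable lebesgue (\<lambda>y. indicator S y * h y)"
      using that by (simp add: integrable_completion)
    have blv: "bounded_linear (vec :: real \<Rightarrow> real^1)"
      by (intro linear_conv_bounded_linear[THEN iffD1] linearI) (simp_all add: vec_eq_iff)
    have eq: "(\<lambda>y. indicator S y *\<^sub>R (vec (h y) :: real^1)) = (\<lambda>y. vec (indicator S y * h y))"
      by (auto simp: vec_eq_iff)
    show ?thesis
      unfolding set_integrable_def set_lebesgue_integral_def eq
      using integrable_bounded_linear[OF blv i] integral_bounded_linear[OF blv i] that
      by (simp add: integral_completion)
  qed
  have FI: "F absolutely_integrable_on \<Psi> ` T ` \<Omega>"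
    "(LINT y:\<Psi> ` T ` \<Omega>|lebesgue. F y) $ 1 = (\<integral>y. indicator (T ` \<Phi> ` \<Omega>) y * f (U y) \<partial>lborel)"
    unfolding F_def img using vec_int[OF _ 1(1)] sub by auto
  have "(\<lambda>y. \<bar>det (matrix (\<Psi>' y))\<bar> *\<^sub>R F (\<Psi> y)) absolutely_integrable_on T ` \<Omega> \<and>
        integral (T ` \<Omega>) (\<lambda>y. \<bar>det (matrix (\<Psi>' y))\<bar> *\<^sub>R F (\<Psi> y)) = integral (\<Psi> ` T ` \<Omega>) F"
    by (subst has_absolute_integral_change_of_variables[OF _ der inj'])
       (use FI T_open[OF \<Omega>] in auto)
  moreover have F\<Psi>: "\<bar>det (matrix (\<Psi>' y))\<bar> *\<^sub>R F (\<Psi> y) = vec (\<bar>det (jacobian \<Phi> (U y))\<bar> * f (\<Phi> (U y)))" for y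
    by (simp add: det F_def \<Psi>_def UT vec_eq_iff)
  ultimately have ai: "(\<lambda>y. vec (\<bar>det (jacobian \<Phi> (U y))\<bar> * f (\<Phi> (U y))) :: real^1) absolutely_integrable_on T ` \<Omega>"
    and eq: "(LINT y:T ` \<Omega>|lebesgue. vec (\<bar>det (jacobian \<Phi> (U y))\<bar> * f (\<Phi> (U y))) :: real^1)
        = (LINT y:\<Psi> ` T ` \<Omega>|lebesgue. F y)"
    using FI(1) by (simp_all add: set_lebesgue_integral_eq_integral)
  have "integrable lborel (\<lambda>y. indicator (T ` \<Omega>) y * (\<bar>det (jacobian \<Phi> (U y))\<bar> * f (\<Phi> (U y))))"
  proof -
    have "integrable lebesgue (\<lambda>y. (indicator (T ` \<Omega>) y *\<^sub>R
        (vec (\<bar>det (jacobian \<Phi> (U y))\<bar> * f (\<Phi> (U y))) :: real^1)) $ 1)"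
      using integrable_bounded_linear[OF bounded_linear_vec_nth ai[unfolded set_integrable_def]] .
    then show ?thesis using meas by (simp add: integrable_completion)
  qed
  from vec_int[OF meas this] eq FI(2) 1(2) 2 show ?thesis by simp
qed

section \<open>Change of variables for Lipschitz perturbations of the identity\<close>

text \<open>For \<open>0 \<le> L < 1\<close> this single convex condition yields a bi-Lipschitz
  injection and, in Euclidean space, positive Jacobian determinants and local solvability; unlike
  injectivity it survives averaging.\<close>

definition near_identity_on :: "real \<Rightarrow> 'a::real_normed_vector set \<Rightarrow> ('a \<Rightarrow> 'a) \<Rightarrow> bool" where
  "near_identity_on L S f \<longleftrightarrow> (\<forall>x\<in>S. \<forall>y\<in>S. norm ((f x - f y) - (x - y)) \<le> L * norm (x - y))"

lemma near_identity_bounds: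
  assumes "near_identity_on L S f" "x \<in> S" "y \<in> S"
  shows "(1 - L) * norm (x - y) \<le> norm (f x - f y)" "norm (f x - f y) \<le> (1 + L) * norm (x - y)"
proof -
  have *: "norm ((f x - f y) - (x - y)) \<le> L * norm (x - y)"
    using assms by (auto simp: near_identity_on_def)
  show "(1 - L) * norm (x - y) \<le> norm (f x - f y)"
    using * norm_triangle_ineq2[of "x - y" "f x - f y"] by (simp add: norm_minus_commute left_diff_distrib)
  show "norm (f x - f y) \<le> (1 + L) * norm (x - y)"
    using * norm_triangle_ineq[of "(f x - f y) - (x - y)" "x - y"] by (simp add: distrib_right)
qed

lemma near_identity_inj: "near_identity_on L S f \<Longrightarrow> L < 1 \<Longrightarrow> inj_on f S"
proof (rule inj_onI)
  fix x y assume f: "near_identity_on L S f" "L < 1" and xy: "x \<in> S" "y \<in> S" "f x = f y"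
  have "(1 - L) * norm (x - y) \<le> 0"
    using near_identity_bounds(1)[OF f(1) xy(1,2)] xy(3) by simp
  then show "x = y" using f(2) by (simp add: mult_le_0_iff)
qed

lemma near_identity_continuous:
  assumes "near_identity_on L S f" "0 \<le> L"
  shows "continuous_on S f"
proof -
  have "(1 + L)-lipschitz_on S f"
    using near_identity_bounds(2)[OF assms(1)] assms(2) by (intro lipschitz_onI) (simp_all add: dist_norm)
  then show ?thesis by (rule lipschitz_on_continuous_on)
qed

lemma near_identity_inverse_lipschitz:
  assumes f: "near_identity_on L S f" "L < 1" and g: "\<And>x. x \<in> S \<Longrightarrow> g (f x) = x"
  shows "(1 / (1 - L))-lipschitz_on (f ` S) g"
proof (rule lipschitz_onI)
  fix y z assume "y \<in> f ` S" "z \<in> f ` S"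
  then show "dist (g y) (g z) \<le> 1 / (1 - L) * dist y z"
    using near_identity_bounds(1)[OF f(1)] f(2) g by (auto simp: dist_norm field_simps)
qed (use f(2) in simp)

lemma near_identity_open_image:
  fixes f :: "'a::euclidean_space \<Rightarrow> 'a"
  assumes "near_identity_on L S f" "0 \<le> L" "L < 1" "open S"
  shows "open (f ` S)"
  by (rule invariance_of_domain[OF near_identity_continuous[OF assms(1,2)] assms(4)
      near_identity_inj[OF assms(1,3)]])

text \<open>Solving \<open>f x = y\<close> means finding a fixed point of
  \<open>T x = x + y - f x\<close>, which contracts with factor \<open>L\<close>. A residual of at
  most \<open>(1 - L) * r\<close> at the centre makes the ball invariant. The explicit radius is
  needed to solve for all late approximants at once.\<close>

lemma near_identity_solve:
  fixes f :: "'a::euclidean_space \<Rightarrow> 'a"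
  assumes f: "near_identity_on L S f" "0 \<le> L" "L < 1" and S: "cball x0 r \<subseteq> S" "0 \<le> r"
    and y: "norm (f x0 - y) \<le> (1 - L) * r"
  shows "y \<in> f ` S"
proof -
  define T where "T x = x + y - f x" for x
  have lip: "norm (T a - T b) \<le> L * norm (a - b)" if "a \<in> S" "b \<in> S" for a b
  proof -
    have "T a - T b = - ((f a - f b) - (a - b))" by (simp add: T_def)
    then show ?thesis using f(1) that by (auto simp: near_identity_on_def simp del: minus_diff_eq)
  qed
  have x0: "x0 \<in> S" using S by auto
  have "\<exists>!x\<in>cball x0 r. T x = x"
  proof (rule Banach_fix[OF _ _ f(2,3)])
    show "complete (cball x0 r)" by (simp add: complete_eq_closed)
    show "cball x0 r \<noteq> {}" using S by simp
    show "T ` cball x0 r \<subseteq> cball x0 r"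
    proof
      fix z assume "z \<in> T ` cball x0 r"
      then obtain x where x: "x \<in> cball x0 r" "z = T x" by auto
      have "norm (T x - x0) \<le> norm (T x - T x0) + norm (T x0 - x0)"
        by (rule norm_triangle_ineq[of "T x - T x0" "T x0 - x0", simplified])
      also have "norm (T x - T x0) \<le> L * r"
        using lip[of x x0] x S x0 mult_left_mono[OF _ f(2), of "norm (x - x0)" r]
        by (auto simp: dist_norm norm_minus_commute)
      also have "norm (T x0 - x0) \<le> (1 - L) * r"
        using y by (simp add: T_def norm_minus_commute)
      finally show "z \<in> cball x0 r"
        using x by (simp add: dist_norm norm_minus_commute algebra_simps)
    qed
    show "dist (T a) (T b) \<le> L * dist a b" if "a \<in> cball x0 r" "b \<in> cball x0 r" for a b
      using lip[OF subsetD[OF S(1) that(1)] subsetD[OF S(1) that(2)]] by (simp add: dist_norm)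
  qed
  then obtain x where "x \<in> cball x0 r" "T x = x" by blast
  then show ?thesis using S by (intro image_eqI[of _ _ x]) (auto simp: T_def)
qed

lemma near_identity_derivative:
  fixes f :: "'a::real_normed_vector \<Rightarrow> 'a"
  assumes f: "near_identity_on L S f" and S: "open S" "x \<in> S" and D: "(f has_derivative D) (at x)"
  shows "norm (D h - h) \<le> L * norm h"
proof (rule field_le_epsilon)
  fix e :: real assume e: "e > 0"
  define c where "c = norm h + 1"
  have c: "c > 0" "norm h \<le> c" by (simp_all add: c_def add_nonneg_pos)
  define e' where "e' = e / c"
  have e': "e' > 0" using e c by (simp add: e'_def)
  obtain d1 where d1: "d1 > 0" "\<And>y. norm (y - x) < d1 \<Longrightarrow> norm (f y - f x - D (y - x)) \<le> e' * norm (y - x)"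
    using D e' unfolding has_derivative_at_alt by blast
  obtain d2 where d2: "d2 > 0" "ball x d2 \<subseteq> S" using S openE by blast
  \<comment> \<open>The vector \<open>t *\<^sub>R h\<close> must stay inside both radii;
    \<open>c = norm h + 1\<close> instead of \<open>norm h\<close> keeps the quotient defined for
    \<open>h = 0\<close>.\<close>
  define t where "t = min d1 d2 / (2 * c)"
  have t: "t > 0" using d1 d2 c by (simp add: t_def)
  have th: "norm (t *\<^sub>R h) < min d1 d2"
  proof -
    have "norm (t *\<^sub>R h) \<le> t * c" using t c by simp
    also have "t * c = min d1 d2 / 2" using c by (simp add: t_def)
    also have "\<dots> < min d1 d2" using d1(1) d2(1) by (simp add: min_def)
    finally show ?thesis .
  qed
  have in_S: "x + t *\<^sub>R h \<in> S" using d2 th by (auto simp: dist_norm subset_eq)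
  interpret D: bounded_linear D using D by (rule has_derivative_bounded_linear)
  have "norm (t *\<^sub>R (D h - h)) \<le> norm (f (x + t *\<^sub>R h) - f x - t *\<^sub>R h)
      + norm (f (x + t *\<^sub>R h) - f x - D (t *\<^sub>R h))"
    using norm_triangle_ineq4[of "f (x + t *\<^sub>R h) - f x - t *\<^sub>R h" "f (x + t *\<^sub>R h) - f x - D (t *\<^sub>R h)"]
    by (simp add: D.scaleR scaleR_diff_right)
  also have "norm (f (x + t *\<^sub>R h) - f x - t *\<^sub>R h) \<le> L * norm (t *\<^sub>R h)"
    using f in_S S(2) by (fastforce simp: near_identity_on_def)
  also have "norm (f (x + t *\<^sub>R h) - f x - D (t *\<^sub>R h)) \<le> e' * norm (t *\<^sub>R h)"
    using d1(2)[of "x + t *\<^sub>R h"] th by simp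
  finally have "t * norm (D h - h) \<le> t * (L * norm h + e' * norm h)"
    unfolding norm_scaleR using t by (simp add: distrib_left mult.left_commute)
  then have "norm (D h - h) \<le> L * norm h + e' * norm h"
    using t by simp
  also have "e' * norm h \<le> e"
    using e c by (simp add: e'_def field_simps)
  finally show "norm (D h - h) \<le> L * norm h + e" by simp
qed

text \<open>A column is the image of a unit vector and has norm at most \<open>1 + L < 2\<close>.
  The bound is free of \<open>L\<close> and of the matrix, so one constant dominates all
  Jacobians.\<close>

lemma matrix_entry_bound:
  fixes M :: "real^'n^'n::finite"
  assumes "\<And>h. norm (M *v h - h) \<le> L * norm h" and "L < 1"
  shows "\<bar>M $ i $ j\<bar> \<le> 2"
proof -
  have "\<bar>M $ i $ j\<bar> = \<bar>(M *v axis j 1) $ i\<bar>" by (simp add: matrix_vector_mult_basis column_def)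
  also have "\<dots> \<le> norm (M *v axis j 1)" by (rule component_le_norm_cart)
  also have "\<dots> \<le> norm (M *v axis j 1 - axis j 1) + norm (axis j 1 :: real^'n)"
    by (metis diff_add_cancel norm_triangle_ineq)
  also have "\<dots> \<le> 2" using assms(1)[of "axis j 1"] assms(2) by (simp add: norm_axis_1)
  finally show ?thesis .
qed

lemma det_bound:
  fixes M :: "real^'n^'n::finite"
  assumes "\<And>i j. \<bar>M $ i $ j\<bar> \<le> B"
  shows "\<bar>det M\<bar> \<le> (\<Sum>p | p permutes (UNIV :: 'n set). B ^ CARD('n))"
  unfolding det_def
proof (intro order.trans[OF sum_abs] sum_mono)
  fix p :: "'n \<Rightarrow> 'n"
  have "\<bar>of_int (sign p) * (\<Prod>i\<in>UNIV. M $ i $ p i)\<bar> = (\<Prod>i\<in>UNIV. \<bar>M $ i $ p i\<bar>)"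
    by (simp add: abs_mult abs_prod sign_def)
  also have "\<dots> \<le> (\<Prod>i\<in>(UNIV :: 'n set). B)" by (intro prod_mono) (auto intro: assms)
  finally show "\<bar>of_int (sign p) * (\<Prod>i\<in>UNIV. M $ i $ p i)\<bar> \<le> B ^ CARD('n)" by simp
qed

lemma tendsto_det:
  fixes N :: "'a \<Rightarrow> real^'n^'n::finite"
  assumes "\<And>i j. ((\<lambda>k. N k $ i $ j) \<longlongrightarrow> M $ i $ j) F"
  shows "((\<lambda>k. det (N k)) \<longlongrightarrow> det M) F"
  unfolding det_def by (intro tendsto_intros assms)

lemma negligible_lipschitz_image:
  fixes f :: "'a::euclidean_space \<Rightarrow> 'a"
  assumes "negligible N" "N \<subseteq> S" "C-lipschitz_on S f"
  shows "negligible (f ` N)"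
proof (rule negligible_locally_Lipschitz_image[OF order.refl assms(1)])
  fix x assume "x \<in> N"
  then show "\<exists>T B. open T \<and> x \<in> T \<and> (\<forall>y\<in>N \<inter> T. norm (f y - f x) \<le> B * norm (y - x))"
    using assms(2) lipschitz_onD[OF assms(3)]
    by (intro exI[of _ UNIV] exI[of _ C]) (auto simp: dist_norm)
qed

text \<open>Lipschitz maps send null sets to null sets, so the exceptional set of \<open>P\<close>
  has a null image.\<close>

lemma AE_lipschitz_image:
  fixes f g :: "'a::euclidean_space \<Rightarrow> 'a"
  assumes P: "AE x\<in>S in lebesgue. P x" and f: "C-lipschitz_on S f" and g: "\<And>x. x \<in> S \<Longrightarrow> g (f x) = x"
  shows "AE y\<in>f ` S in lebesgue. P (g y)"
proof -
  have "negligible {x \<in> S. \<not> P x}"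
    using P by (simp add: negligible_iff_null_sets completion.AE_iff_null_sets)
  then have "negligible (f ` {x \<in> S. \<not> P x})"
    by (rule negligible_lipschitz_image[OF _ _ f]) auto
  then have "AE y in lebesgue. y \<notin> f ` {x \<in> S. \<not> P x}"
    by (simp add: negligible_iff_null_sets AE_not_in)
  then show ?thesis by eventually_elim (use g in auto)
qed

text \<open>Everything about the Jacobian of \<phi> is encoded in \<open>J\<close>, an almost
  everywhere limit of smooth Jacobians; \<phi> itself is never differentiated. The same
  \<open>L\<close> for \<phi> and all \<open>\<Phi> k\<close> makes the estimates uniform in
  \<open>k\<close>.\<close>

locale smoothly_approximated =
  fixes \<Omega> :: "(real^'n::finite) set" and \<phi> :: "real^'n \<Rightarrow> real^'n" and L :: real
    and J :: "real^'n \<Rightarrow> real^'n^'n" and \<Phi> :: "nat \<Rightarrow> real^'n \<Rightarrow> real^'n" and \<delta> :: "nat \<Rightarrow> real"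
  assumes open_\<Omega>: "open \<Omega>" and bounded_\<Omega>: "bounded \<Omega>" and L: "0 \<le> L" "L < 1"
    and near_\<phi>: "near_identity_on L \<Omega> \<phi>"
    and smooth_\<Phi>: "\<And>k m j. Ck m (\<lambda>x. \<Phi> k x $ j)"
    and near_\<Phi>: "\<And>k. near_identity_on L \<Omega> (\<Phi> k)"
    and dist_\<Phi>: "\<And>k x. x \<in> \<Omega> \<Longrightarrow> norm (\<Phi> k x - \<phi> x) \<le> \<delta> k"
    and \<delta>: "\<delta> \<longlonglongrightarrow> 0"
    and jacobian_lim: "AE x\<in>\<Omega> in lebesgue. \<forall>i j. (\<lambda>k. jacobian (\<Phi> k) x $ j $ i) \<longlonglongrightarrow> J x $ j $ i"
begin

definition \<psi> :: "real^'n \<Rightarrow> real^'n" where "\<psi> = inv_into \<Omega> \<phi>"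

lemma inj_\<phi>: "inj_on \<phi> \<Omega>" using near_identity_inj[OF near_\<phi> L(2)] .

lemma \<psi>_\<phi>: "x \<in> \<Omega> \<Longrightarrow> \<psi> (\<phi> x) = x"
  by (simp add: \<psi>_def inj_\<phi>)

lemma \<phi>_\<psi>: "y \<in> \<phi> ` \<Omega> \<Longrightarrow> \<phi> (\<psi> y) = y" "y \<in> \<phi> ` \<Omega> \<Longrightarrow> \<psi> y \<in> \<Omega>"
  by (auto simp: \<psi>_\<phi>)

lemma continuous_\<phi>: "continuous_on \<Omega> \<phi>"
  using near_identity_continuous[OF near_\<phi> L(1)] .

lemma lipschitz_\<phi>: "(1 + L)-lipschitz_on \<Omega> \<phi>"
  using near_identity_bounds(2)[OF near_\<phi>] L by (intro lipschitz_onI) (simp_all add: dist_norm)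

lemma lipschitz_\<psi>: "(1 / (1 - L))-lipschitz_on (\<phi> ` \<Omega>) \<psi>"
  using near_identity_inverse_lipschitz[OF near_\<phi> L(2) \<psi>_\<phi>] .

lemma open_image: "open (\<phi> ` \<Omega>)"
  using near_identity_open_image[OF near_\<phi> L open_\<Omega>] .

lemma bounded_image: "bounded (\<phi> ` \<Omega>)"
proof (cases "\<Omega> = {}")
  case False
  then obtain a where a: "a \<in> \<Omega>" by blast
  obtain B where B: "\<And>x. x \<in> \<Omega> \<Longrightarrow> norm x \<le> B" using bounded_\<Omega> by (auto simp: bounded_iff)
  have "norm (\<phi> x) \<le> norm (\<phi> a) + (1 + L) * (B + B)" if "x \<in> \<Omega>" for x
  proof -
    have "norm (\<phi> x) \<le> norm (\<phi> a) + norm (\<phi> x - \<phi> a)" using norm_triangle_sub by blast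
    also have "norm (\<phi> x - \<phi> a) \<le> (1 + L) * norm (x - a)"
      using near_identity_bounds(2)[OF near_\<phi> that a] .
    also have "\<dots> \<le> (1 + L) * (B + B)"
      using B[OF that] B[OF a] norm_triangle_ineq4[of x a] L by (intro mult_left_mono) auto
    finally show ?thesis by simp
  qed
  then show ?thesis by (auto simp: bounded_iff)
qed simp

lemma compact_preimage:
  assumes "compact K" "K \<subseteq> \<phi> ` \<Omega>"
  shows "compact {x \<in> \<Omega>. \<phi> x \<in> K}"
proof -
  have "{x \<in> \<Omega>. \<phi> x \<in> K} = \<psi> ` K" 
  proof (intro set_eqI iffI)
    fix x assume "x \<in> {x \<in> \<Omega>. \<phi> x \<in> K}"
    then show "x \<in> \<psi> ` K" by (intro image_eqI[of _ _ "\<phi> x"]) (auto simp: \<psi>_\<phi>)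
  next
    fix x assume "x \<in> \<psi> ` K"
    then show "x \<in> {x \<in> \<Omega>. \<phi> x \<in> K}" using assms(2) \<phi>_\<psi> by auto
  qed
  moreover have "continuous_on K \<psi>"
    using lipschitz_on_continuous_on[OF lipschitz_\<psi>] assms(2) continuous_on_subset by blast
  ultimately show ?thesis using compact_continuous_image assms(1) by simp
qed

text \<open>A point sent into \<open>K\<close> by a late \<open>\<Phi> k\<close> is sent by \<phi>
  into the compact neighbourhood \<open>K1\<close>, whose preimage is \<open>K'\<close>. Hence one
  compact subset of \<Omega> carries all pulled-back integrands with support in \<open>K\<close>,
  and the limit can be taken on a fixed set.\<close>

lemma approximation_eventually:
  assumes K: "compact K" "K \<subseteq> \<phi> ` \<Omega>"
  shows "\<exists>K'. compact K' \<and> K' \<subseteq> \<Omega> \<and> (\<forall>x\<in>\<Omega>. \<phi> x \<in> K \<longrightarrow> x \<in> K') \<and>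
    (\<forall>\<^sub>F k in sequentially. K \<subseteq> \<Phi> k ` \<Omega> \<and> (\<forall>x\<in>\<Omega>. \<Phi> k x \<in> K \<longrightarrow> x \<in> K'))"
proof -
  obtain r K1 where r: "r > 0" "compact K1" "K1 \<subseteq> \<phi> ` \<Omega>" "\<And>y. y \<in> K \<Longrightarrow> cball y r \<subseteq> K1"
    using compact_neighbourhood[OF K(1) open_image K(2)] by blast
  define K' where "K' = {x \<in> \<Omega>. \<phi> x \<in> K1}"
  have K': "compact K'" "K' \<subseteq> \<Omega>" using compact_preimage r by (auto simp: K'_def)
  have sub: "{x \<in> \<Omega>. \<phi> x \<in> K} \<subseteq> \<Omega>" by auto
  obtain s where s: "s > 0" "\<And>x. x \<in> \<Omega> \<Longrightarrow> \<phi> x \<in> K \<Longrightarrow> cball x s \<subseteq> \<Omega>"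
  proof -
    obtain s where "s > 0" "(\<Union>x\<in>{x \<in> \<Omega>. \<phi> x \<in> K}. cball x s) \<subseteq> \<Omega>"
      using compact_subset_open_imp_cball_epsilon_subset[OF compact_preimage[OF K] open_\<Omega> sub] by blast
    then show thesis by (intro that) blast+
  qed
  \<comment> \<open>The radius \<open>r\<close> confines the preimages to \<open>K'\<close>;
    \<open>(1 - L) * s\<close> is the residual for which \<open>\<Phi> k x = y\<close> is solvable
    in the ball of radius \<open>s\<close> around the \<phi>-preimage of \<open>y\<close>.\<close>
  have "\<forall>\<^sub>F k in sequentially. \<delta> k < min r ((1 - L) * s)"
    using \<delta> r(1) s(1) L by (intro order_tendstoD) auto
  then have "\<forall>\<^sub>F k in sequentially. K \<subseteq> \<Phi> k ` \<Omega> \<and> (\<forall>x\<in>\<Omega>. \<Phi> k x \<in> K \<longrightarrow> x \<in> K')"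
  proof eventually_elim
    case (elim k)
    have "K \<subseteq> \<Phi> k ` \<Omega>"
    proof
      fix y assume y: "y \<in> K"
      then obtain x where x: "x \<in> \<Omega>" "y = \<phi> x" using K by blast
      show "y \<in> \<Phi> k ` \<Omega>"
        using dist_\<Phi>[OF x(1), of k] elim x y s
        by (intro near_identity_solve[OF near_\<Phi> L, of x s]) auto
    qed
    moreover have "x \<in> K'" if "x \<in> \<Omega>" "\<Phi> k x \<in> K" for x
    proof -
      have "\<phi> x \<in> cball (\<Phi> k x) r" using dist_\<Phi>[OF that(1), of k] elim by (simp add: dist_norm)
      then show ?thesis using r(4)[OF that(2)] that(1) by (auto simp: K'_def)
    qed
    ultimately show ?case by blast
  qed
  moreover have "x \<in> K'" if "x \<in> \<Omega>" "\<phi> x \<in> K" for x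
  proof -
    have "\<phi> x \<in> cball (\<phi> x) r" using r(1) by simp
    then show ?thesis using r(4)[OF that(2)] that by (auto simp: K'_def)
  qed
  ultimately show ?thesis using K' by blast
qed

lemma \<Phi>_tendsto: "x \<in> \<Omega> \<Longrightarrow> (\<lambda>k. \<Phi> k x) \<longlonglongrightarrow> \<phi> x"
  by (rule LIM_zero_cancel, rule Lim_null_comparison[OF always_eventually \<delta>])
     (simp add: dist_\<Phi>)

lemma jacobian_\<Phi>_near: "x \<in> \<Omega> \<Longrightarrow> norm (jacobian (\<Phi> k) x *v h - h) \<le> L * norm h"
  by (rule near_identity_derivative[OF near_\<Phi> open_\<Omega> _ jacobian_has_derivative[OF smooth_\<Phi>]])

lemma J_near: "AE x\<in>\<Omega> in lebesgue. \<forall>h. norm (J x *v h - h) \<le> L * norm h"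
  using jacobian_lim
proof eventually_elim
  case (elim x)
  show ?case
  proof (intro impI allI)
    fix h assume x: "x \<in> \<Omega>"
    have "(\<lambda>k. jacobian (\<Phi> k) x *v h) \<longlonglongrightarrow> J x *v h"
    proof (rule vec_tendstoI)
      fix j show "(\<lambda>k. (jacobian (\<Phi> k) x *v h) $ j) \<longlonglongrightarrow> (J x *v h) $ j"
        unfolding matrix_vector_mult_def vec_lambda_beta
        by (intro tendsto_sum tendsto_mult tendsto_const) (use elim x in auto)
    qed
    then have "(\<lambda>k. norm (jacobian (\<Phi> k) x *v h - h)) \<longlonglongrightarrow> norm (J x *v h - h)"
      by (intro tendsto_intros)
    then show "norm (J x *v h - h) \<le> L * norm h"
      using jacobian_\<Phi>_near[OF x] by (intro LIMSEQ_le_const2) auto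
  qed
qed

lemma det_J_pos: "AE x\<in>\<Omega> in lebesgue. det (J x) > 0"
  using J_near by eventually_elim (use det_pos_near_identity[OF L(2)] in blast)

lemma det_jacobian_\<Phi>_pos: "x \<in> \<Omega> \<Longrightarrow> det (jacobian (\<Phi> k) x) > 0"
  using det_pos_near_identity[OF L(2) jacobian_\<Phi>_near] .

lemma J_measurable: "(\<lambda>x. indicator \<Omega> x * J x $ j $ i) \<in> borel_measurable lebesgue"
proof (rule borel_measurable_AE)
  have "(\<lambda>x. indicator \<Omega> x * jacobian (\<Phi> k) x $ j $ i) \<in> borel_measurable lebesgue" for k
    using continuous_imp_lebesgue_measurable[OF Ck_continuous[OF Ck_jacobian[OF smooth_\<Phi>]]] open_\<Omega>
    by (intro borel_measurable_times borel_measurable_indicator) auto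
  then show "(\<lambda>x. lim (\<lambda>k. indicator \<Omega> x * jacobian (\<Phi> k) x $ j $ i)) \<in> borel_measurable lebesgue"
    by (rule borel_measurable_lim_metric)
  show "AE x in lebesgue. lim (\<lambda>k. indicator \<Omega> x * jacobian (\<Phi> k) x $ j $ i) = indicator \<Omega> x * J x $ j $ i"
    using jacobian_lim
  proof eventually_elim
    case (elim x)
    have "(\<lambda>k. indicator \<Omega> x * jacobian (\<Phi> k) x $ j $ i) \<longlonglongrightarrow> indicator \<Omega> x * J x $ j $ i"
      using elim by (cases "x \<in> \<Omega>") (auto intro: tendsto_mult)
    then show ?case by (rule limI)
  qed
qed

lemma det_J_measurable: "(\<lambda>x. indicator \<Omega> x * det (J x)) \<in> borel_measurable lebesgue"
proof -
  have "(\<lambda>x. indicator \<Omega> x * det (J x)) = (\<lambda>x. det (\<chi> j i. indicator \<Omega> x * J x $ j $ i) * indicator \<Omega> x)"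
    by (auto simp: indicator_def)
  moreover have "(\<lambda>x. det (\<chi> j i. indicator \<Omega> x * J x $ j $ i)) \<in> borel_measurable lebesgue"
    unfolding det_def using J_measurable by simp
  ultimately show ?thesis using open_\<Omega> by (auto intro!: borel_measurable_times borel_measurable_indicator)
qed

text \<open>Continuity of \<open>f\<close> lets \<open>f (\<Phi> k x)\<close> converge pointwise,
  the determinants converge almost everywhere, and all integrands are bounded by the constant
  \<open>C * B\<close> on the bounded domain.\<close>

lemma change_of_variables_continuous:
  fixes f :: "real^'n \<Rightarrow> real"
  assumes f: "continuous_on UNIV f" and K: "compact K" "K \<subseteq> \<phi> ` \<Omega>" and supp: "\<And>y. f y \<noteq> 0 \<Longrightarrow> y \<in> K"
  shows "set_integrable lebesgue \<Omega> (\<lambda>x. det (J x) * f (\<phi> x))"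
    and "(LINT x:\<Omega>|lebesgue. det (J x) * f (\<phi> x)) = (\<integral>y. f y \<partial>lborel)"
proof -
  obtain K' where K': "compact K'" "K' \<subseteq> \<Omega>" "\<forall>x\<in>\<Omega>. \<phi> x \<in> K \<longrightarrow> x \<in> K'"
    "\<forall>\<^sub>F k in sequentially. K \<subseteq> \<Phi> k ` \<Omega> \<and> (\<forall>x\<in>\<Omega>. \<Phi> k x \<in> K \<longrightarrow> x \<in> K')"
    using approximation_eventually[OF K] by (elim exE conjE)
  have fm: "f \<in> borel_measurable borel" using f by (rule borel_measurable_continuous_onI)
  have fi: "integrable lborel f"
    using integrable_continuous_compact_support[OF f K(1)] supp by blast
  have "bounded (f ` K)"
    using K f by (intro compact_imp_bounded compact_continuous_image) (auto intro: continuous_on_subset)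
  then obtain B where "B > 0" "\<And>y. y \<in> K \<Longrightarrow> \<bar>f y\<bar> \<le> B" by (auto simp: bounded_pos)
  then have B: "\<bar>f y\<bar> \<le> B" for y using supp[of y] by (cases "f y = 0") auto
  define C where "C = (\<Sum>p | p permutes (UNIV :: 'n set). (2::real) ^ CARD('n))"
  define F where "F k x = indicator \<Omega> x * (det (jacobian (\<Phi> k) x) * f (\<Phi> k x))" for k x
  define F0 where "F0 x = indicator \<Omega> x * (det (J x) * f (\<phi> x))" for x
  have F_meas: "F k \<in> borel_measurable borel" for k
  proof -
    have "continuous_on UNIV (\<lambda>x. det (jacobian (\<Phi> k) x))"
      using Ck_continuous[OF Ck_det[OF Ck_jacobian[OF smooth_\<Phi>]]] .
    moreover have "continuous_on UNIV (\<Phi> k)"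
      using has_derivative_continuous[OF jacobian_has_derivative[OF smooth_\<Phi>]]
      by (simp add: continuous_at_imp_continuous_on)
    ultimately have "continuous_on UNIV (\<lambda>x. det (jacobian (\<Phi> k) x) * f (\<Phi> k x))"
      using f by (auto intro!: continuous_on_mult continuous_on_compose2[of UNIV f])
    then show ?thesis
      unfolding F_def using open_\<Omega>
      by (intro borel_measurable_times[OF borel_measurable_indicator] borel_measurable_continuous_onI) auto
  qed
  have F0_meas: "F0 \<in> borel_measurable lebesgue"
  proof -
    have "(\<lambda>x. indicator \<Omega> x *\<^sub>R f (\<phi> x)) \<in> borel_measurable borel"
      using open_\<Omega> continuous_\<phi> f
      by (intro borel_measurable_continuous_on_indicator) (auto intro: continuous_on_compose2)
    then have "(\<lambda>x. indicator \<Omega> x *\<^sub>R f (\<phi> x)) \<in> borel_measurable lebesgue"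
      by (intro measurable_completion) simp
    from borel_measurable_times[OF det_J_measurable this]
    show ?thesis by (rule subst[of _ _ "\<lambda>f. f \<in> borel_measurable lebesgue", rotated])
      (auto simp: F0_def indicator_def)
  qed
  have dom: "norm (F k x) \<le> indicator \<Omega> x * (C * B)" for k x
  proof (cases "x \<in> \<Omega>")
    case True
    have "\<bar>det (jacobian (\<Phi> k) x)\<bar> \<le> C"
      unfolding C_def by (intro det_bound matrix_entry_bound[OF jacobian_\<Phi>_near[OF True] L(2)])
    then show ?thesis using True B[of "\<Phi> k x"] by (auto simp: F_def abs_mult intro!: mult_mono)
  qed (simp add: F_def)
  have \<Omega>i: "integrable lebesgue (\<lambda>x. indicator \<Omega> x * (C * B))"
  proof -
    have "emeasure lborel \<Omega> < \<infinity>" using bounded_\<Omega> by (rule emeasure_bounded_finite)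
    then show ?thesis using open_\<Omega> by (intro integrable_mult_left) simp
  qed
  have lim: "AE x in lebesgue. (\<lambda>k. F k x) \<longlonglongrightarrow> F0 x"
    using jacobian_lim
  proof eventually_elim
    case (elim x)
    show ?case
    proof (cases "x \<in> \<Omega>")
      case True
      have "(\<lambda>k. f (\<Phi> k x)) \<longlonglongrightarrow> f (\<phi> x)"
        using continuous_on_tendsto_compose[OF f \<Phi>_tendsto[OF True]] by simp
      moreover have "(\<lambda>k. det (jacobian (\<Phi> k) x)) \<longlonglongrightarrow> det (J x)"
        using elim True by (intro tendsto_det) auto
      ultimately show ?thesis unfolding F_def F0_def by (intro tendsto_mult tendsto_const)
    qed (simp add: F_def F0_def)
  qed
  have Fm: "F k \<in> borel_measurable lebesgue" for k using F_meas by (intro measurable_completion) simp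
  have int: "integrable lebesgue F0"
    by (rule integrable_dominated_convergence[OF F0_meas Fm \<Omega>i lim AE_I2[OF dom]])
  have conv: "(\<lambda>k. integral\<^sup>L lebesgue (F k)) \<longlonglongrightarrow> integral\<^sup>L lebesgue F0"
    by (rule integral_dominated_convergence[OF F0_meas Fm \<Omega>i lim AE_I2[OF dom]])
  have "\<forall>\<^sub>F k in sequentially. integral\<^sup>L lebesgue (F k) = (\<integral>y. f y \<partial>lborel)"
    using K'(4)
  proof eventually_elim
    case (elim k)
    have eq: "(\<lambda>y. indicator (\<Phi> k ` \<Omega>) y * f y) = f"
    proof
      fix y show "indicator (\<Phi> k ` \<Omega>) y * f y = f y"
        using elim supp[of y] by (cases "f y = 0") auto
    qed
    have "(\<integral>y. f y \<partial>lborel) = (\<integral>x. indicator \<Omega> x * (\<bar>det (jacobian (\<Phi> k) x)\<bar> * f (\<Phi> k x)) \<partial>lborel)"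
      using smooth_change_of_variables[OF open_\<Omega> smooth_\<Phi> near_identity_inj[OF near_\<Phi> L(2)] fm, of k] fi
      by (simp add: eq)
    also have "(\<lambda>x. indicator \<Omega> x * (\<bar>det (jacobian (\<Phi> k) x)\<bar> * f (\<Phi> k x))) = F k"
    proof
      fix x show "indicator \<Omega> x * (\<bar>det (jacobian (\<Phi> k) x)\<bar> * f (\<Phi> k x)) = F k x"
        using det_jacobian_\<Phi>_pos[of x k] by (cases "x \<in> \<Omega>") (auto simp: F_def)
    qed
    also have "integral\<^sup>L lborel (F k) = integral\<^sup>L lebesgue (F k)"
      using F_meas by (simp add: integral_completion)
    finally show ?case by simp
  qed
  then have "(\<lambda>k. integral\<^sup>L lebesgue (F k)) \<longlonglongrightarrow> (\<integral>y. f y \<partial>lborel)"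
    by (rule tendsto_eventually)
  with conv have "integral\<^sup>L lebesgue F0 = (\<integral>y. f y \<partial>lborel)" by (rule LIMSEQ_unique)
  with int show "set_integrable lebesgue \<Omega> (\<lambda>x. det (J x) * f (\<phi> x))"
    and "(LINT x:\<Omega>|lebesgue. det (J x) * f (\<phi> x)) = (\<integral>y. f y \<partial>lborel)"
    by (simp_all add: set_integrable_def set_lebesgue_integral_def F0_def[abs_def])
qed

end

context smoothly_approximated
begin

section \<open>From continuous integrands to image measures and arbitrary integrands\<close>

lemma det_J_bounded:
  "\<exists>C. AE x\<in>\<Omega> in lebesgue. \<bar>det (J x)\<bar> \<le> C"
proof
  show "AE x\<in>\<Omega> in lebesgue. \<bar>det (J x)\<bar> \<le> (\<Sum>p | p permutes (UNIV :: 'n set). (2::real) ^ CARD('n))"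
    using J_near
  proof eventually_elim
    case (elim x)
    show ?case
    proof
      assume "x \<in> \<Omega>"
      then have "norm (J x *v h - h) \<le> L * norm h" for h using elim by blast
      then show "\<bar>det (J x)\<bar> \<le> (\<Sum>p | p permutes (UNIV :: 'n set). (2::real) ^ CARD('n))"
        by (intro det_bound matrix_entry_bound[OF _ L(2)])
    qed
  qed
qed

lemma emeasure_\<Omega>_finite: "emeasure lebesgue \<Omega> < \<infinity>"
  using emeasure_bounded_finite[OF bounded_\<Omega>] open_\<Omega> by simp

lemma integrable_bounded_on_\<Omega>:
  fixes f :: "real^'n \<Rightarrow> real"
  assumes "f \<in> borel_measurable lebesgue" and "AE x in lebesgue. \<bar>f x\<bar> \<le> C * indicator \<Omega> x"
  shows "integrable lebesgue f"
proof (rule Bochner_Integration.integrable_bound[of _ "\<lambda>x. C * indicator \<Omega> x"])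
  show "integrable lebesgue (\<lambda>x. C * indicator \<Omega> x)"
    using emeasure_\<Omega>_finite open_\<Omega> by (intro integrable_mult_right) simp
  show "AE x in lebesgue. norm (f x) \<le> norm (C * indicator \<Omega> x)"
    using assms(2) by eventually_elim auto
qed fact

text \<open>The indicator of \<open>V\<close> is the pointwise limit of continuous ramps in the
  distance to the complement. Dominated convergence applies on both sides, since the determinant is
  essentially bounded on \<Omega> and \<open>V\<close> is bounded.\<close>

lemma change_of_variables_open:
  assumes V: "open V" "V \<subseteq> \<phi> ` \<Omega>"
  shows "(\<integral>x. indicator \<Omega> x * det (J x) * indicator V (\<phi> x) \<partial>lebesgue) = measure lborel V"
proof -
  obtain C where C: "AE x\<in>\<Omega> in lebesgue. \<bar>det (J x)\<bar> \<le> C" using det_J_bounded by blast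
  have bV: "bounded V" using bounded_subset[OF bounded_image V(2)] .
  \<comment> \<open>The distance to the empty set is 0 by convention, so the complement must be
    nonempty for the ramps to become positive on \<open>V\<close>.\<close>
  then have "V \<noteq> UNIV" using not_bounded_UNIV by blast
  then have ne: "- V \<noteq> {}" by auto
  have cl: "closed (- V)" using V(1) by auto
  \<comment> \<open>The ramp vanishes up to distance \<open>1 / k\<close> from the complement of
    \<open>V\<close>, which gives it compact support inside \<open>V\<close>, and equals 1 from
    distance \<open>2 / k\<close> on.\<close>
  define f where "f k y = max 0 (min 1 (real k * infdist y (- V) - 1))" for k y
  have fcont: "continuous_on UNIV (f k)" for k
    unfolding f_def by (intro continuous_intros)
  have f01: "0 \<le> f k y" "f k y \<le> indicator V y" for k y
    by (auto simp: f_def indicator_def)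
  have flim: "(\<lambda>k. f k y) \<longlonglongrightarrow> indicator V y" for y
  proof (cases "y \<in> V")
    case True
    then have d: "infdist y (- V) > 0" using infdist_pos_not_in_closed[OF cl ne] by simp
    obtain N where N: "2 < real N * infdist y (- V)" using d reals_Archimedean3 by blast
    have "f k y = 1" if "k \<ge> N" for k
    proof -
      have "real N * infdist y (- V) \<le> real k * infdist y (- V)" using that d by (intro mult_right_mono) auto
      then show ?thesis using N by (simp add: f_def)
    qed
    then show ?thesis
      using True by (intro tendsto_eventually) (auto simp: eventually_sequentially)
  qed (simp add: f_def)
  define K where "K k = {y. 1 \<le> real k * infdist y (- V)}" for k
  have KV: "K k \<subseteq> V" for k by (auto simp: K_def intro: ccontr)
  have K: "compact (K k)" for k
  proof -
    have "closed (K k)" unfolding K_def by (intro closed_Collect_le continuous_intros)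
    then show ?thesis using bounded_subset[OF bV KV] by (simp add: compact_eq_bounded_closed)
  qed
  have supp: "y \<in> K k" if "f k y \<noteq> 0" for y k
    using that by (auto simp: f_def K_def max_def min_def split: if_splits)
  have cv: "(\<integral>x. indicator \<Omega> x * det (J x) * f k (\<phi> x) \<partial>lebesgue) = (\<integral>y. f k y \<partial>lborel)" for k
    using change_of_variables_continuous(2)[OF fcont K order.trans[OF KV V(2)] supp, of k]
    by (simp add: set_lebesgue_integral_def mult.assoc)
  have "(\<lambda>k. \<integral>y. f k y \<partial>lborel) \<longlonglongrightarrow> (\<integral>y. indicator V y \<partial>lborel)"
  proof (rule integral_dominated_convergence[where w = "indicator V"])
    show "integrable lborel (indicator V :: _ \<Rightarrow> real)"
      using emeasure_bounded_finite[OF bV] V(1) by simp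
  qed (use V(1) fcont flim f01 in \<open>auto intro!: borel_measurable_continuous_onI AE_I2\<close>)
  then have 1: "(\<lambda>k. \<integral>y. f k y \<partial>lborel) \<longlonglongrightarrow> measure lborel V" using V(1) by simp
  have "(\<lambda>k. \<integral>x. indicator \<Omega> x * det (J x) * f k (\<phi> x) \<partial>lebesgue)
      \<longlonglongrightarrow> (\<integral>x. indicator \<Omega> x * det (J x) * indicator V (\<phi> x) \<partial>lebesgue)"
  proof (rule integral_dominated_convergence[where w = "\<lambda>x. C * indicator \<Omega> x"])
    have mult_\<Omega>: "(\<lambda>x. indicator \<Omega> x * det (J x) * h x) = (\<lambda>x. (indicator \<Omega> x * det (J x)) * (indicator \<Omega> x *\<^sub>R h x))" for h :: "_ \<Rightarrow> real"
      by (auto simp: indicator_def)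
    have "open {x \<in> \<Omega>. \<phi> x \<in> V}"
      using continuous_open_preimage[OF continuous_\<phi> open_\<Omega> V(1)] by (simp add: vimage_def Int_def)
    then have "(indicator {x \<in> \<Omega>. \<phi> x \<in> V} :: _ \<Rightarrow> real) \<in> borel_measurable lebesgue"
      by (intro borel_measurable_indicator) auto
    moreover have "(\<lambda>x. indicator \<Omega> x *\<^sub>R indicator V (\<phi> x)) = (indicator {x \<in> \<Omega>. \<phi> x \<in> V} :: _ \<Rightarrow> real)"
      by (auto simp: indicator_def)
    ultimately show "(\<lambda>x. indicator \<Omega> x * det (J x) * indicator V (\<phi> x)) \<in> borel_measurable lebesgue"
      unfolding mult_\<Omega>[of "\<lambda>x. indicator V (\<phi> x)"]
      by (intro borel_measurable_times det_J_measurable) simp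
    show "(\<lambda>x. indicator \<Omega> x * det (J x) * f k (\<phi> x)) \<in> borel_measurable lebesgue" for k
    proof -
      have "continuous_on \<Omega> (\<lambda>x. f k (\<phi> x))"
        by (rule continuous_on_compose2[OF fcont continuous_\<phi>]) auto
      then have "(\<lambda>x. indicator \<Omega> x *\<^sub>R f k (\<phi> x)) \<in> borel_measurable borel"
        using open_\<Omega> by (intro borel_measurable_continuous_on_indicator) auto
      then have "(\<lambda>x. indicator \<Omega> x *\<^sub>R f k (\<phi> x)) \<in> borel_measurable lebesgue"
        by (intro measurable_completion) simp
      then show ?thesis
        unfolding mult_\<Omega>[of "\<lambda>x. f k (\<phi> x)"] by (intro borel_measurable_times det_J_measurable)
    qed
    show "integrable lebesgue (\<lambda>x. C * indicator \<Omega> x)"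
      using emeasure_\<Omega>_finite open_\<Omega> by (intro integrable_mult_right) simp
    show "AE x in lebesgue. (\<lambda>k. indicator \<Omega> x * det (J x) * f k (\<phi> x))
        \<longlonglongrightarrow> indicator \<Omega> x * det (J x) * indicator V (\<phi> x)"
      by (intro AE_I2 tendsto_mult tendsto_const flim)
    show "AE x in lebesgue. norm (indicator \<Omega> x * det (J x) * f k (\<phi> x)) \<le> C * indicator \<Omega> x" for k
      using C
    proof eventually_elim
      case (elim x)
      have "\<bar>f k (\<phi> x)\<bar> \<le> 1"
        using f01[of k "\<phi> x"] by (cases "\<phi> x \<in> V") auto
      then have "\<bar>det (J x)\<bar> * \<bar>f k (\<phi> x)\<bar> \<le> C * 1" if "x \<in> \<Omega>"
        using elim that by (intro mult_mono) auto
      then show ?case by (auto simp: indicator_def abs_mult)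
    qed
  qed
  then have "(\<lambda>k. \<integral>y. f k y \<partial>lborel) \<longlonglongrightarrow> (\<integral>x. indicator \<Omega> x * det (J x) * indicator V (\<phi> x) \<partial>lebesgue)"
    unfolding cv .
  then show ?thesis using 1 by (rule LIMSEQ_unique)
qed

text \<open>Both measures are finite and agree on open sets, an intersection-stable generator of the
  Borel sets. Here \<open>j\<close> is a Borel version of the determinant that vanishes off
  \<Omega>, so that \<phi> can be extended by 0 to a total Borel map.\<close>

lemma image_measure_eq:
  assumes j: "j \<in> borel_measurable borel" "\<And>x. 0 \<le> j x" "\<And>x. x \<notin> \<Omega> \<Longrightarrow> j x = 0"
    and jJ: "AE x in lebesgue. indicator \<Omega> x * det (J x) = j x"
  shows "distr (density lborel (\<lambda>x. ennreal (j x))) borel (\<lambda>x. indicator \<Omega> x *\<^sub>R \<phi> x)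
    = density lborel (indicator (\<phi> ` \<Omega>))"
proof -
  let ?\<phi> = "\<lambda>x. indicator \<Omega> x *\<^sub>R \<phi> x"
  have \<phi>m[measurable]: "?\<phi> \<in> borel_measurable borel"
    using open_\<Omega> continuous_\<phi> by (intro borel_measurable_continuous_on_indicator) auto
  note j(1)[measurable]
  have eq: "emeasure (distr (density lborel (\<lambda>x. ennreal (j x))) borel ?\<phi>) U
      = emeasure (density lborel (indicator (\<phi> ` \<Omega>))) U" if U: "open U" for U
  proof -
    define V where "V = U \<inter> \<phi> ` \<Omega>"
    have V: "open V" "V \<subseteq> \<phi> ` \<Omega>" using U open_image by (auto simp: V_def)
    have [measurable]: "V \<in> sets borel" "U \<in> sets borel" using U V by auto
    have fin: "emeasure lborel V < \<infinity>"
      using emeasure_bounded_finite[OF bounded_subset[OF bounded_image V(2)]] .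
    obtain C where C: "AE x\<in>\<Omega> in lebesgue. \<bar>det (J x)\<bar> \<le> C" using det_J_bounded by blast
    have ae: "AE x in lebesgue. j x * indicator V (?\<phi> x) = indicator \<Omega> x * det (J x) * indicator V (\<phi> x)"
      using jJ by eventually_elim (auto simp: indicator_def)
    have m: "(\<lambda>x. j x * indicator V (?\<phi> x)) \<in> borel_measurable borel" by measurable
    have i: "integrable lebesgue (\<lambda>x. j x * indicator V (?\<phi> x))"
    proof (rule integrable_bounded_on_\<Omega>)
      show "(\<lambda>x. j x * indicator V (?\<phi> x)) \<in> borel_measurable lebesgue"
        using m by (intro measurable_completion) simp
      show "AE x in lebesgue. \<bar>j x * indicator V (?\<phi> x)\<bar> \<le> C * indicator \<Omega> x"
        using C jJ
      proof eventually_elim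
        case (elim x)
        have "\<bar>j x\<bar> \<le> C" if "x \<in> \<Omega>" using elim that by simp
        moreover have "0 \<le> C" if "x \<in> \<Omega>" using elim that by auto
        ultimately show ?case using j(3)[of x] by (cases "x \<in> \<Omega>") (auto simp: indicator_def)
      qed
    qed
    then have i': "integrable lborel (\<lambda>x. j x * indicator V (?\<phi> x))"
      using m by (simp add: integrable_completion)
    have "emeasure (distr (density lborel (\<lambda>x. ennreal (j x))) borel ?\<phi>) U
      = (\<integral>\<^sup>+x. ennreal (j x) * indicator (?\<phi> -` U) x \<partial>lborel)"
      by (simp add: emeasure_distr emeasure_density measurable_sets_borel[OF \<phi>m])
    \<comment> \<open>Off \<Omega> the extended map has the value 0, which may belong to
      \<open>U\<close>; there \<open>j\<close> vanishes, so \<open>U\<close> can be replaced by its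
      trace \<open>V\<close> on the image.\<close>
    also have "\<dots> = (\<integral>\<^sup>+x. ennreal (j x * indicator V (?\<phi> x)) \<partial>lborel)"
      using j(3) by (intro nn_integral_cong) (auto simp: V_def indicator_def)
    also have "\<dots> = ennreal (\<integral>x. j x * indicator V (?\<phi> x) \<partial>lborel)"
      using i' j(2) by (intro nn_integral_eq_integral) auto
    also have "(\<integral>x. j x * indicator V (?\<phi> x) \<partial>lborel) = (\<integral>x. j x * indicator V (?\<phi> x) \<partial>lebesgue)"
      using m by (simp add: integral_completion)
    also have "\<dots> = measure lborel V"
      using integral_lebesgue_cong_AE(2)[OF ae] change_of_variables_open[OF V] by simp
    also have "ennreal (measure lborel V) = emeasure lborel V"
      using fin by (simp add: emeasure_eq_ennreal_measure)
    also have "\<dots> = emeasure (density lborel (indicator (\<phi> ` \<Omega>))) U"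
      using open_image by (simp add: emeasure_density V_def indicator_inter_arith[symmetric] Int_commute)
    finally show ?thesis .
  qed
  show ?thesis
  proof (rule measure_eqI_generator_eq[where E = "{U. open U}" and \<Omega> = UNIV and A = "\<lambda>_. UNIV"])
    show "Int_stable {U :: (real^'n) set. open U}" by (auto simp: Int_stable_def)
    have "emeasure (density lborel (indicator (\<phi> ` \<Omega>))) UNIV = emeasure lborel (\<phi> ` \<Omega>)"
      using open_image by (simp add: emeasure_density)
    then show "emeasure (distr (density lborel (\<lambda>x. ennreal (j x))) borel ?\<phi>) UNIV \<noteq> \<infinity>"
      using eq[of UNIV] emeasure_bounded_finite[OF bounded_image] by (simp add: less_top)
  qed (use eq in \<open>auto simp: borel_def\<close>)
qed

lemma AE_transfer_to_image: "AE x\<in>\<Omega> in lebesgue. P x \<Longrightarrow> AE y\<in>\<phi> ` \<Omega> in lebesgue. P (\<psi> y)"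
  by (rule AE_lipschitz_image[OF _ lipschitz_\<phi> \<psi>_\<phi>])

text \<open>Measurability of \<open>F\<close> is recovered from the pulled-back integrand: division
  by the positive determinant makes \<open>F (\<phi> x)\<close> measurable on \<Omega>, a Borel
  version \<open>h\<close> of it is carried to the image as \<open>g\<close>, and \<open>g\<close>
  equals \<open>F\<close> almost everywhere there because \<phi> preserves null sets. For
  \<open>g\<close> the formula is equality of image measures.\<close>

theorem change_of_variables:
  fixes F :: "real^'n \<Rightarrow> real"
  assumes F: "set_integrable lebesgue \<Omega> (\<lambda>x. det (J x) * F (\<phi> x))"
  shows "set_integrable lebesgue (\<phi> ` \<Omega>) F"
    and "(LINT y:\<phi> ` \<Omega>|lebesgue. F y) = (LINT x:\<Omega>|lebesgue. det (J x) * F (\<phi> x))"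
proof -
  let ?\<phi> = "\<lambda>x. indicator \<Omega> x *\<^sub>R \<phi> x" and ?\<psi> = "\<lambda>y. indicator (\<phi> ` \<Omega>) y *\<^sub>R \<psi> y"
  have \<phi>m[measurable]: "?\<phi> \<in> borel_measurable borel"
    using open_\<Omega> continuous_\<phi> by (intro borel_measurable_continuous_on_indicator) auto
  have \<psi>m[measurable]: "?\<psi> \<in> borel_measurable borel"
    using open_image lipschitz_on_continuous_on[OF lipschitz_\<psi>]
    by (intro borel_measurable_continuous_on_indicator) auto
  have [measurable]: "\<Omega> \<in> sets borel" "\<phi> ` \<Omega> \<in> sets borel" using open_\<Omega> open_image by auto
  obtain j0 where j0: "j0 \<in> borel_measurable lborel" "AE x in lborel. indicator \<Omega> x * det (J x) = j0 x"
    using completion_ex_borel_measurable_real[OF det_J_measurable] by auto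
  \<comment> \<open>A Borel version of the determinant may be negative or nonzero on a null set;
    truncation makes it a density vanishing off \<Omega> at every point.\<close>
  define j where "j x = max 0 (j0 x) * indicator \<Omega> x" for x
  have j: "j \<in> borel_measurable borel" "\<And>x. 0 \<le> j x" "\<And>x. x \<notin> \<Omega> \<Longrightarrow> j x = 0"
    using j0(1) open_\<Omega> unfolding j_def by (auto intro!: borel_measurable_times)
  note j(1)[measurable]
  have jJ: "AE x in lebesgue. indicator \<Omega> x * det (J x) = j x"
    using AE_completion[OF j0(2)] det_J_pos
    by eventually_elim (auto simp: j_def indicator_def split: if_splits)
  have H: "(\<lambda>x. indicator \<Omega> x * F (\<phi> x)) \<in> borel_measurable lebesgue"
  proof (rule borel_measurable_AE)
    show "(\<lambda>x. (indicator \<Omega> x *\<^sub>R (det (J x) * F (\<phi> x))) / (indicator \<Omega> x * det (J x))) \<in> borel_measurable lebesgue"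
      using F det_J_measurable unfolding set_integrable_def
      by (intro borel_measurable_divide) (auto dest: borel_measurable_integrable)
    show "AE x in lebesgue. (indicator \<Omega> x *\<^sub>R (det (J x) * F (\<phi> x))) / (indicator \<Omega> x * det (J x))
        = indicator \<Omega> x * F (\<phi> x)"
      using det_J_pos by eventually_elim (auto simp: indicator_def)
  qed
  obtain h where h: "h \<in> borel_measurable lborel" "AE x in lborel. indicator \<Omega> x * F (\<phi> x) = h x"
    using completion_ex_borel_measurable_real[OF H] by auto
  have hF: "AE x\<in>\<Omega> in lebesgue. F (\<phi> x) = h x"
    using AE_completion[OF h(2)] by eventually_elim auto
  have [measurable]: "h \<in> borel_measurable borel" using h(1) by simp
  define g where "g y = h (?\<psi> y)" for y
  have gm[measurable]: "g \<in> borel_measurable borel" unfolding g_def by measurable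
  have gF: "AE y\<in>\<phi> ` \<Omega> in lebesgue. F y = g y"
    using AE_transfer_to_image[OF hF]
  proof eventually_elim
    case (elim y)
    show ?case using elim \<phi>_\<psi>(1)[of y] by (auto simp: g_def)
  qed
  have ae: "AE x in lebesgue. j x * g (?\<phi> x) = indicator \<Omega> x *\<^sub>R (det (J x) * F (\<phi> x))"
    using jJ hF
  proof eventually_elim
    case (elim x)
    show ?case
    proof (cases "x \<in> \<Omega>")
      case True
      then have "g (?\<phi> x) = h x" by (simp add: g_def \<psi>_\<phi>)
      then show ?thesis using elim True by simp
    qed (simp add: j)
  qed
  have ji: "integrable lborel (\<lambda>x. j x *\<^sub>R g (?\<phi> x))"
    "(\<integral>x. j x *\<^sub>R g (?\<phi> x) \<partial>lborel) = (LINT x:\<Omega>|lebesgue. det (J x) * F (\<phi> x))"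
  proof -
    have m: "(\<lambda>x. j x * g (?\<phi> x)) \<in> borel_measurable borel" by measurable
    have "integrable lebesgue (\<lambda>x. j x * g (?\<phi> x))"
      using integral_lebesgue_cong_AE(1)[OF ae] F unfolding set_integrable_def by simp
    then show "integrable lborel (\<lambda>x. j x *\<^sub>R g (?\<phi> x))" using m by (simp add: integrable_completion)
    show "(\<integral>x. j x *\<^sub>R g (?\<phi> x) \<partial>lborel) = (LINT x:\<Omega>|lebesgue. det (J x) * F (\<phi> x))"
      using integral_lebesgue_cong_AE(2)[OF ae] m
      by (simp add: integral_completion set_lebesgue_integral_def)
  qed
  let ?M1 = "distr (density lborel (\<lambda>x. ennreal (j x))) borel ?\<phi>"
  have I1: "integrable ?M1 g" "integral\<^sup>L ?M1 g = (LINT x:\<Omega>|lebesgue. det (J x) * F (\<phi> x))"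
    using ji j(2)
    by (subst integrable_distr_eq integral_distr; simp add: integrable_density integral_density)+
  have ind: "density lborel (indicator (\<phi> ` \<Omega>)) = density lborel (\<lambda>x. ennreal (indicator (\<phi> ` \<Omega>) x))"
    by (rule arg_cong[of _ _ "density lborel"]) (auto simp: indicator_def)
  have M1: "?M1 = density lborel (\<lambda>x. ennreal (indicator (\<phi> ` \<Omega>) x))"
    using image_measure_eq[OF j jJ] ind by simp
  have I2: "integrable lborel (\<lambda>y. indicator (\<phi> ` \<Omega>) y *\<^sub>R g y)"
    "(\<integral>y. indicator (\<phi> ` \<Omega>) y *\<^sub>R g y \<partial>lborel) = (LINT x:\<Omega>|lebesgue. det (J x) * F (\<phi> x))"
    using I1[unfolded M1] by (simp_all add: integrable_density integral_density)
  have m: "(\<lambda>y. indicator (\<phi> ` \<Omega>) y *\<^sub>R g y) \<in> borel_measurable borel" by measurable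
  have "set_integrable lebesgue (\<phi> ` \<Omega>) g"
    using I2(1) m unfolding set_integrable_def by (simp add: integrable_completion)
  then show "set_integrable lebesgue (\<phi> ` \<Omega>) F"
    using set_integral_lebesgue_cong_AE(1)[OF gF] by simp
  have "(LINT y:\<phi> ` \<Omega>|lebesgue. F y) = (LINT y:\<phi> ` \<Omega>|lebesgue. g y)"
    by (rule set_integral_lebesgue_cong_AE(2)[OF gF])
  also have "\<dots> = (\<integral>y. indicator (\<phi> ` \<Omega>) y *\<^sub>R g y \<partial>lborel)"
    using m unfolding set_lebesgue_integral_def by (simp add: integral_completion)
  finally show "(LINT y:\<phi> ` \<Omega>|lebesgue. F y) = (LINT x:\<Omega>|lebesgue. det (J x) * F (\<phi> x))"
    using I2(2) by simp
qed

end

section \<open>The chain rule for weak gradients\<close>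

lemma borel_measurable_lebesgue_AE_limit:
  fixes f :: "nat \<Rightarrow> 'a::euclidean_space \<Rightarrow> real"
  assumes "\<And>k. f k \<in> borel_measurable lebesgue" and "AE x in lebesgue. (\<lambda>k. f k x) \<longlonglongrightarrow> g x"
  shows "g \<in> borel_measurable lebesgue"
proof (rule borel_measurable_AE)
  show "(\<lambda>x. lim (\<lambda>k. f k x)) \<in> borel_measurable lebesgue"
    using assms(1) by (rule borel_measurable_lim_metric)
  show "AE x in lebesgue. lim (\<lambda>k. f k x) = g x"
    using assms(2) by eventually_elim (rule limI)
qed

text \<open>In the application \<open>f\<close> is \<open>v\<close> or a component of its weak
  gradient and stays fixed; only the bounded smooth coefficients \<open>g' k\<close> vary with the
  approximation.\<close>

lemma dominated_convergence_coefficients: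
  fixes f g :: "'a::euclidean_space \<Rightarrow> real" and g' :: "nat \<Rightarrow> 'a \<Rightarrow> real"
  assumes K: "compact K" and f: "set_integrable lebesgue K f"
    and g: "\<And>k. g' k \<in> borel_measurable lebesgue" "\<And>k. \<forall>x\<in>K. \<bar>g' k x\<bar> \<le> C"
    and lim: "AE x\<in>K in lebesgue. (\<lambda>k. g' k x) \<longlonglongrightarrow> g x"
  shows "set_integrable lebesgue K (\<lambda>x. f x * g x)"
    and "(\<lambda>k. LINT x:K|lebesgue. f x * g' k x) \<longlonglongrightarrow> (LINT x:K|lebesgue. f x * g x)"
proof -
  let ?F = "\<lambda>k x. indicator K x *\<^sub>R (f x * g' k x)" and ?H = "\<lambda>x. indicator K x *\<^sub>R (f x * g x)"
  have fi: "integrable lebesgue (\<lambda>x. indicator K x *\<^sub>R f x)" using f by (simp add: set_integrable_def)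
  have eq: "?F k = (\<lambda>x. (indicator K x *\<^sub>R f x) * g' k x)" for k :: nat by auto
  have Fm: "?F k \<in> borel_measurable lebesgue" for k :: nat
    unfolding eq by (rule borel_measurable_times[OF borel_measurable_integrable[OF fi] g(1)])
  have l: "AE x in lebesgue. (\<lambda>k. ?F k x) \<longlonglongrightarrow> ?H x"
    using lim
  proof eventually_elim
    case (elim x)
    then show ?case by (cases "x \<in> K") (auto intro: tendsto_mult)
  qed
  have F0m: "?H \<in> borel_measurable lebesgue"
    using Fm l by (rule borel_measurable_lebesgue_AE_limit)
  have w: "integrable lebesgue (\<lambda>x. C * \<bar>indicator K x *\<^sub>R f x\<bar>)"
    using fi by (intro integrable_mult_right integrable_abs)
  have b: "AE x in lebesgue. norm (?F k x) \<le> C * \<bar>indicator K x *\<^sub>R f x\<bar>" for k :: nat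
  proof (rule AE_I2)
    fix x
    show "norm (?F k x) \<le> C * \<bar>indicator K x *\<^sub>R f x\<bar>"
    proof (cases "x \<in> K")
      case True
      then show ?thesis using mult_right_mono[OF bspec[OF g(2) True, of k], of "\<bar>f x\<bar>"]
        by (simp add: abs_mult mult.commute)
    qed simp
  qed
  show "set_integrable lebesgue K (\<lambda>x. f x * g x)"
    unfolding set_integrable_def by (rule integrable_dominated_convergence[OF F0m Fm w l b])
  show "(\<lambda>k. LINT x:K|lebesgue. f x * g' k x) \<longlonglongrightarrow> (LINT x:K|lebesgue. f x * g x)"
    unfolding set_lebesgue_integral_def by (rule integral_dominated_convergence[OF F0m Fm w l b])
qed

lemma set_integral_restrict:
  fixes h :: "'a::euclidean_space \<Rightarrow> 'b::{banach, second_countable_topology}"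
  assumes "K \<subseteq> G" and "\<And>x. x \<in> G \<Longrightarrow> x \<notin> K \<Longrightarrow> h x = 0"
  shows "(LINT x:G|lebesgue. h x) = (LINT x:K|lebesgue. h x)"
    and "set_integrable lebesgue G h \<longleftrightarrow> set_integrable lebesgue K h"
proof -
  have "(\<lambda>x. indicator G x *\<^sub>R h x) = (\<lambda>x. indicator K x *\<^sub>R h x)"
    using assms by (auto simp: indicator_def fun_eq_iff)
  then show "(LINT x:G|lebesgue. h x) = (LINT x:K|lebesgue. h x)"
    and "set_integrable lebesgue G h \<longleftrightarrow> set_integrable lebesgue K h"
    by (simp_all add: set_lebesgue_integral_def set_integrable_def)
qed

lemma set_integral_sum_finite_type:
  fixes f :: "'i::finite \<Rightarrow> 'a \<Rightarrow> 'b::{banach, second_countable_topology}"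
  assumes "\<And>i. set_integrable M A (f i)"
  shows "set_integrable M A (\<lambda>x. \<Sum>i\<in>UNIV. f i x)"
    and "(LINT x:A|M. \<Sum>i\<in>UNIV. f i x) = (\<Sum>i\<in>UNIV. LINT x:A|M. f i x)"
proof -
  have eq: "(\<lambda>x. indicator A x *\<^sub>R (\<Sum>i\<in>UNIV. f i x)) = (\<lambda>x. \<Sum>i\<in>UNIV. indicator A x *\<^sub>R f i x)"
    by (rule ext) (rule scaleR_sum_right)
  have i: "integrable M (\<lambda>x. indicator A x *\<^sub>R f i x)" for i
    using assms by (simp add: set_integrable_def)
  show "set_integrable M A (\<lambda>x. \<Sum>i\<in>UNIV. f i x)"
    unfolding set_integrable_def eq by (intro Bochner_Integration.integrable_sum i)
  show "(LINT x:A|M. \<Sum>i\<in>UNIV. f i x) = (\<Sum>i\<in>UNIV. LINT x:A|M. f i x)"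
    unfolding set_lebesgue_integral_def eq by (intro Bochner_Integration.integral_sum i)
qed

lemma set_integrable_componentwise:
  fixes f :: "'a::euclidean_space \<Rightarrow> real^'n::finite"
  assumes "\<And>i. set_integrable lebesgue A (\<lambda>x. f x $ i)"
  shows "set_integrable lebesgue A f"
proof -
  have "(\<lambda>x. indicator A x *\<^sub>R f x) = (\<lambda>x. \<Sum>i\<in>UNIV. (indicator A x *\<^sub>R f x $ i) *\<^sub>R axis i 1)"
    using basis_expansion[of "indicator A _ *\<^sub>R f _"] by (auto simp: scalar_mult_eq_scaleR)
  moreover have "integrable lebesgue (\<lambda>x. \<Sum>i\<in>UNIV. (indicator A x *\<^sub>R f x $ i) *\<^sub>R (axis i 1 :: real^'n))"
    using assms by (intro Bochner_Integration.integrable_sum integrable_scaleR_left)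
      (simp add: set_integrable_def)
  ultimately show ?thesis unfolding set_integrable_def by simp
qed

context smoothly_approximated
begin

abbreviation cofactor :: "nat \<Rightarrow> 'n \<Rightarrow> 'n \<Rightarrow> real^'n \<Rightarrow> real" where
  "cofactor k i j x \<equiv> det_row_replaced (jacobian (\<Phi> k) x) i (axis j 1)"

lemma Ck_cofactor: "Ck m (cofactor k i j)"
  by (rule Ck_det_row_replaced[OF Ck_jacobian[OF smooth_\<Phi>]])

lemma cofactor_bounded:
  assumes "x \<in> \<Omega>"
  shows "\<bar>cofactor k i j x\<bar> \<le> (\<Sum>p | p permutes (UNIV :: 'n set). (2::real) ^ CARD('n))"
  unfolding det_row_replaced_def
proof (rule det_bound)
  fix a b
  show "\<bar>(\<chi> b. if b = i then axis j 1 else jacobian (\<Phi> k) x $ b) $ a $ b\<bar> \<le> 2"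
    using matrix_entry_bound[OF jacobian_\<Phi>_near[OF assms] L(2), of k a b] by (simp add: axis_def)
qed

lemma cofactor_tendsto:
  "AE x\<in>\<Omega> in lebesgue. \<forall>i j. (\<lambda>k. cofactor k i j x) \<longlonglongrightarrow> det_row_replaced (J x) i (axis j 1)"
  using jacobian_lim
proof eventually_elim
  case (elim x)
  show ?case
  proof (intro impI allI)
    fix i j assume x: "x \<in> \<Omega>"
    show "(\<lambda>k. cofactor k i j x) \<longlonglongrightarrow> det_row_replaced (J x) i (axis j 1)"
      unfolding det_row_replaced_def
    proof (rule tendsto_det)
      fix a b
      show "(\<lambda>k. (\<chi> b. if b = i then axis j 1 else jacobian (\<Phi> k) x $ b) $ a $ b)
          \<longlonglongrightarrow> (\<chi> b. if b = i then axis j 1 else J x $ b) $ a $ b"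
        using elim x by (cases "a = i") auto
    qed
  qed
qed

text \<open>
  Testing the weak gradient of \<open>v\<close> with the fields \<open>cofactor k i j \<sqdot> (\<zeta> \<circ> \<Phi> k)\<close> and summing over
  \<open>j\<close>: by the Piola identity only the derivatives of \<open>\<zeta> \<circ> \<Phi> k\<close> survive on the left, so no
  approximation of \<open>v\<close> is needed.
\<close>

lemma smooth_chain_rule:
  assumes v: "has_weak_gradient \<Omega> v p" and \<zeta>: "\<And>m. Ck m \<zeta>"
    and K': "compact K'" "K' \<subseteq> \<Omega>" and supp: "\<And>x. x \<in> \<Omega> \<Longrightarrow> \<zeta> (\<Phi> k x) \<noteq> 0 \<Longrightarrow> x \<in> K'"
  shows "(LINT x:K'|lebesgue. v x * (det (jacobian (\<Phi> k) x) * partial_deriv i \<zeta> (\<Phi> k x)))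
    = - (\<Sum>j\<in>UNIV. LINT x:K'|lebesgue. p x $ j * (cofactor k i j x * \<zeta> (\<Phi> k x)))"
proof -
  define \<eta> where "\<eta> j x = cofactor k i j x * \<zeta> (\<Phi> k x)" for j x
  \<comment> \<open>Outside \<Omega> nothing is known about \<open>\<Phi> k\<close>, and
    \<open>\<zeta> (\<Phi> k x)\<close> may be nonzero there. Extension by zero from \<Omega> gives
    a test function, with support in \<open>K'\<close>.\<close>
  define \<eta>' where "\<eta>' j x = (if x \<in> \<Omega> then \<eta> j x else 0)" for j x
  have C\<zeta>: "Ck m (\<lambda>x. \<zeta> (\<Phi> k x))" for m by (rule Ck_compose[OF \<zeta> smooth_\<Phi>])
  have C\<eta>: "Ck m (\<eta> j)" for m j
    unfolding \<eta>_def by (rule Ck_mult[OF Ck_cofactor C\<zeta>])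
  have s\<eta>: "x \<in> K'" if "x \<in> \<Omega>" "\<eta> j x \<noteq> 0" for x j using that supp by (auto simp: \<eta>_def)
  have cl: "closure {x. \<eta>' j x \<noteq> 0} \<subseteq> K'" for j
    using s\<eta> compact_imp_closed[OF K'(1)] by (intro closure_minimal) (auto simp: \<eta>'_def split: if_splits)
  then have "compact (closure {x. \<eta>' j x \<noteq> 0})" for j
    using K'(1) by (meson bounded_subset closed_closure compact_eq_bounded_closed)
  moreover have "Ck m (\<eta>' j)" for m j
    unfolding \<eta>'_def using compact_imp_closed[OF K'(1)] K'(2) s\<eta>
    by (intro Ck_cutoff[OF C\<eta> open_\<Omega>, of K']) auto
  ultimately have test: "\<eta>' j \<in> test_functions \<Omega>" for j
    using cl K'(2) unfolding test_functions_def by blast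
  have loc: "partial_deriv j (\<eta>' j) x = partial_deriv j (\<eta> j) x" if "x \<in> \<Omega>" for x j
    by (rule partial_deriv_local[OF open_\<Omega> that]) (simp add: \<eta>'_def)
  have vj: "set_integrable lebesgue K' (\<lambda>x. v x * partial_deriv j (\<eta>' j) x)"
    "(LINT x:K'|lebesgue. v x * partial_deriv j (\<eta>' j) x) = - (LINT x:K'|lebesgue. p x $ j * \<eta> j x)" for j
  proof -
    have z: "partial_deriv j (\<eta>' j) x = 0" if "x \<notin> K'" for x
      using cl that partial_deriv_eq_0_outside by blast
    show "set_integrable lebesgue K' (\<lambda>x. v x * partial_deriv j (\<eta>' j) x)"
      using set_integrable_mult_test_function(2)[OF _ test] v z
        set_integral_restrict(2)[OF K'(2), of "\<lambda>x. v x * partial_deriv j (\<eta>' j) x"]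
      by (simp add: has_weak_gradient_def)
    have "(LINT x:K'|lebesgue. v x * partial_deriv j (\<eta>' j) x) = (LINT x:\<Omega>|lebesgue. v x * partial_deriv j (\<eta>' j) x)"
      using z by (intro set_integral_restrict(1)[OF K'(2), symmetric]) simp
    also have "\<dots> = - (LINT x:\<Omega>|lebesgue. p x $ j * \<eta>' j x)"
      using v test by (simp add: has_weak_gradient_def)
    also have "(LINT x:\<Omega>|lebesgue. p x $ j * \<eta>' j x) = (LINT x:K'|lebesgue. p x $ j * \<eta>' j x)"
      using s\<eta> by (intro set_integral_restrict(1)[OF K'(2)]) (auto simp: \<eta>'_def)
    also have "\<dots> = (LINT x:K'|lebesgue. p x $ j * \<eta> j x)"
      using K'(2) unfolding set_lebesgue_integral_def
      by (intro Bochner_Integration.integral_cong) (auto simp: \<eta>'_def indicator_def)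
    finally show "(LINT x:K'|lebesgue. v x * partial_deriv j (\<eta>' j) x) = - (LINT x:K'|lebesgue. p x $ j * \<eta> j x)" .
  qed
  \<comment> \<open>The product rule gives two sums. The divergence of the cofactors vanishes; the
    other sum is the determinant whose row \<open>i\<close> is the gradient of
    \<open>\<zeta> (\<Phi> k x)\<close>. That gradient is the transposed Jacobian applied to the
    gradient of \<zeta>, so Cramer's rule evaluates it.\<close>
  have div: "(\<Sum>j\<in>UNIV. partial_deriv j (\<eta> j) x) = det (jacobian (\<Phi> k) x) * partial_deriv i \<zeta> (\<Phi> k x)" for x
  proof -
    have d\<zeta>: "\<zeta> differentiable at y" for y using \<zeta>[of "Suc 0"] by simp
    let ?r = "\<chi> j. partial_deriv j (\<lambda>x. \<zeta> (\<Phi> k x)) x"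
    have "partial_deriv j (\<eta> j) x = partial_deriv j (cofactor k i j) x * \<zeta> (\<Phi> k x)
        + ?r $ j * cofactor k i j x" for j
    proof -
      have "Ck (Suc 0) (cofactor k i j)" "Ck (Suc 0) (\<lambda>x. \<zeta> (\<Phi> k x))" by (rule Ck_cofactor, rule C\<zeta>)
      from has_derivative_mult[OF this[THEN Ck_Suc_has_derivative]]
      have "(\<eta> j has_derivative (\<lambda>h. cofactor k i j x * (\<Sum>l\<in>UNIV. h $ l * partial_deriv l (\<lambda>x. \<zeta> (\<Phi> k x)) x)
          + (\<Sum>l\<in>UNIV. h $ l * partial_deriv l (cofactor k i j) x) * \<zeta> (\<Phi> k x))) (at x)"
        unfolding \<eta>_def .
      from partial_deriv_eqI[OF this] show ?thesis
        by (simp add: axis_def if_distrib if_distribR cong: if_cong)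
    qed
    then have "(\<Sum>j\<in>UNIV. partial_deriv j (\<eta> j) x)
      = (\<Sum>j\<in>UNIV. partial_deriv j (cofactor k i j) x) * \<zeta> (\<Phi> k x) + (\<Sum>j\<in>UNIV. ?r $ j * cofactor k i j x)"
      by (simp only: sum.distrib sum_distrib_right)
    also have "(\<Sum>j\<in>UNIV. partial_deriv j (cofactor k i j) x) = 0"
      by (rule Piola_identity[OF smooth_\<Phi>])
    also have "(\<Sum>j\<in>UNIV. ?r $ j * cofactor k i j x) = det_row_replaced (jacobian (\<Phi> k) x) i ?r"
      by (rule det_row_replaced_expand[symmetric])
    also have "?r = transpose (jacobian (\<Phi> k) x) *v (\<chi> b. partial_deriv b \<zeta> (\<Phi> k x))"
      unfolding partial_deriv_compose[OF d\<zeta> smooth_\<Phi>]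
      by (simp add: vec_eq_iff matrix_vector_mult_def transpose_def)
    finally show ?thesis by (simp only: det_row_replaced_transpose) simp
  qed
  have "(LINT x:K'|lebesgue. v x * (det (jacobian (\<Phi> k) x) * partial_deriv i \<zeta> (\<Phi> k x)))
      = (LINT x:K'|lebesgue. \<Sum>j\<in>UNIV. v x * partial_deriv j (\<eta>' j) x)"
    unfolding set_lebesgue_integral_def
  proof (rule Bochner_Integration.integral_cong[OF refl])
    fix x
    show "indicator K' x *\<^sub>R (v x * (det (jacobian (\<Phi> k) x) * partial_deriv i \<zeta> (\<Phi> k x)))
        = indicator K' x *\<^sub>R (\<Sum>j\<in>UNIV. v x * partial_deriv j (\<eta>' j) x)"
    proof (cases "x \<in> K'")
      case True
      then have "x \<in> \<Omega>" using K'(2) by blast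
      then show ?thesis using div[of x] by (simp add: loc sum_distrib_left[symmetric])
    qed simp
  qed
  also have "\<dots> = (\<Sum>j\<in>UNIV. LINT x:K'|lebesgue. v x * partial_deriv j (\<eta>' j) x)"
    by (rule set_integral_sum_finite_type(2)[OF vj(1)])
  also have "\<dots> = - (\<Sum>j\<in>UNIV. LINT x:K'|lebesgue. p x $ j * \<eta> j x)"
    by (simp add: vj(2) sum_negf)
  finally show ?thesis by (simp add: \<eta>_def)
qed

text \<open>For late \<open>k\<close> all integrals of the smooth identity live on one compact
  \<open>K'\<close>, where \<open>v\<close> and its weak gradient are integrable. The coefficients
  are uniformly bounded and converge almost everywhere, so the limit exists term by term.\<close>

lemma chain_rule_reference:
  assumes v: "has_weak_gradient \<Omega> v p" and \<zeta>: "\<zeta> \<in> test_functions (\<phi> ` \<Omega>)"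
  shows "set_integrable lebesgue \<Omega> (\<lambda>x. det (J x) * (v x * partial_deriv i \<zeta> (\<phi> x)))"
    and "set_integrable lebesgue \<Omega> (\<lambda>x. det_row_replaced (J x) i (p x) * \<zeta> (\<phi> x))"
    and "(LINT x:\<Omega>|lebesgue. det (J x) * (v x * partial_deriv i \<zeta> (\<phi> x)))
      = - (LINT x:\<Omega>|lebesgue. det_row_replaced (J x) i (p x) * \<zeta> (\<phi> x))"
proof -
  let ?K = "closure {y. \<zeta> y \<noteq> 0}"
  note \<zeta>D = test_functionD[OF \<zeta>]
  obtain K' where K': "compact K'" "K' \<subseteq> \<Omega>" "\<forall>x\<in>\<Omega>. \<phi> x \<in> ?K \<longrightarrow> x \<in> K'"
    "\<forall>\<^sub>F k in sequentially. ?K \<subseteq> \<Phi> k ` \<Omega> \<and> (\<forall>x\<in>\<Omega>. \<Phi> k x \<in> ?K \<longrightarrow> x \<in> K')"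
    using approximation_eventually[OF \<zeta>D(3,4)] by (elim exE conjE)
  have bd: "\<exists>B\<ge>0. \<forall>y. \<bar>f y\<bar> \<le> B" if "continuous_on UNIV f" "\<And>y. f y \<noteq> 0 \<Longrightarrow> y \<in> ?K" for f :: "real^'n \<Rightarrow> real"
  proof -
    have "bounded (f ` ?K)"
      using \<zeta>D(3) that(1) by (intro compact_imp_bounded compact_continuous_image) (auto intro: continuous_on_subset)
    then obtain B where B: "B > 0" "\<And>y. y \<in> ?K \<Longrightarrow> \<bar>f y\<bar> \<le> B" by (auto simp: bounded_pos)
    have "\<bar>f y\<bar> \<le> B" for y using B that(2)[of y] by (cases "f y = 0") auto
    then show ?thesis using B(1) by (intro exI[of _ B]) auto
  qed
  obtain B where B: "B \<ge> 0" "\<And>y. \<bar>\<zeta> y\<bar> \<le> B" using bd[OF \<zeta>D(2)] \<zeta>D(6) by blast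
  obtain B' where B': "B' \<ge> 0" "\<And>y. \<bar>partial_deriv i \<zeta> y\<bar> \<le> B'" using bd[OF \<zeta>D(5)] \<zeta>D(7) by blast
  define C where "C = (\<Sum>p | p permutes (UNIV :: 'n set). (2::real) ^ CARD('n))"
  have C0: "0 \<le> C" by (simp add: C_def sum_nonneg)
  have \<Phi>cont: "continuous_on UNIV (\<Phi> k)" for k
    using has_derivative_continuous[OF jacobian_has_derivative[OF smooth_\<Phi>]]
    by (simp add: continuous_at_imp_continuous_on)
  have meas: "(\<lambda>x. c x * f (\<Phi> k x)) \<in> borel_measurable lebesgue"
    if "continuous_on UNIV c" "continuous_on UNIV f" for c f :: "real^'n \<Rightarrow> real" and k
    by (intro continuous_imp_lebesgue_measurable continuous_on_mult that(1)
        continuous_on_compose2[OF that(2) \<Phi>cont]) auto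
  have lim: "(\<lambda>k. f (\<Phi> k x)) \<longlonglongrightarrow> f (\<phi> x)" if "continuous_on UNIV f" "x \<in> \<Omega>" for f :: "real^'n \<Rightarrow> real" and x
    using continuous_on_tendsto_compose[OF that(1) \<Phi>_tendsto[OF that(2)]] by simp
  have vK: "set_integrable lebesgue K' v" and pK: "set_integrable lebesgue K' (\<lambda>x. p x $ j)" for j
    using v K' locally_integrable_component[of p \<Omega> j]
    by (auto simp: has_weak_gradient_def locally_integrable_on_def)
  have dbound: "\<bar>det (jacobian (\<Phi> k) x)\<bar> \<le> C" if "x \<in> \<Omega>" for k x
    unfolding C_def by (intro det_bound matrix_entry_bound[OF jacobian_\<Phi>_near[OF that] L(2)])
  have m1: "(\<lambda>x. det (jacobian (\<Phi> k) x) * partial_deriv i \<zeta> (\<Phi> k x)) \<in> borel_measurable lebesgue" for k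
    by (rule meas[OF Ck_continuous[OF Ck_det[OF Ck_jacobian[OF smooth_\<Phi>]]] \<zeta>D(5)])
  have b1: "\<forall>x\<in>K'. \<bar>det (jacobian (\<Phi> k) x) * partial_deriv i \<zeta> (\<Phi> k x)\<bar> \<le> C * B'" for k
    unfolding abs_mult using dbound K'(2) B'(2) C0 by (intro ballI mult_mono) auto
  have l1: "AE x\<in>K' in lebesgue. (\<lambda>k. det (jacobian (\<Phi> k) x) * partial_deriv i \<zeta> (\<Phi> k x))
      \<longlonglongrightarrow> det (J x) * partial_deriv i \<zeta> (\<phi> x)"
    using jacobian_lim by eventually_elim (use K'(2) in \<open>auto intro!: tendsto_mult tendsto_det lim \<zeta>D(5)\<close>)
  note 1 = dominated_convergence_coefficients[OF K'(1) vK m1 b1 l1]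
  have m2: "(\<lambda>x. cofactor k i j x * \<zeta> (\<Phi> k x)) \<in> borel_measurable lebesgue" for k j
    by (rule meas[OF Ck_continuous[OF Ck_cofactor] \<zeta>D(2)])
  have b2: "\<forall>x\<in>K'. \<bar>cofactor k i j x * \<zeta> (\<Phi> k x)\<bar> \<le> C * B" for k j
    unfolding abs_mult C_def using cofactor_bounded K'(2) B(2) by (intro ballI mult_mono) (auto intro: sum_nonneg)
  have l2: "AE x\<in>K' in lebesgue. (\<lambda>k. cofactor k i j x * \<zeta> (\<Phi> k x))
      \<longlonglongrightarrow> det_row_replaced (J x) i (axis j 1) * \<zeta> (\<phi> x)" for j
    using cofactor_tendsto by eventually_elim (use K'(2) in \<open>auto intro!: tendsto_mult lim \<zeta>D(2)\<close>)
  note 2 = dominated_convergence_coefficients[OF K'(1) pK m2 b2 l2]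
  have "\<forall>\<^sub>F k in sequentially.
      - (\<Sum>j\<in>UNIV. LINT x:K'|lebesgue. p x $ j * (cofactor k i j x * \<zeta> (\<Phi> k x)))
      = (LINT x:K'|lebesgue. v x * (det (jacobian (\<Phi> k) x) * partial_deriv i \<zeta> (\<Phi> k x)))"
    using K'(4)
  proof eventually_elim
    case (elim k)
    then show ?case
      using \<zeta>D(6) by (intro smooth_chain_rule[OF v \<zeta>D(1) K'(1,2), symmetric]) blast
  qed
  moreover have "(\<lambda>k. - (\<Sum>j\<in>UNIV. LINT x:K'|lebesgue. p x $ j * (cofactor k i j x * \<zeta> (\<Phi> k x))))
    \<longlonglongrightarrow> - (\<Sum>j\<in>UNIV. LINT x:K'|lebesgue. p x $ j * (det_row_replaced (J x) i (axis j 1) * \<zeta> (\<phi> x)))"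
    by (intro tendsto_minus tendsto_sum 2(2))
  ultimately have "(\<lambda>k. LINT x:K'|lebesgue. v x * (det (jacobian (\<Phi> k) x) * partial_deriv i \<zeta> (\<Phi> k x)))
    \<longlonglongrightarrow> - (\<Sum>j\<in>UNIV. LINT x:K'|lebesgue. p x $ j * (det_row_replaced (J x) i (axis j 1) * \<zeta> (\<phi> x)))"
    by (rule Lim_transform_eventually[rotated])
  with 1(2) have eq: "(LINT x:K'|lebesgue. v x * (det (J x) * partial_deriv i \<zeta> (\<phi> x)))
    = - (\<Sum>j\<in>UNIV. LINT x:K'|lebesgue. p x $ j * (det_row_replaced (J x) i (axis j 1) * \<zeta> (\<phi> x)))"
    by (rule LIMSEQ_unique)
  have exp: "det_row_replaced (J x) i (p x) * \<zeta> (\<phi> x)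
      = (\<Sum>j\<in>UNIV. p x $ j * (det_row_replaced (J x) i (axis j 1) * \<zeta> (\<phi> x)))" for x
    by (subst det_row_replaced_expand) (simp add: sum_distrib_right mult.assoc)
  have i2: "set_integrable lebesgue K' (\<lambda>x. det_row_replaced (J x) i (p x) * \<zeta> (\<phi> x))"
    "(LINT x:K'|lebesgue. det_row_replaced (J x) i (p x) * \<zeta> (\<phi> x))
      = (\<Sum>j\<in>UNIV. LINT x:K'|lebesgue. p x $ j * (det_row_replaced (J x) i (axis j 1) * \<zeta> (\<phi> x)))"
    unfolding exp
    by (rule set_integral_sum_finite_type(1), rule 2(1)) (rule set_integral_sum_finite_type(2), rule 2(1))
  have comm: "det (J x) * (v x * partial_deriv i \<zeta> (\<phi> x)) = v x * (det (J x) * partial_deriv i \<zeta> (\<phi> x))" for x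
    by simp
  have z1: "v x * (det (J x) * partial_deriv i \<zeta> (\<phi> x)) = 0" if "x \<in> \<Omega>" "x \<notin> K'" for x
    using that K'(3) \<zeta>D(7) by auto
  have z2: "det_row_replaced (J x) i (p x) * \<zeta> (\<phi> x) = 0" if "x \<in> \<Omega>" "x \<notin> K'" for x
    using that K'(3) \<zeta>D(6) by auto
  show "set_integrable lebesgue \<Omega> (\<lambda>x. det (J x) * (v x * partial_deriv i \<zeta> (\<phi> x)))"
    unfolding comm using 1(1) set_integral_restrict(2)[OF K'(2) z1] by simp
  show "set_integrable lebesgue \<Omega> (\<lambda>x. det_row_replaced (J x) i (p x) * \<zeta> (\<phi> x))"
    using i2(1) set_integral_restrict(2)[OF K'(2) z2] by simp
  show "(LINT x:\<Omega>|lebesgue. det (J x) * (v x * partial_deriv i \<zeta> (\<phi> x)))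
      = - (LINT x:\<Omega>|lebesgue. det_row_replaced (J x) i (p x) * \<zeta> (\<phi> x))"
    unfolding comm using eq i2(2) set_integral_restrict(1)[OF K'(2) z1] set_integral_restrict(1)[OF K'(2) z2]
    by simp
qed

lemma det_J_matrix_inv:
  "AE x\<in>\<Omega> in lebesgue. \<forall>i. det (J x) * (matrix_inv (transpose (J x)) *v r x) $ i = det_row_replaced (J x) i (r x)"
  using det_J_pos by eventually_elim (auto simp: det_row_replaced_matrix_inv[symmetric] mult.commute)

text \<open>Changing variables multiplies the candidate gradient by the determinant, which turns the
  inverse matrix into cofactors. Local integrability and the testing identity thereby reduce to
  statements on \<Omega> about bounded coefficients.\<close>

theorem has_weak_gradient_pushforward:
  assumes v: "has_weak_gradient \<Omega> v p"
  shows "has_weak_gradient (\<phi> ` \<Omega>) (\<lambda>y. v (\<psi> y)) (\<lambda>y. matrix_inv (transpose (J (\<psi> y))) *v p (\<psi> y))"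
proof -
  define q where "q x = matrix_inv (transpose (J x)) *v p x" for x
  have cof_meas: "(\<lambda>x. indicator \<Omega> x * det_row_replaced (J x) i (axis j 1)) \<in> borel_measurable lebesgue" for i j
  proof (rule borel_measurable_lebesgue_AE_limit)
    show "(\<lambda>x. indicator \<Omega> x * cofactor k i j x) \<in> borel_measurable lebesgue" for k
      using continuous_imp_lebesgue_measurable[OF Ck_continuous[OF Ck_cofactor]] open_\<Omega>
      by (intro borel_measurable_times borel_measurable_indicator) auto
    show "AE x in lebesgue. (\<lambda>k. indicator \<Omega> x * cofactor k i j x)
        \<longlonglongrightarrow> indicator \<Omega> x * det_row_replaced (J x) i (axis j 1)"
      using cofactor_tendsto
    proof eventually_elim
      case (elim x)
      then show ?case by (cases "x \<in> \<Omega>") (auto intro: tendsto_mult)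
    qed
  qed
  \<comment> \<open>Integrability over a compact part of the image follows from the change of
    variables applied to the integrand cut off by the indicator of \<open>K\<close>.\<close>
  have local: "set_integrable lebesgue K F"
    if K: "compact K" "K \<subseteq> \<phi> ` \<Omega>"
      and F: "set_integrable lebesgue {x \<in> \<Omega>. \<phi> x \<in> K} (\<lambda>x. det (J x) * F (\<phi> x))" for K and F :: "real^'n \<Rightarrow> real"
  proof -
    have "(\<lambda>x. indicator {x \<in> \<Omega>. \<phi> x \<in> K} x *\<^sub>R (det (J x) * F (\<phi> x)))
        = (\<lambda>x. indicator \<Omega> x *\<^sub>R (det (J x) * (indicator K (\<phi> x) * F (\<phi> x))))"
      by (auto simp: indicator_def)
    then have "set_integrable lebesgue \<Omega> (\<lambda>x. det (J x) * (indicator K (\<phi> x) * F (\<phi> x)))"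
      using F by (simp add: set_integrable_def)
    from change_of_variables(1)[of "\<lambda>y. indicator K y * F y", OF this]
    have "set_integrable lebesgue K (\<lambda>y. indicator K y * F y)"
      using set_integral_restrict(2)[OF K(2), of "\<lambda>y. indicator K y * F y"] by simp
    moreover have "(\<lambda>y. indicator K y *\<^sub>R (indicator K y * F y)) = (\<lambda>y. indicator K y *\<^sub>R F y)"
      by (auto simp: indicator_def)
    ultimately show ?thesis by (simp add: set_integrable_def)
  qed
  have coeff: "set_integrable lebesgue K0 (\<lambda>x. f x * c x)"
    if K0: "compact K0" "K0 \<subseteq> \<Omega>" and f: "set_integrable lebesgue K0 f"
      and c: "(\<lambda>x. indicator \<Omega> x * c x) \<in> borel_measurable lebesgue"
      and b: "AE x\<in>\<Omega> in lebesgue. \<bar>c x\<bar> \<le> C" for K0 f C and c :: "real^'n \<Rightarrow> real"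
    unfolding set_integrable_def
  proof (rule Bochner_Integration.integrable_bound)
    have fi: "integrable lebesgue (\<lambda>x. indicator K0 x *\<^sub>R f x)" using f by (simp add: set_integrable_def)
    show "integrable lebesgue (\<lambda>x. (indicator K0 x *\<^sub>R f x) * C)"
      using fi by (intro integrable_mult_left)
    have "(\<lambda>x. indicator K0 x *\<^sub>R (f x * c x)) = (\<lambda>x. (indicator K0 x *\<^sub>R f x) * (indicator \<Omega> x * c x))"
      using K0 by (intro ext) (auto simp: indicator_def)
    then show "(\<lambda>x. indicator K0 x *\<^sub>R (f x * c x)) \<in> borel_measurable lebesgue"
      using borel_measurable_times[OF borel_measurable_integrable[OF fi] c] by simp
    show "AE x in lebesgue. norm (indicator K0 x *\<^sub>R (f x * c x)) \<le> norm ((indicator K0 x *\<^sub>R f x) * C)"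
      using b
    proof eventually_elim
      case (elim x)
      show ?case
      proof (cases "x \<in> K0")
        case True
        then have "\<bar>c x\<bar> \<le> \<bar>C\<bar>" using elim K0 by auto
        then show ?thesis using True by (simp add: abs_mult mult_left_mono)
      qed simp
    qed
  qed
  have vloc: "locally_integrable_on (\<lambda>y. v (\<psi> y)) (\<phi> ` \<Omega>)"
    unfolding locally_integrable_on_def
  proof (intro allI impI)
    fix K assume K: "compact K \<and> K \<subseteq> \<phi> ` \<Omega>"
    let ?K0 = "{x \<in> \<Omega>. \<phi> x \<in> K}"
    have K0: "compact ?K0" "?K0 \<subseteq> \<Omega>" using compact_preimage K by auto
    obtain C where C: "AE x\<in>\<Omega> in lebesgue. \<bar>det (J x)\<bar> \<le> C" using det_J_bounded by blast
    have "set_integrable lebesgue ?K0 (\<lambda>x. v x * det (J x))"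
      using coeff[OF K0 _ det_J_measurable C] v K0 by (simp add: has_weak_gradient_def locally_integrable_on_def)
    moreover have "(\<lambda>x. indicator ?K0 x *\<^sub>R (v x * det (J x)))
        = (\<lambda>x. indicator ?K0 x *\<^sub>R (det (J x) * v (\<psi> (\<phi> x))))"
      by (auto simp: indicator_def \<psi>_\<phi>)
    ultimately have "set_integrable lebesgue ?K0 (\<lambda>x. det (J x) * v (\<psi> (\<phi> x)))"
      by (simp add: set_integrable_def)
    then show "set_integrable lebesgue K (\<lambda>y. v (\<psi> y))"
      by (rule local[OF conjunct1[OF K] conjunct2[OF K]])
  qed
  have qloc: "locally_integrable_on (\<lambda>y. q (\<psi> y)) (\<phi> ` \<Omega>)"
    unfolding locally_integrable_on_def
  proof (intro allI impI set_integrable_componentwise)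
    fix K i assume K: "compact K \<and> K \<subseteq> \<phi> ` \<Omega>"
    let ?K0 = "{x \<in> \<Omega>. \<phi> x \<in> K}"
    have K0: "compact ?K0" "?K0 \<subseteq> \<Omega>" using compact_preimage K by auto
    have pj: "set_integrable lebesgue ?K0 (\<lambda>x. p x $ j)" for j
      using locally_integrable_component[of p \<Omega> j] v K0
      by (auto simp: has_weak_gradient_def locally_integrable_on_def)
    define C where "C = (\<Sum>p | p permutes (UNIV :: 'n set). (2::real) ^ CARD('n))"
    have "AE x\<in>\<Omega> in lebesgue. \<bar>det_row_replaced (J x) i (axis j 1)\<bar> \<le> C" for j
      using cofactor_tendsto
    proof eventually_elim
      case (elim x)
      show ?case
      proof
        assume x: "x \<in> \<Omega>"
        then have "(\<lambda>k. \<bar>cofactor k i j x\<bar>) \<longlonglongrightarrow> \<bar>det_row_replaced (J x) i (axis j 1)\<bar>"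
          using elim by (intro tendsto_rabs) auto
        then show "\<bar>det_row_replaced (J x) i (axis j 1)\<bar> \<le> C"
          using cofactor_bounded[OF x] unfolding C_def by (intro LIMSEQ_le_const2) auto
      qed
    qed
    from coeff[OF K0 pj cof_meas this]
    have "set_integrable lebesgue ?K0 (\<lambda>x. \<Sum>j\<in>UNIV. p x $ j * det_row_replaced (J x) i (axis j 1))"
      by (rule set_integral_sum_finite_type(1))
    then have "set_integrable lebesgue ?K0 (\<lambda>x. det_row_replaced (J x) i (p x))"
      unfolding det_row_replaced_expand[of _ i "p _"] .
    moreover have ae: "AE x\<in>?K0 in lebesgue. det_row_replaced (J x) i (p x) = det (J x) * q (\<psi> (\<phi> x)) $ i"
      using det_J_matrix_inv[of p] by eventually_elim (auto simp: q_def \<psi>_\<phi>)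
    ultimately have "set_integrable lebesgue ?K0 (\<lambda>x. det (J x) * q (\<psi> (\<phi> x)) $ i)"
      using set_integral_lebesgue_cong_AE(1)[OF ae] by simp
    then show "set_integrable lebesgue K (\<lambda>y. q (\<psi> y) $ i)"
      by (rule local[OF conjunct1[OF K] conjunct2[OF K]])
  qed
  have "(LINT y:\<phi> ` \<Omega>|lebesgue. v (\<psi> y) * partial_deriv i \<zeta> y) = - (LINT y:\<phi> ` \<Omega>|lebesgue. q (\<psi> y) $ i * \<zeta> y)"
    if \<zeta>: "\<zeta> \<in> test_functions (\<phi> ` \<Omega>)" for \<zeta> i
  proof -
    note cr = chain_rule_reference[OF v \<zeta>, of i]
    have a1: "AE x\<in>\<Omega> in lebesgue. det (J x) * (v x * partial_deriv i \<zeta> (\<phi> x))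
        = det (J x) * (v (\<psi> (\<phi> x)) * partial_deriv i \<zeta> (\<phi> x))"
      by (auto simp: \<psi>_\<phi>)
    have a2: "AE x\<in>\<Omega> in lebesgue. det_row_replaced (J x) i (p x) * \<zeta> (\<phi> x)
        = det (J x) * (q (\<psi> (\<phi> x)) $ i * \<zeta> (\<phi> x))"
      using det_J_matrix_inv[of p] by eventually_elim (auto simp: q_def \<psi>_\<phi>)
    have "(LINT y:\<phi> ` \<Omega>|lebesgue. v (\<psi> y) * partial_deriv i \<zeta> y)
        = (LINT x:\<Omega>|lebesgue. det (J x) * (v x * partial_deriv i \<zeta> (\<phi> x)))"
      using change_of_variables(2)[of "\<lambda>y. v (\<psi> y) * partial_deriv i \<zeta> y"] cr(1)
        set_integral_lebesgue_cong_AE[OF a1] by simp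
    also have "\<dots> = - (LINT x:\<Omega>|lebesgue. det_row_replaced (J x) i (p x) * \<zeta> (\<phi> x))" by (rule cr(3))
    also have "(LINT x:\<Omega>|lebesgue. det_row_replaced (J x) i (p x) * \<zeta> (\<phi> x))
        = (LINT y:\<phi> ` \<Omega>|lebesgue. q (\<psi> y) $ i * \<zeta> y)"
      using change_of_variables(2)[of "\<lambda>y. q (\<psi> y) $ i * \<zeta> y"] cr(2)
        set_integral_lebesgue_cong_AE[OF a2] by simp
    finally show ?thesis .
  qed
  with vloc qloc show ?thesis unfolding has_weak_gradient_def q_def by blast
qed

text \<open>The energy is formed with a chosen weak gradient of \<open>w\<close>, an arbitrary
  representative of the transported function. Uniqueness up to null sets identifies this choice with
  the pushed forward gradient, after which only the change of variables remains.\<close>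

theorem energy_transformation:
  fixes W :: "real^'n \<Rightarrow> real \<Rightarrow> real^'n \<Rightarrow> real"
  assumes v: "has_weak_gradient \<Omega> v p"
    and w: "AE y\<in>\<phi> ` \<Omega> in lebesgue. w y = v (\<psi> y)"
    and int: "set_integrable lebesgue \<Omega> (\<lambda>x. W (\<phi> x) (v x) (matrix_inv (transpose (J x)) *v p x) * det (J x))"
  shows "energy W w (\<phi> ` \<Omega>)
    = (LINT x:\<Omega>|lebesgue. W (\<phi> x) (v x) (matrix_inv (transpose (J x)) *v p x) * det (J x))"
proof -
  define F where "F y = W y (v (\<psi> y)) (matrix_inv (transpose (J (\<psi> y))) *v p (\<psi> y))" for y
  note grad = has_weak_gradient_pushforward[OF v]
  have "has_weak_gradient (\<phi> ` \<Omega>) w (\<lambda>y. matrix_inv (transpose (J (\<psi> y))) *v p (\<psi> y))"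
    by (rule has_weak_gradient_cong_AE[OF grad]) (use w in \<open>auto elim!: eventually_mono\<close>)
  from weak_gradient_works[OF this]
  have "AE y\<in>\<phi> ` \<Omega> in lebesgue. weak_gradient (\<phi> ` \<Omega>) w y = matrix_inv (transpose (J (\<psi> y))) *v p (\<psi> y)"
    using grad w by (rule has_weak_gradient_unique[OF open_image])
  then have ae: "AE y\<in>\<phi> ` \<Omega> in lebesgue. W y (w y) (weak_gradient (\<phi> ` \<Omega>) w y) = F y"
    using w by eventually_elim (auto simp: F_def)
  have a1: "AE x\<in>\<Omega> in lebesgue. W (\<phi> x) (v x) (matrix_inv (transpose (J x)) *v p x) * det (J x)
      = det (J x) * F (\<phi> x)"
    by (auto simp: F_def \<psi>_\<phi> mult.commute)
  have "energy W w (\<phi> ` \<Omega>) = (LINT y:\<phi> ` \<Omega>|lebesgue. F y)"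
    unfolding energy_def by (rule set_integral_lebesgue_cong_AE(2)[OF ae])
  also have "\<dots> = (LINT x:\<Omega>|lebesgue. W (\<phi> x) (v x) (matrix_inv (transpose (J x)) *v p x) * det (J x))"
    using change_of_variables(2)[of F] int set_integral_lebesgue_cong_AE[OF a1] by simp
  finally show ?thesis .
qed

end

section \<open>Differentiability of minimal values\<close>

locale seminormed_functions =
  fixes C :: "('a \<Rightarrow> 'b::real_vector) set" and N :: "('a \<Rightarrow> 'b) \<Rightarrow> real"
  assumes subspace: "linear_subspace C"
    and N_nonneg: "f \<in> C \<Longrightarrow> 0 \<le> N f"
    and N_triangle: "f \<in> C \<Longrightarrow> h \<in> C \<Longrightarrow> N (\<lambda>x. f x + h x) \<le> N f + N h"
    and N_scale: "f \<in> C \<Longrightarrow> N (\<lambda>x. c *\<^sub>R f x) \<le> \<bar>c\<bar> * N f"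
begin

lemma C_closed:
  "(\<lambda>x. 0) \<in> C" "f \<in> C \<Longrightarrow> h \<in> C \<Longrightarrow> (\<lambda>x. f x + h x) \<in> C" "f \<in> C \<Longrightarrow> (\<lambda>x. c *\<^sub>R f x) \<in> C"
  using subspace by (auto simp: linear_subspace_def)

lemma C_diff: "f \<in> C \<Longrightarrow> h \<in> C \<Longrightarrow> (\<lambda>x. f x - h x) \<in> C"
  using C_closed(2)[OF _ C_closed(3)[of h "-1"], of f] by simp

lemma N_zero: "N (\<lambda>x. 0) = 0"
  using N_scale[OF C_closed(1), of 0] N_nonneg[OF C_closed(1)] by simp

lemma dual_spaceD:
  assumes "M \<in> dual_space C N"
  shows "f \<notin> C \<Longrightarrow> M f = 0" "f \<in> C \<Longrightarrow> h \<in> C \<Longrightarrow> M (\<lambda>x. f x + h x) = M f + M h"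
    "f \<in> C \<Longrightarrow> M (\<lambda>x. c *\<^sub>R f x) = c * M f" "\<exists>B. \<forall>f\<in>C. \<bar>M f\<bar> \<le> B * N f"
  using assms by (auto simp: dual_space_def)

lemma dual_norm_bdd:
  assumes "M \<in> dual_space C N"
  shows "bdd_above ((\<lambda>f. \<bar>M f\<bar>) ` {f \<in> C. N f \<le> 1})"
proof -
  obtain B where B: "\<And>f. f \<in> C \<Longrightarrow> \<bar>M f\<bar> \<le> B * N f" using dual_spaceD(4)[OF assms] by blast
  show ?thesis
  proof (rule bdd_aboveI2)
    fix f assume "f \<in> {f \<in> C. N f \<le> 1}"
    then have f: "f \<in> C" "N f \<le> 1" by auto
    have "\<bar>M f\<bar> \<le> \<bar>B\<bar> * N f"
      using B[OF f(1)] mult_right_mono[OF abs_ge_self N_nonneg[OF f(1)], of B] by linarith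
    also have "\<dots> \<le> \<bar>B\<bar> * 1" using f(2) by (intro mult_left_mono) auto
    finally show "\<bar>M f\<bar> \<le> \<bar>B\<bar>" by simp
  qed
qed

text \<open>If \<open>N f\<close> is positive, \<open>f\<close> can be normalised. If it is 0, which
  is possible for nonzero \<open>f\<close> since \<open>N\<close> is a seminorm, boundedness of the
  functional forces \<open>M f = 0\<close>.\<close>

lemma dual_norm_bound:
  assumes M: "M \<in> dual_space C N" and f: "f \<in> C"
  shows "\<bar>M f\<bar> \<le> dual_norm C N M * N f"
proof (cases "N f = 0")
  case True
  then show ?thesis using dual_spaceD(4)[OF M] f by fastforce
next
  case False
  then have pos: "N f > 0" using N_nonneg[OF f] by simp
  define g where "g = (\<lambda>x. (1 / N f) *\<^sub>R f x)"
  have g: "g \<in> C" "N g \<le> 1"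
    using C_closed(3)[OF f] N_scale[OF f, of "1 / N f"] pos by (simp_all add: g_def)
  have "\<bar>M g\<bar> \<le> dual_norm C N M"
    unfolding dual_norm_def using g by (intro cSUP_upper2[OF dual_norm_bdd[OF M], of g]) auto
  moreover have "M g = M f / N f"
    unfolding g_def using dual_spaceD(3)[OF M f, of "1 / N f"] by simp
  ultimately show ?thesis using pos by (simp add: abs_div field_simps)
qed

lemma dual_norm_le:
  assumes "\<And>f. f \<in> C \<Longrightarrow> \<bar>M f\<bar> \<le> e * N f" "0 \<le> e"
  shows "dual_norm C N M \<le> e"
  unfolding dual_norm_def
proof (rule cSUP_least)
  show "{f \<in> C. N f \<le> 1} \<noteq> {}" using C_closed(1) N_zero by auto
  fix f assume f: "f \<in> {f \<in> C. N f \<le> 1}"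
  then have "\<bar>M f\<bar> \<le> e * N f" using assms(1) by simp
  also have "\<dots> \<le> e * 1" using f assms(2) by (intro mult_left_mono) auto
  finally show "\<bar>M f\<bar> \<le> e" by simp
qed

lemma dual_diff:
  assumes M: "M \<in> dual_space C N" and K: "K \<in> dual_space C N"
  shows "(\<lambda>f. M f - K f) \<in> dual_space C N"
proof -
  have "\<bar>M f - K f\<bar> \<le> (dual_norm C N M + dual_norm C N K) * N f" if "f \<in> C" for f
    using dual_norm_bound[OF M that] dual_norm_bound[OF K that] by (simp add: distrib_right)
  then have "\<exists>B. \<forall>f\<in>C. \<bar>M f - K f\<bar> \<le> B * N f" by blast
  then show ?thesis
    unfolding dual_space_def using dual_spaceD(1-3)[OF M] dual_spaceD(1-3)[OF K]
    by (intro CollectI conjI) (simp_all add: algebra_simps)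
qed

lemma dual_norm_nonneg:
  assumes "M \<in> dual_space C N"
  shows "0 \<le> dual_norm C N M"
proof -
  have "\<bar>M (\<lambda>x. 0)\<bar> \<le> dual_norm C N M"
    unfolding dual_norm_def using C_closed(1) N_zero
    by (intro cSUP_upper2[OF dual_norm_bdd[OF assms], of "\<lambda>x. 0"]) auto
  then show ?thesis by (rule order.trans[rotated]) simp
qed

lemma dual_ball_open:
  assumes L: "L \<in> dual_space C N"
  shows "openin (dual_topology C N) {M \<in> dual_space C N. dual_norm C N (\<lambda>f. M f - L f) < e}"
  unfolding dual_topology_def openin_seminorm_topology
proof (intro conjI ballI)
  fix M assume "M \<in> {M \<in> dual_space C N. dual_norm C N (\<lambda>f. M f - L f) < e}"
  then have M: "M \<in> dual_space C N" "dual_norm C N (\<lambda>f. M f - L f) < e" by auto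
  show "\<exists>d>0. \<forall>K\<in>dual_space C N. dual_norm C N (\<lambda>f. K f - M f) < d \<longrightarrow>
      K \<in> {M \<in> dual_space C N. dual_norm C N (\<lambda>f. M f - L f) < e}"
  proof (intro exI[of _ "e - dual_norm C N (\<lambda>f. M f - L f)"] conjI ballI impI)
    fix K assume K: "K \<in> dual_space C N"
      "dual_norm C N (\<lambda>f. K f - M f) < e - dual_norm C N (\<lambda>f. M f - L f)"
    have "dual_norm C N (\<lambda>f. K f - L f) \<le> dual_norm C N (\<lambda>f. K f - M f) + dual_norm C N (\<lambda>f. M f - L f)"
    proof (rule dual_norm_le)
      show "\<bar>K f - L f\<bar> \<le> (dual_norm C N (\<lambda>f. K f - M f) + dual_norm C N (\<lambda>f. M f - L f)) * N f" if "f \<in> C" for f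
        using dual_norm_bound[OF dual_diff[OF K(1) M(1)] that] dual_norm_bound[OF dual_diff[OF M(1) L] that]
        by (simp add: distrib_right)
      show "0 \<le> dual_norm C N (\<lambda>f. K f - M f) + dual_norm C N (\<lambda>f. M f - L f)"
        by (intro add_nonneg_nonneg dual_norm_nonneg dual_diff K M L)
    qed
    then show "K \<in> {M \<in> dual_space C N. dual_norm C N (\<lambda>f. M f - L f) < e}" using K by simp
  qed (use M in simp)
qed auto

text \<open>Restriction to a line brings in one-variable calculus, namely uniqueness of derivatives
  and the mean value theorem. Dividing by \<open>N h + 1\<close> rather than \<open>N h\<close>
  covers directions of seminorm 0.\<close>

lemma has_dual_derivative_line:
  assumes D: "has_dual_derivative C N F M (\<lambda>x. f x + s *\<^sub>R h x)" and h: "h \<in> C"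
  shows "((\<lambda>s. F (\<lambda>x. f x + s *\<^sub>R h x)) has_real_derivative M h) (at s)"
  unfolding has_field_derivative_def has_derivative_at_alt
proof (intro conjI allI impI)
  show "bounded_linear ((*) (M h))" by (rule bounded_linear_mult_right)
  fix e :: real assume e: "e > 0"
  have M: "M \<in> dual_space C N" using D by (simp add: has_dual_derivative_def)
  have e': "e / (N h + 1) > 0" using e N_nonneg[OF h] by simp
  obtain d where d: "d > 0" "\<And>g. g \<in> C \<Longrightarrow> N g < d \<Longrightarrow>
      \<bar>F (\<lambda>x. (f x + s *\<^sub>R h x) + g x) - F (\<lambda>x. f x + s *\<^sub>R h x) - M g\<bar> \<le> e / (N h + 1) * N g"
    using D e' unfolding has_dual_derivative_def by blast
  show "\<exists>d>0. \<forall>y. norm (y - s) < d \<longrightarrow>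
      norm (F (\<lambda>x. f x + y *\<^sub>R h x) - F (\<lambda>x. f x + s *\<^sub>R h x) - M h * (y - s)) \<le> e * norm (y - s)"
  proof (intro exI[of _ "d / (N h + 1)"] conjI allI impI)
    show "0 < d / (N h + 1)" using d(1) N_nonneg[OF h] by simp
    fix y :: real assume y: "norm (y - s) < d / (N h + 1)"
    define g where "g = (\<lambda>x. (y - s) *\<^sub>R h x)"
    have g: "g \<in> C" "N g \<le> \<bar>y - s\<bar> * N h"
      using C_closed(3)[OF h] N_scale[OF h] by (simp_all add: g_def)
    have "\<bar>y - s\<bar> * N h \<le> \<bar>y - s\<bar> * (N h + 1)" by (intro mult_left_mono) auto
    also have "\<dots> < d" using y N_nonneg[OF h] by (simp add: field_simps)
    finally have "N g < d" using g(2) by simp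
    from d(2)[OF g(1) this]
    have "\<bar>F (\<lambda>x. (f x + s *\<^sub>R h x) + g x) - F (\<lambda>x. f x + s *\<^sub>R h x) - M g\<bar> \<le> e / (N h + 1) * (\<bar>y - s\<bar> * N h)"
      using mult_left_mono[OF g(2), of "e / (N h + 1)"] e' by linarith
    also have "\<dots> = (e * \<bar>y - s\<bar>) * (N h / (N h + 1))" by simp
    also have "\<dots> \<le> (e * \<bar>y - s\<bar>) * 1" using e N_nonneg[OF h] by (intro mult_left_mono) auto
    finally have "\<bar>F (\<lambda>x. (f x + s *\<^sub>R h x) + g x) - F (\<lambda>x. f x + s *\<^sub>R h x) - M g\<bar> \<le> e * \<bar>y - s\<bar>" by simp
    moreover have "(\<lambda>x. (f x + s *\<^sub>R h x) + g x) = (\<lambda>x. f x + y *\<^sub>R h x)"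
      by (simp add: g_def scaleR_diff_left add.assoc)
    moreover have "M g = M h * (y - s)"
      unfolding g_def using dual_spaceD(3)[OF M h] by simp
    ultimately show "norm (F (\<lambda>x. f x + y *\<^sub>R h x) - F (\<lambda>x. f x + s *\<^sub>R h x) - M h * (y - s)) \<le> e * norm (y - s)"
      by simp
  qed
qed

text \<open>The directional derivatives determine the functional on the carrier, and off the carrier
  elements of the dual are 0 by convention; hence equality of functions.\<close>

lemma has_dual_derivative_unique:
  assumes K: "has_dual_derivative C N F K f" and M: "has_dual_derivative C N F M f"
  shows "K = M"
proof
  fix h
  have KM: "K \<in> dual_space C N" "M \<in> dual_space C N" using assms by (auto simp: has_dual_derivative_def)
  show "K h = M h"
  proof (cases "h \<in> C")
    case True
    have K0: "has_dual_derivative C N F K (\<lambda>x. f x + 0 *\<^sub>R h x)" using K by simp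
    have M0: "has_dual_derivative C N F M (\<lambda>x. f x + 0 *\<^sub>R h x)" using M by simp
    show ?thesis
      by (rule DERIV_unique[OF has_dual_derivative_line[OF K0 True] has_dual_derivative_line[OF M0 True]])
  qed (simp add: dual_spaceD(1)[OF KM(1)] dual_spaceD(1)[OF KM(2)])
qed

lemma dual_derivative_eqI: "has_dual_derivative C N F M f \<Longrightarrow> dual_derivative C N F f = M"
  unfolding dual_derivative_def by (rule some_equality) (auto intro: has_dual_derivative_unique)

section \<open>The envelope argument\<close>

lemma openin_translate:
  assumes "openin (seminorm_topology C N) U" "f \<in> U"
  shows "\<exists>d>0. \<forall>h\<in>C. N h < d \<longrightarrow> (\<lambda>x. f x + h x) \<in> U"
proof -
  have f: "f \<in> C" using assms openin_subset by fastforce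
  obtain d where d: "d > 0" "\<And>h. h \<in> C \<Longrightarrow> N (\<lambda>x. h x - f x) < d \<Longrightarrow> h \<in> U"
    using assms unfolding openin_seminorm_topology by blast
  have "(\<lambda>x. f x + h x) \<in> U" if "h \<in> C" "N h < d" for h
    using d(2)[OF C_closed(2)[OF f that(1)]] that(2) by simp
  then show ?thesis using d(1) by blast
qed

text \<open>No derivative of \<open>p\<close> occurs. The increment of \<open>F\<close> lies between
  increments of \<E> taken at the fixed first arguments \<open>p \<phi>\<close> (above) and
  \<open>p \<theta>\<close> (below), and both are controlled by the derivative of \<E> near
  \<open>(p \<phi>, \<phi>)\<close>.\<close>

theorem envelope_theorem:
  fixes X :: "'v topology" and \<E> :: "'v \<Rightarrow> ('a \<Rightarrow> 'b) \<Rightarrow> real"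
  assumes S: "openin (seminorm_topology C N) S" and Q: "openin (seminorm_topology C N) Q" "Q \<subseteq> S"
    and deriv: "\<And>v \<phi>. v \<in> topspace X \<Longrightarrow> \<phi> \<in> S \<Longrightarrow> \<exists>M. has_dual_derivative C N (\<E> v) M \<phi>"
    and deriv_cont: "continuous_map (prod_topology X (subtopology (seminorm_topology C N) S)) (dual_topology C N)
      (\<lambda>(v, \<phi>). dual_derivative C N (\<E> v) \<phi>)"
    and p: "continuous_map (subtopology (seminorm_topology C N) Q) X p"
    and F_eq: "\<And>\<phi>. \<phi> \<in> Q \<Longrightarrow> F \<phi> = \<E> (p \<phi>) \<phi>"
    and F_le: "\<And>\<phi> \<theta>. \<phi> \<in> Q \<Longrightarrow> \<theta> \<in> Q \<Longrightarrow> F \<theta> \<le> \<E> (p \<phi>) \<theta>"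
  shows "C1_functional_on C N Q F"
    and "\<phi> \<in> Q \<Longrightarrow> dual_derivative C N F \<phi> = dual_derivative C N (\<E> (p \<phi>)) \<phi>"
proof -
  let ?T = "seminorm_topology C N"
  let ?D = "\<lambda>v \<phi>. dual_derivative C N (\<E> v) \<phi>"
  have QC: "Q \<subseteq> C" using openin_subset[OF Q(1)] by simp
  have pX: "p \<phi> \<in> topspace X" if "\<phi> \<in> Q" for \<phi>
    using continuous_map_funspace[OF p] that QC by (auto simp: Pi_iff)
  have D: "has_dual_derivative C N (\<E> v) (?D v \<phi>) \<phi>" if "v \<in> topspace X" "\<phi> \<in> S" for v \<phi>
    using deriv[OF that] dual_derivative_eqI by metis
  have Ddual: "?D v \<phi> \<in> dual_space C N" if "v \<in> topspace X" "\<phi> \<in> S" for v \<phi>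
    using D[OF that] by (simp add: has_dual_derivative_def)
  have main: "has_dual_derivative C N F (?D (p \<phi>) \<phi>) \<phi>" if \<phi>: "\<phi> \<in> Q" for \<phi>
    unfolding has_dual_derivative_def
  proof (intro conjI allI impI)
    let ?M = "?D (p \<phi>) \<phi>"
    have \<phi>S: "\<phi> \<in> S" using \<phi> Q(2) by blast
    show Mdual: "?M \<in> dual_space C N" using Ddual[OF pX[OF \<phi>] \<phi>S] .
    fix e :: real assume e: "e > 0"
    define B where "B = {K \<in> dual_space C N. dual_norm C N (\<lambda>f. K f - ?M f) < e}"
    have "dual_norm C N (\<lambda>f. ?M f - ?M f) \<le> e / 2"
      using e N_nonneg by (intro dual_norm_le) auto
    then have MB: "?M \<in> B" using Mdual e by (simp add: B_def)
    define P where "P = {z \<in> topspace (prod_topology X (subtopology ?T S)). (case z of (v, \<phi>) \<Rightarrow> ?D v \<phi>) \<in> B}"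
    have P: "openin (prod_topology X (subtopology ?T S)) P"
      unfolding P_def B_def by (rule openin_continuous_map_preimage[OF deriv_cont dual_ball_open[OF Mdual]])
    have inP: "(p \<phi>, \<phi>) \<in> P"
      using pX[OF \<phi>] \<phi> \<phi>S QC MB by (auto simp: P_def)
    obtain U V where UV: "openin X U" "openin (subtopology ?T S) V" "p \<phi> \<in> U" "\<phi> \<in> V" "U \<times> V \<subseteq> P"
      using P[unfolded openin_prod_topology_alt, rule_format, OF inP] by (elim exE conjE)
    have V: "openin ?T V" using UV(2) S openin_trans_full by blast
    have "openin (subtopology ?T Q) {\<theta> \<in> topspace (subtopology ?T Q). p \<theta> \<in> U}"
      by (rule openin_continuous_map_preimage[OF p UV(1)])
    then have R: "openin ?T {\<theta> \<in> topspace (subtopology ?T Q). p \<theta> \<in> U}"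
      using Q(1) openin_trans_full by blast
    \<comment> \<open>For perturbations in \<open>Z\<close> both the perturbation and its value
      under \<open>p\<close> stay in the factors of a product neighbourhood on which the derivative
      is within \<open>e\<close> of \<open>?M\<close>.\<close>
    define Z where "Z = V \<inter> {\<theta> \<in> topspace (subtopology ?T Q). p \<theta> \<in> U}"
    have "openin ?T Z" unfolding Z_def using V R by (rule openin_Int)
    moreover have "\<phi> \<in> Z"
      using UV \<phi> QC by (auto simp: Z_def)
    ultimately have "\<exists>d>0. \<forall>h\<in>C. N h < d \<longrightarrow> (\<lambda>x. \<phi> x + h x) \<in> Z"
      by (rule openin_translate)
    then obtain d where d: "d > 0" "\<forall>h\<in>C. N h < d \<longrightarrow> (\<lambda>x. \<phi> x + h x) \<in> Z"
      by (elim exE conjE)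
    have dV: "(\<lambda>x. \<phi> x + h x) \<in> V" "(\<lambda>x. \<phi> x + h x) \<in> Q" "p (\<lambda>x. \<phi> x + h x) \<in> U"
      if "h \<in> C" "N h < d" for h using d(2)[rule_format, OF that] by (auto simp: Z_def)
    \<comment> \<open>Mean value theorem on the segment from \<phi>: the derivative at the
      intermediate point lies in the dual ball \<open>B\<close>. The estimate is uniform in
      \<open>v \<in> U\<close>, so it also applies to the moving argument
      \<open>p ?\<theta>\<close>.\<close>
    have incr: "\<bar>\<E> v (\<lambda>x. \<phi> x + h x) - \<E> v \<phi> - ?M h\<bar> \<le> e * N h"
      if v: "v \<in> U" and h: "h \<in> C" "N h < d" for v h
    proof -
      have vX: "v \<in> topspace X" using v UV(1) openin_subset by blast
      have seg: "(\<lambda>x. \<phi> x + s *\<^sub>R h x) \<in> V" "(\<lambda>x. \<phi> x + s *\<^sub>R h x) \<in> S" if "0 \<le> s" "s \<le> 1" for s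
      proof -
        have "N (\<lambda>x. s *\<^sub>R h x) \<le> s * N h" using N_scale[OF h(1), of s] that by simp
        also have "\<dots> \<le> N h" using that N_nonneg[OF h(1)] by (simp add: mult_left_le_one_le)
        finally have "N (\<lambda>x. s *\<^sub>R h x) < d" using h(2) by simp
        from dV(1,2)[OF C_closed(3)[OF h(1)] this]
        show "(\<lambda>x. \<phi> x + s *\<^sub>R h x) \<in> V" "(\<lambda>x. \<phi> x + s *\<^sub>R h x) \<in> S" using Q(2) by auto
      qed
      have "((\<lambda>s. \<E> v (\<lambda>x. \<phi> x + s *\<^sub>R h x)) has_real_derivative ?D v (\<lambda>x. \<phi> x + s *\<^sub>R h x) h) (at s)"
        if "0 \<le> s" "s \<le> 1" for s
        using has_dual_derivative_line[OF D[OF vX seg(2)[OF that]] h(1)] .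
      from MVT2[of 0 1, OF _ this] obtain s where s: "0 < s" "s < 1"
        "\<E> v (\<lambda>x. \<phi> x + h x) - \<E> v \<phi> = ?D v (\<lambda>x. \<phi> x + s *\<^sub>R h x) h" by auto
      have "(v, \<lambda>x. \<phi> x + s *\<^sub>R h x) \<in> P" using UV(5) v seg(1)[of s] s by auto
      then have DB: "?D v (\<lambda>x. \<phi> x + s *\<^sub>R h x) \<in> B" by (simp add: P_def)
      then have "\<bar>?D v (\<lambda>x. \<phi> x + s *\<^sub>R h x) h - ?M h\<bar>
          \<le> dual_norm C N (\<lambda>f. ?D v (\<lambda>x. \<phi> x + s *\<^sub>R h x) f - ?M f) * N h"
        using dual_norm_bound[OF dual_diff[OF _ Mdual] h(1)] by (simp add: B_def)
      also have "\<dots> \<le> e * N h"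
        using DB N_nonneg[OF h(1)] by (intro mult_right_mono) (auto simp: B_def)
      finally show ?thesis using s(3) by simp
    qed
    show "\<exists>d>0. \<forall>h\<in>C. N h < d \<longrightarrow> \<bar>F (\<lambda>x. \<phi> x + h x) - F \<phi> - ?M h\<bar> \<le> e * N h"
    proof (intro exI[of _ d] conjI ballI impI)
      fix h assume h: "h \<in> C" "N h < d"
      let ?\<theta> = "\<lambda>x. \<phi> x + h x"
      note \<theta> = dV(2,3)[OF h]
      \<comment> \<open>Each endpoint is compared with the value at the other one's argument:
        \<open>p \<phi>\<close> competes at \<open>?\<theta>\<close>, and \<open>p ?\<theta>\<close>
        competes at \<phi>.\<close>
      have "F ?\<theta> - F \<phi> \<le> \<E> (p \<phi>) ?\<theta> - \<E> (p \<phi>) \<phi>"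
        using F_le[OF \<phi> \<theta>(1)] F_eq[OF \<phi>] by simp
      moreover have "F ?\<theta> - F \<phi> \<ge> \<E> (p ?\<theta>) ?\<theta> - \<E> (p ?\<theta>) \<phi>"
        using F_le[OF \<theta>(1) \<phi>] F_eq[OF \<theta>(1)] by simp
      ultimately show "\<bar>F ?\<theta> - F \<phi> - ?M h\<bar> \<le> e * N h"
        using incr[OF UV(3) h] incr[OF \<theta>(2) h] by linarith
    qed (rule d(1))
  qed
  show eq: "dual_derivative C N F \<phi> = ?D (p \<phi>) \<phi>" if "\<phi> \<in> Q" for \<phi>
    using dual_derivative_eqI[OF main[OF that]] .
  have "continuous_map (subtopology ?T Q) (prod_topology X (subtopology ?T S)) (\<lambda>\<phi>. (p \<phi>, \<phi>))"
    using p Q(2) by (auto simp: continuous_map_pairwise o_def continuous_map_in_subtopology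
        intro: continuous_map_from_subtopology)
  from continuous_map_compose[OF this deriv_cont]
  have "continuous_map (subtopology ?T Q) (dual_topology C N) (\<lambda>\<phi>. ?D (p \<phi>) \<phi>)"
    by (simp add: o_def)
  then have "continuous_map (subtopology ?T Q) (dual_topology C N) (dual_derivative C N F)"
    by (rule continuous_map_eq) (auto simp: eq)
  then show "C1_functional_on C N Q F"
    unfolding C1_functional_on_def using main by blast
qed

end

section \<open>Lipschitz representatives and admissible perturbations\<close>

lemma locally_integrable_add:
  "locally_integrable_on f G \<Longrightarrow> locally_integrable_on g G \<Longrightarrow> locally_integrable_on (\<lambda>x. f x + g x) G"
  unfolding locally_integrable_on_def by (blast intro: set_integral_add)

lemma locally_integrable_scaleR:
  "locally_integrable_on f G \<Longrightarrow> locally_integrable_on (\<lambda>x. c *\<^sub>R f x) G"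
  unfolding locally_integrable_on_def set_integrable_def
  using integrable_scaleR_right[of c lebesgue "\<lambda>x. indicator _ x *\<^sub>R f x"] by (simp add: mult.commute)

lemma has_weak_gradient_add:
  assumes "has_weak_gradient G v p" "has_weak_gradient G w q"
  shows "has_weak_gradient G (\<lambda>x. v x + w x) (\<lambda>x. p x + q x)"
  unfolding has_weak_gradient_def
proof (intro conjI ballI allI)
  have l: "locally_integrable_on v G" "locally_integrable_on w G" "locally_integrable_on p G" "locally_integrable_on q G"
    using assms by (auto simp: has_weak_gradient_def)
  then show "locally_integrable_on (\<lambda>x. v x + w x) G" "locally_integrable_on (\<lambda>x. p x + q x) G"
    by (auto intro: locally_integrable_add)
  fix \<psi> i assume \<psi>: "\<psi> \<in> test_functions G"
  note m = set_integrable_mult_test_function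
  show "(LINT x:G|lebesgue. (v x + w x) * partial_deriv i \<psi> x) = - (LINT x:G|lebesgue. (p x + q x) $ i * \<psi> x)"
    using assms \<psi> m(2)[OF l(1) \<psi>] m(2)[OF l(2) \<psi>]
      m(1)[OF locally_integrable_component[OF l(3)] \<psi>] m(1)[OF locally_integrable_component[OF l(4)] \<psi>]
    by (simp add: distrib_right set_integral_add has_weak_gradient_def)
qed

lemma has_weak_gradient_scaleR:
  fixes v :: "real^'n::finite \<Rightarrow> real"
  assumes "has_weak_gradient G v p"
  shows "has_weak_gradient G (\<lambda>x. c * v x) (\<lambda>x. c *\<^sub>R p x)"
  unfolding has_weak_gradient_def
proof (intro conjI ballI allI)
  have l: "locally_integrable_on v G" "locally_integrable_on p G"
    using assms by (auto simp: has_weak_gradient_def)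
  then show "locally_integrable_on (\<lambda>x. c * v x) G" "locally_integrable_on (\<lambda>x. c *\<^sub>R p x) G"
    using locally_integrable_scaleR[OF l(1), of c] locally_integrable_scaleR[OF l(2), of c] by simp_all
  fix \<psi> i assume \<psi>: "\<psi> \<in> test_functions G"
  have "(LINT x:G|lebesgue. c * (v x * partial_deriv i \<psi> x)) = - (LINT x:G|lebesgue. c * (p x $ i * \<psi> x))"
    using assms \<psi> by (simp add: has_weak_gradient_def)
  then show "(LINT x:G|lebesgue. c * v x * partial_deriv i \<psi> x) = - (LINT x:G|lebesgue. (c *\<^sub>R p x) $ i * \<psi> x)"
    by (simp add: mult.assoc)
qed

text \<open>The norms are suprema of sets of reals and give usable estimates only when these sets
  are bounded above; membership in \<open>W1inf\<close> supplies the bounds.\<close>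

lemma W1infD:
  assumes "u \<in> W1inf G"
  shows "bdd_above {norm (u x) | x. x \<in> G}" "bdd_above {norm (u x - u y) / norm (x - y) | x y. x \<in> G \<and> y \<in> G \<and> x \<noteq> y}"
    "has_weak_gradient G (\<lambda>x. u x $ j) (weak_gradient G (\<lambda>x. u x $ j))"
proof -
  obtain B where "\<And>x. x \<in> G \<Longrightarrow> norm (u x) \<le> B"
    using assms by (auto simp: W1inf_def bounded_iff)
  then show "bdd_above {norm (u x) | x. x \<in> G}" by (intro bdd_aboveI[of _ B]) auto
  obtain L where L: "L-lipschitz_on G u" using assms by (auto simp: W1inf_def)
  show "bdd_above {norm (u x - u y) / norm (x - y) | x y. x \<in> G \<and> y \<in> G \<and> x \<noteq> y}"
    using lipschitz_onD[OF L] by (intro bdd_aboveI[of _ L]) (auto simp: dist_norm divide_le_eq)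
  show "has_weak_gradient G (\<lambda>x. u x $ j) (weak_gradient G (\<lambda>x. u x $ j))"
    using assms weak_gradient_works by (fastforce simp: W1inf_def)
qed

lemma sup_norm_upper:
  assumes "bdd_above {norm (u x) | x. x \<in> G}" "x \<in> G"
  shows "norm (u x) \<le> sup_norm G u"
  unfolding sup_norm_def using assms by (intro cSup_upper) auto

lemma sup_norm_nonneg: "bdd_above {norm (u x) | x. x \<in> G} \<Longrightarrow> 0 \<le> sup_norm G u"
  unfolding sup_norm_def by (intro cSup_upper) auto

lemma sup_norm_least: "(\<And>x. x \<in> G \<Longrightarrow> norm (u x) \<le> B) \<Longrightarrow> 0 \<le> B \<Longrightarrow> sup_norm G u \<le> B"
  unfolding sup_norm_def by (intro cSup_least) auto

lemma Lip_seminorm_upper: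
  assumes "bdd_above {norm (u x - u y) / norm (x - y) | x y. x \<in> G \<and> y \<in> G \<and> x \<noteq> y}" "x \<in> G" "y \<in> G"
  shows "norm (u x - u y) \<le> Lip_seminorm G u * norm (x - y)"
proof (cases "x = y")
  case False
  then have "norm (u x - u y) / norm (x - y) \<le> Lip_seminorm G u"
    unfolding Lip_seminorm_def using assms by (intro cSup_upper) auto
  then show ?thesis using False by (simp add: divide_le_eq)
qed simp

lemma Lip_seminorm_nonneg:
  "bdd_above {norm (u x - u y) / norm (x - y) | x y. x \<in> G \<and> y \<in> G \<and> x \<noteq> y} \<Longrightarrow> 0 \<le> Lip_seminorm G u"
  unfolding Lip_seminorm_def by (intro cSup_upper) auto

lemma Lip_seminorm_least:
  assumes "\<And>x y. x \<in> G \<Longrightarrow> y \<in> G \<Longrightarrow> norm (u x - u y) \<le> B * norm (x - y)" "0 \<le> B"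
  shows "Lip_seminorm G u \<le> B"
  unfolding Lip_seminorm_def using assms by (intro cSup_least) (auto simp: divide_le_eq)

lemma W1inf_add:
  assumes f: "f \<in> W1inf G" and h: "h \<in> W1inf G"
  shows "(\<lambda>x. f x + h x) \<in> W1inf G"
proof -
  obtain Bf where Bf: "\<And>x. x \<in> G \<Longrightarrow> norm (f x) \<le> Bf" using f by (auto simp: W1inf_def bounded_iff)
  obtain Bh where Bh: "\<And>x. x \<in> G \<Longrightarrow> norm (h x) \<le> Bh" using h by (auto simp: W1inf_def bounded_iff)
  have "norm (f x + h x) \<le> Bf + Bh" if "x \<in> G" for x
    using norm_triangle_mono[OF Bf[OF that] Bh[OF that]] .
  then have 1: "bounded ((\<lambda>x. f x + h x) ` G)" by (auto simp: bounded_iff)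
  have 2: "\<exists>L. L-lipschitz_on G (\<lambda>x. f x + h x)"
    using f h by (auto simp: W1inf_def intro: lipschitz_on_add)
  have "\<exists>p B. has_weak_gradient G (\<lambda>x. (f x + h x) $ j) p \<and> (AE x\<in>G in lebesgue. norm (p x) \<le> B)" for j
  proof -
    obtain p B where p: "has_weak_gradient G (\<lambda>x. f x $ j) p" "AE x\<in>G in lebesgue. norm (p x) \<le> B"
      using f unfolding W1inf_def by blast
    obtain q D where q: "has_weak_gradient G (\<lambda>x. h x $ j) q" "AE x\<in>G in lebesgue. norm (q x) \<le> D"
      using h unfolding W1inf_def by blast
    have "AE x\<in>G in lebesgue. norm (p x + q x) \<le> B + D"
      using p(2) q(2) by eventually_elim (auto intro: norm_triangle_mono)
    then show ?thesis using has_weak_gradient_add[OF p(1) q(1)] by auto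
  qed
  then show ?thesis unfolding W1inf_def using 1 2 by simp
qed

lemma W1inf_scaleR:
  assumes f: "f \<in> W1inf G"
  shows "(\<lambda>x. c *\<^sub>R f x) \<in> W1inf G"
proof -
  obtain B where B: "\<And>x. x \<in> G \<Longrightarrow> norm (f x) \<le> B" using f by (auto simp: W1inf_def bounded_iff)
  have "norm (c *\<^sub>R f x) \<le> \<bar>c\<bar> * B" if "x \<in> G" for x
    using mult_left_mono[OF B[OF that], of "\<bar>c\<bar>"] by simp
  then have 1: "bounded ((\<lambda>x. c *\<^sub>R f x) ` G)" unfolding bounded_iff by blast
  have 2: "\<exists>L. L-lipschitz_on G (\<lambda>x. c *\<^sub>R f x)"
    using f by (auto simp: W1inf_def intro: lipschitz_on_cmult)
  have "\<exists>p B. has_weak_gradient G (\<lambda>x. (c *\<^sub>R f x) $ j) p \<and> (AE x\<in>G in lebesgue. norm (p x) \<le> B)" for j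
  proof -
    obtain p B where p: "has_weak_gradient G (\<lambda>x. f x $ j) p" "AE x\<in>G in lebesgue. norm (p x) \<le> B"
      using f unfolding W1inf_def by blast
    have "AE x\<in>G in lebesgue. norm (c *\<^sub>R p x) \<le> \<bar>c\<bar> * B"
      using p(2) by eventually_elim (auto intro: mult_left_mono)
    moreover have "has_weak_gradient G (\<lambda>x. (c *\<^sub>R f x) $ j) (\<lambda>x. c *\<^sub>R p x)"
      using has_weak_gradient_scaleR[OF p(1), of c] by simp
    ultimately show ?thesis by blast
  qed
  then show ?thesis unfolding W1inf_def using 1 2 by simp
qed

lemma W1inf_zero: "(\<lambda>x. 0) \<in> W1inf G"
proof -
  have "has_weak_gradient G (\<lambda>x. 0) (\<lambda>x. 0)"
    by (simp add: has_weak_gradient_def locally_integrable_on_def set_integrable_def set_lebesgue_integral_def)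
  moreover have "0-lipschitz_on G (\<lambda>x. 0)" by (rule lipschitz_on_constant)
  ultimately show ?thesis
    unfolding W1inf_def by (auto intro!: exI[of _ "\<lambda>x. 0"] exI[of _ 0] simp: image_constant_conv)
qed

lemma seminormed_W1inf: "seminormed_functions (W1inf G) (W1inf_norm G)"
proof
  show "linear_subspace (W1inf G)"
    unfolding linear_subspace_def using W1inf_zero W1inf_add W1inf_scaleR by blast
  fix f assume f: "f \<in> W1inf G"
  note bf = W1infD(1,2)[OF f]
  show "0 \<le> W1inf_norm G f"
    unfolding W1inf_norm_def using sup_norm_nonneg[OF bf(1)] Lip_seminorm_nonneg[OF bf(2)] by simp
  show "W1inf_norm G (\<lambda>x. c *\<^sub>R f x) \<le> \<bar>c\<bar> * W1inf_norm G f" for c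
  proof -
    have "sup_norm G (\<lambda>x. c *\<^sub>R f x) \<le> \<bar>c\<bar> * sup_norm G f"
      using sup_norm_upper[OF bf(1)] sup_norm_nonneg[OF bf(1)]
      by (intro sup_norm_least) (auto intro: mult_left_mono)
    moreover have "Lip_seminorm G (\<lambda>x. c *\<^sub>R f x) \<le> \<bar>c\<bar> * Lip_seminorm G f"
    proof (rule Lip_seminorm_least)
      fix x y assume "x \<in> G" "y \<in> G"
      from mult_left_mono[OF Lip_seminorm_upper[OF bf(2) this], of "\<bar>c\<bar>"]
      show "norm (c *\<^sub>R f x - c *\<^sub>R f y) \<le> \<bar>c\<bar> * Lip_seminorm G f * norm (x - y)"
        by (simp add: scaleR_diff_right[symmetric] mult.assoc)
    qed (use Lip_seminorm_nonneg[OF bf(2)] in simp)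
    ultimately show ?thesis by (simp add: W1inf_norm_def distrib_left)
  qed
  fix h assume h: "h \<in> W1inf G"
  note bh = W1infD(1,2)[OF h]
  have "sup_norm G (\<lambda>x. f x + h x) \<le> sup_norm G f + sup_norm G h"
    using sup_norm_upper[OF bf(1)] sup_norm_upper[OF bh(1)] sup_norm_nonneg[OF bf(1)] sup_norm_nonneg[OF bh(1)]
    by (intro sup_norm_least) (auto intro: norm_triangle_mono)
  moreover have "Lip_seminorm G (\<lambda>x. f x + h x) \<le> Lip_seminorm G f + Lip_seminorm G h"
  proof (rule Lip_seminorm_least)
    fix x y assume xy: "x \<in> G" "y \<in> G"
    have eq: "(f x + h x) - (f y + h y) = (f x - f y) + (h x - h y)" by simp
    show "norm ((f x + h x) - (f y + h y)) \<le> (Lip_seminorm G f + Lip_seminorm G h) * norm (x - y)"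
      unfolding eq distrib_right
      by (rule norm_triangle_mono[OF Lip_seminorm_upper[OF bf(2) xy] Lip_seminorm_upper[OF bh(2) xy]])
  qed (use Lip_seminorm_nonneg[OF bf(2)] Lip_seminorm_nonneg[OF bh(2)] in simp)
  ultimately show "W1inf_norm G (\<lambda>x. f x + h x) \<le> W1inf_norm G f + W1inf_norm G h"
    by (simp add: W1inf_norm_def)
qed

text \<open>The Lipschitz constant of \<phi>, increased by 1, bounds the difference quotients of
  \<open>\<phi> x - x\<close>, so that their supremum \<open>Lip_seminorm\<close> really dominates
  them.\<close>

lemma admissible_near_identity:
  assumes "\<phi> \<in> admissible \<Omega>0 \<Omega>"
  shows "near_identity_on (Lip_seminorm \<Omega>0 (\<lambda>x. \<phi> x - x)) \<Omega>0 \<phi>"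
    and "0 \<le> Lip_seminorm \<Omega>0 (\<lambda>x. \<phi> x - x)" "Lip_seminorm \<Omega>0 (\<lambda>x. \<phi> x - x) < 1"
proof -
  obtain L where L: "L-lipschitz_on \<Omega>0 \<phi>" using assms by (auto simp: admissible_def W1inf_def)
  have "norm ((\<phi> x - x) - (\<phi> y - y)) / norm (x - y) \<le> L + 1" if "x \<in> \<Omega>0" "y \<in> \<Omega>0" "x \<noteq> y" for x y
  proof -
    have "norm ((\<phi> x - x) - (\<phi> y - y)) \<le> norm (\<phi> x - \<phi> y) + norm (x - y)"
      using norm_triangle_ineq4[of "\<phi> x - \<phi> y" "x - y"] by (simp add: algebra_simps)
    also have "\<dots> \<le> (L + 1) * norm (x - y)"
      using lipschitz_onD[OF L that(1,2)] by (simp add: dist_norm distrib_right)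
    finally show ?thesis using that(3) by (simp add: divide_le_eq)
  qed
  then have b: "bdd_above {norm ((\<phi> x - x) - (\<phi> y - y)) / norm (x - y) | x y. x \<in> \<Omega>0 \<and> y \<in> \<Omega>0 \<and> x \<noteq> y}"
    by (intro bdd_aboveI[of _ "L + 1"]) auto
  have eq: "(\<phi> x - \<phi> y) - (x - y) = (\<phi> x - x) - (\<phi> y - y)" for x y by simp
  show "near_identity_on (Lip_seminorm \<Omega>0 (\<lambda>x. \<phi> x - x)) \<Omega>0 \<phi>"
    unfolding near_identity_on_def eq using Lip_seminorm_upper[OF b] by blast
  show "0 \<le> Lip_seminorm \<Omega>0 (\<lambda>x. \<phi> x - x)" by (rule Lip_seminorm_nonneg[OF b])
  show "Lip_seminorm \<Omega>0 (\<lambda>x. \<phi> x - x) < 1" using assms by (simp add: admissible_def)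
qed

lemma admissible_open:
  assumes \<Omega>0: "open \<Omega>0" and \<Omega>: "closure \<Omega> \<subseteq> \<Omega>0"
  shows "openin (W1inf_topology \<Omega>0) (admissible \<Omega>0 \<Omega>)"
  unfolding W1inf_topology_def openin_seminorm_topology
proof (intro conjI ballI)
  show "admissible \<Omega>0 \<Omega> \<subseteq> W1inf \<Omega>0" by (auto simp: admissible_def)
  fix \<phi> assume \<phi>: "\<phi> \<in> admissible \<Omega>0 \<Omega>"
  then have \<phi>W: "\<phi> \<in> W1inf \<Omega>0" and cl: "closure (\<phi> ` \<Omega>) \<subseteq> \<Omega>0" by (auto simp: admissible_def)
  have \<Omega>sub: "\<Omega> \<subseteq> \<Omega>0" using \<Omega> closure_subset by blast
  have "bounded (\<phi> ` \<Omega>)"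
    using \<phi>W bounded_subset[OF _ image_mono[OF \<Omega>sub]] by (auto simp: W1inf_def)
  then have "compact (closure (\<phi> ` \<Omega>))" by (simp add: compact_closure)
  then obtain r K where r: "r > 0" "compact K" "K \<subseteq> \<Omega>0" "\<And>y. y \<in> closure (\<phi> ` \<Omega>) \<Longrightarrow> cball y r \<subseteq> K"
    using compact_neighbourhood[OF _ \<Omega>0 cl] by blast
  let ?L = "Lip_seminorm \<Omega>0 (\<lambda>x. \<phi> x - x)"
  show "\<exists>e>0. \<forall>h\<in>W1inf \<Omega>0. W1inf_norm \<Omega>0 (\<lambda>x. h x - \<phi> x) < e \<longrightarrow> h \<in> admissible \<Omega>0 \<Omega>"
  \<comment> \<open>A sup-norm change below \<open>r\<close> keeps the image inside the compact
    \<open>K\<close>; a Lipschitz change below half the gap \<open>1 - ?L\<close> keeps the constant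
    below 1.\<close>
  proof (intro exI[of _ "min r ((1 - ?L) / 2)"] conjI ballI impI)
    show "0 < min r ((1 - ?L) / 2)" using r(1) admissible_near_identity(3)[OF \<phi>] by simp
    fix h assume h: "h \<in> W1inf \<Omega>0" "W1inf_norm \<Omega>0 (\<lambda>x. h x - \<phi> x) < min r ((1 - ?L) / 2)"
    interpret seminormed_functions "W1inf \<Omega>0" "W1inf_norm \<Omega>0" by (rule seminormed_W1inf)
    note b = W1infD(1,2)[OF C_diff[OF h(1) \<phi>W]]
    have small: "sup_norm \<Omega>0 (\<lambda>x. h x - \<phi> x) < r" "Lip_seminorm \<Omega>0 (\<lambda>x. h x - \<phi> x) < (1 - ?L) / 2"
      using h(2) sup_norm_nonneg[OF b(1)] Lip_seminorm_nonneg[OF b(2)] by (auto simp: W1inf_norm_def)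
    have "Lip_seminorm \<Omega>0 (\<lambda>x. h x - x) \<le> ?L + Lip_seminorm \<Omega>0 (\<lambda>x. h x - \<phi> x)"
    proof (rule Lip_seminorm_least)
      fix x y assume xy: "x \<in> \<Omega>0" "y \<in> \<Omega>0"
      have 1: "norm ((\<phi> x - \<phi> y) - (x - y)) \<le> ?L * norm (x - y)"
        using admissible_near_identity(1)[OF \<phi>] xy by (auto simp: near_identity_on_def)
      have eq: "(h x - x) - (h y - y) = ((\<phi> x - \<phi> y) - (x - y)) + ((h x - \<phi> x) - (h y - \<phi> y))" by simp
      show "norm ((h x - x) - (h y - y)) \<le> (?L + Lip_seminorm \<Omega>0 (\<lambda>x. h x - \<phi> x)) * norm (x - y)"
        unfolding eq distrib_right by (rule norm_triangle_mono[OF 1 Lip_seminorm_upper[OF b(2) xy]])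
    qed (use admissible_near_identity(2)[OF \<phi>] Lip_seminorm_nonneg[OF b(2)] in simp)
    then have "Lip_seminorm \<Omega>0 (\<lambda>x. h x - x) < 1"
      using small(2) admissible_near_identity(3)[OF \<phi>] by simp
    moreover have "h ` \<Omega> \<subseteq> K"
    proof
      fix y assume "y \<in> h ` \<Omega>"
      then obtain x where x: "x \<in> \<Omega>" "y = h x" by blast
      have "norm (h x - \<phi> x) < r"
        using le_less_trans[OF sup_norm_upper[OF b(1) subsetD[OF \<Omega>sub x(1)]] small(1)] .
      then have "y \<in> cball (\<phi> x) r" using x by (simp add: dist_norm norm_minus_commute)
      moreover have "\<phi> x \<in> closure (\<phi> ` \<Omega>)"
        using closure_subset imageI[OF x(1)] by (rule subsetD)
      ultimately show "y \<in> K" using subsetD[OF r(4)] by metis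
    qed
    then have "closure (h ` \<Omega>) \<subseteq> \<Omega>0"
      using closure_minimal[OF _ compact_imp_closed[OF r(2)]] r(3) by blast
    ultimately show "h \<in> admissible \<Omega>0 \<Omega>" using h(1) by (simp add: admissible_def)
  qed
qed

section \<open>Transport between the reference domain and its images\<close>

lemma pushforward_image:
  assumes "closure \<Omega> \<subseteq> \<Omega>0" "\<phi> \<in> admissible \<Omega>0 \<Omega>" "x \<in> \<Omega>"
  shows "pushforward \<Omega>0 \<phi> v (\<phi> x) = v x"
proof -
  have "x \<in> \<Omega>0" using assms(1,3) closure_subset by blast
  then show ?thesis
    using near_identity_inj[OF admissible_near_identity(1,3)[OF assms(2)]] by (simp add: pushforward_def)
qed

text \<open>The inverse of \<phi> is Lipschitz on the image and carries the exceptional null set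
  back to a null set.\<close>

lemma AE_admissible_pullback:
  fixes \<Omega>0 \<Omega> :: "(real^'n::finite) set"
  assumes \<Omega>: "closure \<Omega> \<subseteq> \<Omega>0" and \<phi>: "\<phi> \<in> admissible \<Omega>0 \<Omega>"
    and P: "AE y\<in>\<phi> ` \<Omega> in lebesgue. P y"
  shows "AE x\<in>\<Omega> in lebesgue. P (\<phi> x)"
proof -
  let ?L = "Lip_seminorm \<Omega>0 (\<lambda>x. \<phi> x - x)"
  have near: "near_identity_on ?L \<Omega> \<phi>" "?L < 1"
    using admissible_near_identity(1,3)[OF \<phi>] \<Omega> closure_subset[of \<Omega>] by (auto simp: near_identity_on_def)
  define \<psi> where "\<psi> = inv_into \<Omega> \<phi>"
  have \<psi>: "\<psi> (\<phi> x) = x" if "x \<in> \<Omega>" for x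
    using near_identity_inj[OF near] that by (simp add: \<psi>_def)
  then have "\<psi> ` \<phi> ` \<Omega> = \<Omega>" by (force simp: image_image)
  moreover have "AE x\<in>\<psi> ` \<phi> ` \<Omega> in lebesgue. P (\<phi> x)"
    by (rule AE_lipschitz_image[OF P near_identity_inverse_lipschitz[OF near \<psi>]]) (auto simp: \<psi>)
  ultimately show ?thesis by simp
qed

text \<open>Stated for any \<open>w\<close> with \<open>w (\<phi> x) = v x\<close> almost
  everywhere, so that it applies to a minimizer, which is known only as a representative, and to a
  transported competitor alike.\<close>

lemma energy_eq_ref_energy:
  fixes \<Omega>0 \<Omega> :: "(real^'n::finite) set"
  assumes \<Omega>0: "bounded \<Omega>0" "open \<Omega>0" and \<Omega>: "open \<Omega>" "closure \<Omega> \<subseteq> \<Omega>0"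
    and \<phi>: "\<phi> \<in> admissible \<Omega>0 \<Omega>" and v: "v \<in> H1 \<Omega>"
    and int: "set_integrable lebesgue \<Omega> (ref_density W \<Omega>0 \<Omega> v \<phi>)"
    and w: "AE x\<in>\<Omega> in lebesgue. w (\<phi> x) = v x"
  shows "energy W w (\<phi> ` \<Omega>) = ref_energy W \<Omega>0 \<Omega> v \<phi>"
proof -
  let ?L = "Lip_seminorm \<Omega>0 (\<lambda>x. \<phi> x - x)"
  note near = admissible_near_identity[OF \<phi>]
  have \<Omega>sub: "\<Omega> \<subseteq> \<Omega>0" using \<Omega>(2) closure_subset by blast
  have b\<Omega>: "bounded \<Omega>" using bounded_subset[OF \<Omega>0(1) \<Omega>sub] .
  have \<phi>W: "\<phi> \<in> W1inf \<Omega>0" using \<phi> by (simp add: admissible_def)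
  let ?p = "\<lambda>j. weak_gradient \<Omega>0 (\<lambda>x. \<phi> x $ j)"
  have "compact (closure \<Omega>)" using b\<Omega> by (simp add: compact_closure)
  moreover have "\<forall>x\<in>\<Omega>0. \<forall>y\<in>\<Omega>0. norm ((\<phi> x - \<phi> y) - (x - y)) \<le> ?L * norm (x - y)"
    using near(1) by (simp add: near_identity_on_def)
  ultimately obtain \<Phi> \<delta> where A: "\<forall>k m j. Ck m (\<lambda>x. \<Phi> k x $ j)"
    "\<forall>k. \<forall>x\<in>\<Omega>. \<forall>y\<in>\<Omega>. norm ((\<Phi> k x - \<Phi> k y) - (x - y)) \<le> ?L * norm (x - y)"
    "\<forall>k. \<forall>x\<in>\<Omega>. norm (\<Phi> k x - \<phi> x) \<le> \<delta> k" "\<delta> \<longlonglongrightarrow> 0"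
    "AE x\<in>\<Omega> in lebesgue. \<forall>i j. (\<lambda>k. jacobian (\<Phi> k) x $ j $ i) \<longlonglongrightarrow> ?p j x $ i"
    using smooth_approximation[OF \<Omega>0(2) _ \<Omega>(2) near(2) _ W1infD(3)[OF \<phi>W]] by (elim meta_impE exE conjE)
  \<comment> \<open>The approximation delivers Jacobians with the component as row index, whereas
    \<open>gradT\<close> has it as column index; the transposition also makes
    \<open>matrix_inv (transpose (J x))\<close> equal to \<open>A_mat\<close>.\<close>
  define J where "J x = transpose (gradT \<Omega>0 \<phi> x)" for x
  interpret smoothly_approximated \<Omega> \<phi> ?L J \<Phi> \<delta>
  proof
    show "near_identity_on ?L \<Omega> \<phi>" using near(1) \<Omega>sub by (auto simp: near_identity_on_def)
    show "near_identity_on ?L \<Omega> (\<Phi> k)" for k using A(2) by (auto simp: near_identity_on_def)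
    show "AE x\<in>\<Omega> in lebesgue. \<forall>i j. (\<lambda>k. jacobian (\<Phi> k) x $ j $ i) \<longlonglongrightarrow> J x $ j $ i"
      using A(5) by (simp add: J_def transpose_def gradT_def)
  qed (use A \<Omega> b\<Omega> near in auto)
  have w\<psi>: "AE y\<in>\<phi> ` \<Omega> in lebesgue. w y = v (\<psi> y)"
    using AE_transfer_to_image[OF w] by eventually_elim (auto simp: \<psi>_\<phi>)
  obtain p where "has_weak_gradient \<Omega> v p" using v by (auto simp: H1_def)
  then have grad: "has_weak_gradient \<Omega> v (weak_gradient \<Omega> v)" by (rule weak_gradient_works)
  have dens: "ref_density W \<Omega>0 \<Omega> v \<phi>
      = (\<lambda>x. W (\<phi> x) (v x) (matrix_inv (transpose (J x)) *v weak_gradient \<Omega> v x) * det (J x))"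
    by (simp add: ref_density_def[abs_def] A_mat_def kappa_def J_def transpose_transpose det_transpose)
  show "energy W w (\<phi> ` \<Omega>) = ref_energy W \<Omega>0 \<Omega> v \<phi>"
    using energy_transformation[OF grad w\<psi> int[unfolded dens]] unfolding ref_energy_def dens .
qed

theorem theorem0p4p3:
  fixes \<Omega>0 \<Omega> :: "(real^'n::finite) set"
    and W :: "real^'n \<Rightarrow> real \<Rightarrow> real^'n \<Rightarrow> real"
    and g :: "real^'n \<Rightarrow> real"
    and V \<U>0 :: "(real^'n \<Rightarrow> real) set"
    and \<O>0 :: "(real^'n \<Rightarrow> real^'n) set"
    and u :: "(real^'n \<Rightarrow> real^'n) \<Rightarrow> (real^'n \<Rightarrow> real)"
  assumes "bounded \<Omega>0" and "convex \<Omega>0" and "open \<Omega>0"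
    and "open \<Omega>" and "closure \<Omega> \<subseteq> \<Omega>0"
    and W_integrals: "\<And>v \<phi>. v \<in> H1 \<Omega> \<Longrightarrow> \<phi> \<in> admissible \<Omega>0 \<Omega> \<Longrightarrow>
          set_integrable lebesgue \<Omega> (ref_density W \<Omega>0 \<Omega> v \<phi>)"
    and "g \<in> H1 \<Omega>"
    and "linear_subspace V" and "closedin (H1_topology \<Omega>) V"
    and "H10 \<Omega> \<subseteq> V" and "V \<subseteq> H1 \<Omega>"
    and E_C0: "continuous_map
          (prod_topology (H1_topology \<Omega>) (subtopology (W1inf_topology \<Omega>0) (admissible \<Omega>0 \<Omega>)))
          euclideanreal
          (\<lambda>(v, \<phi>). ref_energy W \<Omega>0 \<Omega> v \<phi>)"
    and E_C1: "\<And>v. v \<in> H1 \<Omega> \<Longrightarrow>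
          C1_functional_on (W1inf \<Omega>0) (W1inf_norm \<Omega>0) (admissible \<Omega>0 \<Omega>) (ref_energy W \<Omega>0 \<Omega> v)"
    and dE_C0: "continuous_map
          (prod_topology (H1_topology \<Omega>) (subtopology (W1inf_topology \<Omega>0) (admissible \<Omega>0 \<Omega>)))
          (dual_topology (W1inf \<Omega>0) (W1inf_norm \<Omega>0))
          (\<lambda>(v, \<phi>). W1inf_derivative \<Omega>0 (ref_energy W \<Omega>0 \<Omega> v) \<phi>)"
    and "openin (subtopology (H1_topology \<Omega>) V) \<U>0"
    and "openin (subtopology (W1inf_topology \<Omega>0) (admissible \<Omega>0 \<Omega>)) \<O>0"
    and "id \<in> \<O>0"
    and minimizer: "\<And>\<phi>. \<phi> \<in> \<O>0 \<Longrightarrow>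
          is_arg_min (\<lambda>w. energy W w (\<phi> ` \<Omega>)) (\<lambda>w. w \<in> transported_set \<Omega>0 \<Omega> \<U>0 g \<phi>) (u \<phi>)"
    and u_C0: "continuous_map (subtopology (W1inf_topology \<Omega>0) \<O>0) (H1_topology \<Omega>)
          (\<lambda>\<phi>. pullback \<phi> (u \<phi>))"
  shows "C1_functional_on (W1inf \<Omega>0) (W1inf_norm \<Omega>0) \<O>0 (E_star W \<Omega> u) \<and>
         (\<forall>\<phi>\<in>\<O>0. W1inf_derivative \<Omega>0 (E_star W \<Omega> u) \<phi> =
                 W1inf_derivative \<Omega>0 (ref_energy W \<Omega>0 \<Omega> (pullback \<phi> (u \<phi>))) \<phi>) \<and>
         W1inf_derivative \<Omega>0 (E_star W \<Omega> u) id =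
           W1inf_derivative \<Omega>0 (ref_energy W \<Omega>0 \<Omega> (u id)) id"
proof -
  interpret seminormed_functions "W1inf \<Omega>0" "W1inf_norm \<Omega>0" by (rule seminormed_W1inf)
  let ?S = "admissible \<Omega>0 \<Omega>" and ?T = "W1inf_topology \<Omega>0"
  let ?p = "\<lambda>\<phi>. pullback \<phi> (u \<phi>)"
  note energy_eq = energy_eq_ref_energy[OF \<open>bounded \<Omega>0\<close> \<open>open \<Omega>0\<close> \<open>open \<Omega>\<close> \<open>closure \<Omega> \<subseteq> \<Omega>0\<close>]
  have S: "openin ?T ?S" by (rule admissible_open[OF \<open>open \<Omega>0\<close> \<open>closure \<Omega> \<subseteq> \<Omega>0\<close>])
  have \<O>0: "openin ?T \<O>0" "\<O>0 \<subseteq> ?S"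
    using openin_trans_full[OF \<open>openin (subtopology ?T ?S) \<O>0\<close> S]
      openin_imp_subset[OF \<open>openin (subtopology ?T ?S) \<O>0\<close>] by auto
  have \<O>0W: "\<O>0 \<subseteq> W1inf \<Omega>0" using \<O>0(2) by (auto simp: admissible_def)
  have pH1: "?p \<phi> \<in> H1 \<Omega>" if "\<phi> \<in> \<O>0" for \<phi>
    using continuous_map_funspace[OF u_C0] that \<O>0W by (auto simp: Pi_iff H1_topology_def W1inf_topology_def)
  have F_eq: "E_star W \<Omega> u \<phi> = ref_energy W \<Omega>0 \<Omega> (?p \<phi>) \<phi>" if \<phi>: "\<phi> \<in> \<O>0" for \<phi>
    unfolding E_star_def
    using \<phi> \<O>0(2) pH1[OF \<phi>] W_integrals by (intro energy_eq) (auto simp: pullback_def)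
  have F_le: "E_star W \<Omega> u \<theta> \<le> ref_energy W \<Omega>0 \<Omega> (?p \<phi>) \<theta>" if \<phi>: "\<phi> \<in> \<O>0" and \<theta>: "\<theta> \<in> \<O>0" for \<phi> \<theta>
  proof -
    obtain v where v: "v \<in> \<U>0" "AE y\<in>\<phi> ` \<Omega> in lebesgue. u \<phi> y = pushforward \<Omega>0 \<phi> (\<lambda>x. v x + g x) y"
      using minimizer[OF \<phi>] by (auto simp: is_arg_min_def transported_set_def)
    \<comment> \<open>The competitor at \<theta> is the minimizer at \<phi> transported through the
      reference domain: the same \<open>v \<in> \<U>0\<close> is pushed forward by \<theta> instead
      of \<phi>, so it is admissible and its pullback agrees with that of \<open>u \<phi>\<close>
      almost everywhere.\<close>
    let ?w = "pushforward \<Omega>0 \<theta> (\<lambda>x. v x + g x)"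
    have "AE x\<in>\<Omega> in lebesgue. ?w (\<theta> x) = ?p \<phi> x"
      using AE_admissible_pullback[OF \<open>closure \<Omega> \<subseteq> \<Omega>0\<close> subsetD[OF \<O>0(2) \<phi>] v(2)]
    proof eventually_elim
      case (elim x)
      then show ?case
        using pushforward_image[OF \<open>closure \<Omega> \<subseteq> \<Omega>0\<close> subsetD[OF \<O>0(2) \<phi>], of x]
          pushforward_image[OF \<open>closure \<Omega> \<subseteq> \<Omega>0\<close> subsetD[OF \<O>0(2) \<theta>], of x]
        by (simp add: pullback_def)
    qed
    then have "energy W ?w (\<theta> ` \<Omega>) = ref_energy W \<Omega>0 \<Omega> (?p \<phi>) \<theta>"
      using \<theta> \<O>0(2) pH1[OF \<phi>] W_integrals by (intro energy_eq) auto
    moreover have "?w \<in> transported_set \<Omega>0 \<Omega> \<U>0 g \<theta>"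
      using v(1) by (auto simp: transported_set_def)
    ultimately show ?thesis
      using minimizer[OF \<theta>] by (force simp: is_arg_min_def E_star_def not_less)
  qed
  have deriv: "\<exists>M. has_dual_derivative (W1inf \<Omega>0) (W1inf_norm \<Omega>0) (ref_energy W \<Omega>0 \<Omega> v) M \<phi>"
    if "v \<in> topspace (H1_topology \<Omega>)" "\<phi> \<in> ?S" for v \<phi>
    using E_C1[of v] that by (auto simp: C1_functional_on_def H1_topology_def)
  note env = envelope_theorem[where S = ?S and Q = \<O>0 and X = "H1_topology \<Omega>" and \<E> = "ref_energy W \<Omega>0 \<Omega>"
      and p = ?p and F = "E_star W \<Omega> u", OF S[unfolded W1inf_topology_def] \<O>0(1)[unfolded W1inf_topology_def] \<O>0(2)
      deriv dE_C0[unfolded W1inf_topology_def W1inf_derivative_def] u_C0[unfolded W1inf_topology_def] F_eq F_le]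
  have 1: "C1_functional_on (W1inf \<Omega>0) (W1inf_norm \<Omega>0) \<O>0 (E_star W \<Omega> u)"
    by (rule env(1))
  have 2: "W1inf_derivative \<Omega>0 (E_star W \<Omega> u) \<phi> = W1inf_derivative \<Omega>0 (ref_energy W \<Omega>0 \<Omega> (?p \<phi>)) \<phi>"
    if "\<phi> \<in> \<O>0" for \<phi>
    unfolding W1inf_derivative_def using that by (rule env(2)[rotated -1])
  show ?thesis
    using 1 2 2[OF \<open>id \<in> \<O>0\<close>] by (simp add: pullback_def)
qed

end
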